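(* Let $\mathcal{E}$ be a category with finite limits and $p:E\to B$ an exponentiable morphism of $\mathcal{E}$. There is a bijection between the following types of data: (1) Unit and multiplication 2-cells in $\mathbf{Poly}_{\mathcal{E}}$ making the polynomial $$1\longleftarrow E\xrightarrow{\ p\ }B\longrightarrow1$$ the underlying endoarrow of a monad in $\mathbf{Poly}_{\mathcal{E}}$. (2) Double category structures on $\mathcal{D}(p)$ making $\mathcal{U}_p:\mathcal{D}(p)\to\mathcal{D}(\mathcal{E})$ a double functor.
   Context: A morphism $f:X\to Y$ of $\mathcal{E}$ is exponentiable when the pullback functor $\Delta_f:\mathcal{E}/Y\to\mathcal{E}/X$ has a right adjoint $\Pi_f$. $\mathbf{Poly}_{\mathcal{E}}$ is the bicategory with the objects of $\mathcal{E}$; 1-cells $X\to Y$ are polynomials $X\xleftarrow{p_1}A\xrightarrow{p_2}C\xrightarrow{p_3}Y$ with $p_2$ exponentiable; 2-cells from this to $X\xleftarrow{q_1}A'\xrightarrow{q_2}C'\xrightarrow{q_3}Y$ are pairs $f_0:A\to A'$, $f_1:C\to C'$ with $q_1f_0=p_1$, $q_3f_1=p_3$ and $q_2f_0=f_1p_2$ a pullback square. Identities have all three maps identities. The composite $q\circ p$ of $p=(X\xleftarrow{p_1}A\xrightarrow{p_2}C\xrightarrow{p_3}Y)$ and $q=(Y\xleftarrow{q_1}A'\xrightarrow{q_2}C'\xrightarrow{q_3}Z)$ is: form the pullback $P=C\times_YA'$ with projections $\pi_1:P\to C$, $\pi_2:P\to A'$; form a distributivity pullback $(\varepsilon:F\to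 P,\ e:F\to G,\ r:G\to C')$ around $(q_2,\pi_2)$; form the pullback $H$ of $p_2$ and $\pi_1\varepsilon$; then $q\circ p=(X\leftarrow H\to G\to Z)$ with maps $H\to A\xrightarrow{p_1}X$, $H\to F\xrightarrow{e}G$, $q_3r$. Horizontal composition of 2-cells and coherence isomorphisms are induced by the universal properties. Here a distributivity pullback around composable $(f:U\to V,\ g:Z\to U)$ is a terminal object of the category of triples $(a:X\to Z,\ b:X\to Y,\ c:Y\to V)$ such that $fga=cb$ is a pullback square exhibiting $X$ as the pullback of $f$ and $c$, with morphisms the pairs $(s:X\to X',\ t:Y\to Y')$ with $a's=a$, $b's=tb$, $c't=c$. A $p$-fibration is an arrow $f:X\to Y$ of $\mathcal{E}$ together with $u:X\to E$, $v:Y\to B$ such that $pu=vf$ is a pullback square. A morphism of $p$-fibrations $(f_1:X_1\to Y_1,u_1,v_1)\to(f_2:X_2\to Y_2,u_2,v_2)$ is a pair $u_3:X_1\to X_2$, $v_3:Y_1\to Y_2$ with $f_2u_3=v_3f_1$, $u_2u_3=u_1$, $v_2v_3=v_1$. A double category (double functor) is a category (functor) internal to $\mathbf{CAT}$. $\mathcal{D}(\mathcal{E})$ is the double category whose objects are those of $\mathcal{E}$, whose vertical and horizontal arrows are the morphisms of $\mathcal{E}$, and whose squares are the commutative squares of $\mathcal{E}$; so its category of objects and vertical arrows is $\mathcal{E}$ and its category of horizontal arrows and squares is the arrow category $\mathcal{E}^{[1]}$. $\mathcal{D}(p)$ is the graph internal to $\mathbf{CAT}$ with $\mathcal{D}(p)_0=\mathcal{E}$,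 with $\mathcal{D}(p)_1$ the category of $p$-fibrations and their morphisms, and with source and target functors given by the domain and codomain of the underlying arrow $f$. $\mathcal{U}_p:\mathcal{D}(p)\to\mathcal{D}(\mathcal{E})$ is the morphism of internal graphs with $(\mathcal{U}_p)_0=1_{\mathcal{E}}$ and $(\mathcal{U}_p)_1$ the functor forgetting $p$-fibration structures. A double category structure on $\mathcal{D}(p)$ consists of horizontal identity and horizontal composition functors making this internal graph a category internal to $\mathbf{CAT}$. *)

theory Defs
  imports Main "HOL-Library.FuncSet"
begin

section \<open>Categories, functors, adjunctions, limits\<close>

record ('o, 'm) category =
  Obj :: "'o set"
  Arr :: "'m set"
  Dom :: "'m \<Rightarrow> 'o"
  Cod :: "'m \<Rightarrow> 'o"
  Idn :: "'o \<Rightarrow> 'm"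
  Comp :: "'m \<Rightarrow> 'm \<Rightarrow> 'm"  (infixr \<open>\<cdot>\<index>\<close> 70)

definition hom :: "('o, 'm) category \<Rightarrow> 'o \<Rightarrow> 'o \<Rightarrow> 'm set" where
  "hom C x y = {f \<in> Arr C. Dom C f = x \<and> Cod C f = y}"

definition is_category :: "('o, 'm) category \<Rightarrow> bool" where
  "is_category C \<longleftrightarrow>
     (\<forall>f\<in>Arr C. Dom C f \<in> Obj C \<and> Cod C f \<in> Obj C) \<and>
     (\<forall>x\<in>Obj C. Idn C x \<in> hom C x x) \<and>
     (\<forall>f\<in>Arr C. \<forall>g\<in>Arr C. Cod C f = Dom C g \<longrightarrow> g \<cdot>\<^bsub>C\<^esub> f \<in> hom C (Dom C f) (Cod C g)) \<and>
     (\<forall>f\<in>Arr C. f \<cdot>\<^bsub>C\<^esub> Idn C (Dom C f) = f \<and> Idn C (Cod C f) \<cdot>\<^bsub>C\<^esub> f = f) \<and>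
     (\<forall>f\<in>Arr C. \<forall>g\<in>Arr C. \<forall>h\<in>Arr C. Cod C f = Dom C g \<and> Cod C g = Dom C h \<longrightarrow>
        (h \<cdot>\<^bsub>C\<^esub> g) \<cdot>\<^bsub>C\<^esub> f = h \<cdot>\<^bsub>C\<^esub> (g \<cdot>\<^bsub>C\<^esub> f))"

record ('o, 'm, 'p, 'n) funct =
  FObj :: "'o \<Rightarrow> 'p"
  FArr :: "'m \<Rightarrow> 'n"

text \<open>Functors are extensional (\<open>undefined\<close> off the objects and arrows of their domain), so that
  HOL equality of functors is equality of functors.\<close>

definition is_functor ::
  "('o, 'm) category \<Rightarrow> ('p, 'n) category \<Rightarrow> ('o, 'm, 'p, 'n) funct \<Rightarrow> bool" where
  "is_functor C D F \<longleftrightarrow>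
     FObj F \<in> Obj C \<rightarrow>\<^sub>E Obj D \<and> FArr F \<in> Arr C \<rightarrow>\<^sub>E Arr D \<and>
     (\<forall>f\<in>Arr C. Dom D (FArr F f) = FObj F (Dom C f) \<and> Cod D (FArr F f) = FObj F (Cod C f)) \<and>
     (\<forall>x\<in>Obj C. FArr F (Idn C x) = Idn D (FObj F x)) \<and>
     (\<forall>f\<in>Arr C. \<forall>g\<in>Arr C. Cod C f = Dom C g \<longrightarrow>
        FArr F (g \<cdot>\<^bsub>C\<^esub> f) = FArr F g \<cdot>\<^bsub>D\<^esub> FArr F f)"

definition identity_functor :: "('o, 'm) category \<Rightarrow> ('o, 'm, 'o, 'm) funct" where
  "identity_functor C = \<lparr>FObj = \<lambda>x\<in>Obj C. x, FArr = \<lambda>f\<in>Arr C. f\<rparr>"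

definition right_adjoint_of ::
  "('o, 'm) category \<Rightarrow> ('p, 'n) category \<Rightarrow> ('o, 'm, 'p, 'n) funct \<Rightarrow> ('p, 'n, 'o, 'm) funct \<Rightarrow> bool"
where
  "right_adjoint_of C D F G \<longleftrightarrow>
     is_functor C D F \<and> is_functor D C G \<and>
     (\<exists>\<phi>. (\<forall>x\<in>Obj C. \<forall>y\<in>Obj D. bij_betw (\<phi> x y) (hom D (FObj F x) y) (hom C x (FObj G y))) \<and>
          (\<forall>x'\<in>Obj C. \<forall>x\<in>Obj C. \<forall>y\<in>Obj D. \<forall>y'\<in>Obj D.
             \<forall>f\<in>hom C x' x. \<forall>k\<in>hom D y y'. \<forall>h\<in>hom D (FObj F x) y.
               \<phi> x' y' (k \<cdot>\<^bsub>D\<^esub> h \<cdot>\<^bsub>D\<^esub> FArr F f) = FArr G k \<cdot>\<^bsub>C\<^esub> \<phi> x y h \<cdot>\<^bsub>C\<^esub> f))"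

definition is_cone ::
  "('i, 'j) category \<Rightarrow> ('o, 'm) category \<Rightarrow> ('i, 'j, 'o, 'm) funct \<Rightarrow> 'o \<Rightarrow> ('i \<Rightarrow> 'm) \<Rightarrow> bool" where
  "is_cone J C D x \<pi> \<longleftrightarrow> x \<in> Obj C \<and> (\<forall>i\<in>Obj J. \<pi> i \<in> hom C x (FObj D i)) \<and>
     (\<forall>k\<in>Arr J. FArr D k \<cdot>\<^bsub>C\<^esub> \<pi> (Dom J k) = \<pi> (Cod J k))"

definition is_limit ::
  "('i, 'j) category \<Rightarrow> ('o, 'm) category \<Rightarrow> ('i, 'j, 'o, 'm) funct \<Rightarrow> 'o \<Rightarrow> ('i \<Rightarrow> 'm) \<Rightarrow> bool" where
  "is_limit J C D x \<pi> \<longleftrightarrow> is_cone J C D x \<pi> \<and>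
     (\<forall>y \<rho>. is_cone J C D y \<rho> \<longrightarrow> (\<exists>!h. h \<in> hom C y x \<and> (\<forall>i\<in>Obj J. \<pi> i \<cdot>\<^bsub>C\<^esub> h = \<rho> i)))"

text \<open>Every finite category is isomorphic to one whose objects and arrows are natural numbers.\<close>

definition has_finite_limits :: "('o, 'm) category \<Rightarrow> bool" where
  "has_finite_limits C \<longleftrightarrow>
     (\<forall>(J :: (nat, nat) category) D.
        is_category J \<and> finite (Obj J) \<and> finite (Arr J) \<and> is_functor J C D \<longrightarrow>
        (\<exists>x \<pi>. is_limit J C D x \<pi>))"

definition is_terminal :: "('o, 'm) category \<Rightarrow> 'o \<Rightarrow> bool" where
  "is_terminal C t \<longleftrightarrow> t \<in> Obj C \<and> (\<forall>x\<in>Obj C. \<exists>!h. h \<in> hom C x t)"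

definition terminal :: "('o, 'm) category \<Rightarrow> 'o" where
  "terminal C = (SOME t. is_terminal C t)"

definition to_terminal :: "('o, 'm) category \<Rightarrow> 'o \<Rightarrow> 'm" where
  "to_terminal C x = (THE h. h \<in> hom C x (terminal C))"

text \<open>\<open>is_pullback C f g a b\<close>: the square \<open>f a = g b\<close> is a pullback, with \<open>a\<close> the projection to the
  domain of \<open>f\<close> and \<open>b\<close> the projection to the domain of \<open>g\<close>.\<close>

definition is_pullback :: "('o, 'm) category \<Rightarrow> 'm \<Rightarrow> 'm \<Rightarrow> 'm \<Rightarrow> 'm \<Rightarrow> bool" where
  "is_pullback C f g a b \<longleftrightarrow>
     f \<in> Arr C \<and> g \<in> Arr C \<and> a \<in> Arr C \<and> b \<in> Arr C \<and>
     Cod C f = Cod C g \<and> Dom C a = Dom C b \<and> Cod C a = Dom C f \<and> Cod C b = Dom C g \<and>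
     f \<cdot>\<^bsub>C\<^esub> a = g \<cdot>\<^bsub>C\<^esub> b \<and>
     (\<forall>x\<in>Arr C. \<forall>y\<in>Arr C.
        Dom C x = Dom C y \<and> Cod C x = Dom C f \<and> Cod C y = Dom C g \<and> f \<cdot>\<^bsub>C\<^esub> x = g \<cdot>\<^bsub>C\<^esub> y \<longrightarrow>
        (\<exists>!w. w \<in> hom C (Dom C x) (Dom C a) \<and> a \<cdot>\<^bsub>C\<^esub> w = x \<and> b \<cdot>\<^bsub>C\<^esub> w = y))"

text \<open>Chosen pullbacks, and the arrow \<open>w\<close> with \<open>a w = x\<close> and \<open>b w = y\<close> induced by a pullback with
  projections \<open>a\<close>, \<open>b\<close>.\<close>

definition pb :: "('o, 'm) category \<Rightarrow> 'm \<Rightarrow> 'm \<Rightarrow> 'm \<times> 'm" where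
  "pb C f g = (SOME (a, b). is_pullback C f g a b)"

definition pb1 :: "('o, 'm) category \<Rightarrow> 'm \<Rightarrow> 'm \<Rightarrow> 'm" where
  "pb1 C f g = fst (pb C f g)"

definition pb2 :: "('o, 'm) category \<Rightarrow> 'm \<Rightarrow> 'm \<Rightarrow> 'm" where
  "pb2 C f g = snd (pb C f g)"

definition induced :: "('o, 'm) category \<Rightarrow> 'm \<Rightarrow> 'm \<Rightarrow> 'm \<Rightarrow> 'm \<Rightarrow> 'm" where
  "induced C a b x y =
     (THE w. w \<in> hom C (Dom C x) (Dom C a) \<and> a \<cdot>\<^bsub>C\<^esub> w = x \<and> b \<cdot>\<^bsub>C\<^esub> w = y)"

text \<open>The category with given objects, whose arrows \<open>x \<rightarrow> y\<close> are the \<open>h\<close> with \<open>R x h y\<close>. Arrows are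
  stored as triples \<open>(x, h, y)\<close> so that they determine their source and target.\<close>

abbreviation source :: "'a \<times> 'h \<times> 'a \<Rightarrow> 'a" where "source \<alpha> \<equiv> fst \<alpha>"
abbreviation label :: "'a \<times> 'h \<times> 'a \<Rightarrow> 'h" where "label \<alpha> \<equiv> fst (snd \<alpha>)"
abbreviation target :: "'a \<times> 'h \<times> 'a \<Rightarrow> 'a" where "target \<alpha> \<equiv> snd (snd \<alpha>)"

definition category_of ::
  "'a set \<Rightarrow> ('a \<Rightarrow> 'h \<Rightarrow> 'a \<Rightarrow> bool) \<Rightarrow> ('a \<Rightarrow> 'h) \<Rightarrow> ('h \<Rightarrow> 'h \<Rightarrow> 'h) \<Rightarrow> ('a, 'a \<times> 'h \<times> 'a) category"
where
  "category_of A R i c =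
     \<lparr>Obj = A, Arr = {(x, h, y). x \<in> A \<and> y \<in> A \<and> R x h y},
      Dom = (\<lambda>\<alpha>. source \<alpha>), Cod = (\<lambda>\<alpha>. target \<alpha>),
      Idn = (\<lambda>x. (x, i x, x)),
      Comp = (\<lambda>\<beta> \<alpha>. (source \<alpha>, c (label \<beta>) (label \<alpha>), target \<beta>))\<rparr>"

definition pair_comp :: "('o, 'm) category \<Rightarrow> 'm \<times> 'm \<Rightarrow> 'm \<times> 'm \<Rightarrow> 'm \<times> 'm" where
  "pair_comp C = (\<lambda>(g0, g1) (f0, f1). (g0 \<cdot>\<^bsub>C\<^esub> f0, g1 \<cdot>\<^bsub>C\<^esub> f1))"

section \<open>Exponentiable morphisms and distributivity pullbacks\<close>

definition slice :: "('o, 'm) category \<Rightarrow> 'o \<Rightarrow> ('m, 'm \<times> 'm \<times> 'm) category" where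
  "slice C y = category_of {a \<in> Arr C. Cod C a = y}
     (\<lambda>a h b. h \<in> hom C (Dom C a) (Dom C b) \<and> b \<cdot>\<^bsub>C\<^esub> h = a)
     (\<lambda>a. Idn C (Dom C a)) (Comp C)"

definition pullback_functor ::
  "('o, 'm) category \<Rightarrow> 'm \<Rightarrow> ('m, 'm \<times> 'm \<times> 'm, 'm, 'm \<times> 'm \<times> 'm) funct" where
  "pullback_functor C f =
     \<lparr>FObj = \<lambda>a\<in>Obj (slice C (Cod C f)). pb1 C f a,
      FArr = \<lambda>\<alpha>\<in>Arr (slice C (Cod C f)).
        (pb1 C f (source \<alpha>),
         induced C (pb1 C f (target \<alpha>)) (pb2 C f (target \<alpha>))
           (pb1 C f (source \<alpha>)) (label \<alpha> \<cdot>\<^bsub>C\<^esub> pb2 C f (source \<alpha>)),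
         pb1 C f (target \<alpha>))\<rparr>"

definition exponentiable :: "('o, 'm) category \<Rightarrow> 'm \<Rightarrow> bool" where
  "exponentiable C f \<longleftrightarrow> f \<in> Arr C \<and>
     (\<exists>R. right_adjoint_of (slice C (Cod C f)) (slice C (Dom C f)) (pullback_functor C f) R)"

text \<open>The category of pullbacks around \<open>(f, g)\<close>: triples \<open>(a, b, c)\<close> such that \<open>f (g a) = c b\<close> is a
  pullback square.\<close>

definition pullbacks_around ::
  "('o, 'm) category \<Rightarrow> 'm \<Rightarrow> 'm \<Rightarrow>
   ('m \<times> 'm \<times> 'm, ('m \<times> 'm \<times> 'm) \<times> ('m \<times> 'm) \<times> ('m \<times> 'm \<times> 'm)) category" where
  "pullbacks_around C f g = category_of
     {(a, b, c). a \<in> Arr C \<and> Cod C a = Dom C g \<and> is_pullback C f c (g \<cdot>\<^bsub>C\<^esub> a) b}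
     (\<lambda>(a, b, c) (s, t) (a', b', c').
        s \<in> hom C (Dom C a) (Dom C a') \<and> t \<in> hom C (Dom C c) (Dom C c') \<and>
        a' \<cdot>\<^bsub>C\<^esub> s = a \<and> b' \<cdot>\<^bsub>C\<^esub> s = t \<cdot>\<^bsub>C\<^esub> b \<and> c' \<cdot>\<^bsub>C\<^esub> t = c)
     (\<lambda>(a, b, c). (Idn C (Dom C a), Idn C (Dom C c)))
     (pair_comp C)"

definition distributivity_pullback :: "('o, 'm) category \<Rightarrow> 'm \<Rightarrow> 'm \<Rightarrow> 'm \<times> 'm \<times> 'm" where
  "distributivity_pullback C f g = terminal (pullbacks_around C f g)"

definition dist_induced :: "('o, 'm) category \<Rightarrow> 'm \<Rightarrow> 'm \<Rightarrow> 'm \<times> 'm \<times> 'm \<Rightarrow> 'm \<times> 'm" where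
  "dist_induced C f g T = label (to_terminal (pullbacks_around C f g) T)"

section \<open>Bicategories and monads in them\<close>

text \<open>The data of a bicategory only. \<open>Comp1 q p\<close> is \<open>q \<circ> p\<close>; \<open>HComp \<beta> \<alpha>\<close> is the horizontal composite
  \<open>\<beta> \<circ> \<alpha>\<close>; \<open>Assoc r q p : (r \<circ> q) \<circ> p \<Rightarrow> r \<circ> (q \<circ> p)\<close>; \<open>LUnit p : 1 \<circ> p \<Rightarrow> p\<close>; \<open>RUnit p : p \<circ> 1 \<Rightarrow> p\<close>.
  Vertical composition and identity 2-cells are those of the hom-categories.\<close>

record ('o, 'c, 't) bicategory_data =
  Obj0 :: "'o set"
  HomCat :: "'o \<Rightarrow> 'o \<Rightarrow> ('c, 't) category"
  Id1 :: "'o \<Rightarrow> 'c"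
  Comp1 :: "'c \<Rightarrow> 'c \<Rightarrow> 'c"
  HComp :: "'t \<Rightarrow> 't \<Rightarrow> 't"
  Assoc :: "'c \<Rightarrow> 'c \<Rightarrow> 'c \<Rightarrow> 't"
  LUnit :: "'c \<Rightarrow> 't"
  RUnit :: "'c \<Rightarrow> 't"

definition is_monad :: "('o, 'c, 't) bicategory_data \<Rightarrow> 'o \<Rightarrow> 'c \<Rightarrow> 't \<Rightarrow> 't \<Rightarrow> bool" where
  "is_monad \<B> x m \<eta> \<mu> \<longleftrightarrow>
     (let H = HomCat \<B> x x; i = Idn H m in
      x \<in> Obj0 \<B> \<and> m \<in> Obj H \<and>
      \<eta> \<in> hom H (Id1 \<B> x) m \<and> \<mu> \<in> hom H (Comp1 \<B> m m) m \<and>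
      \<mu> \<cdot>\<^bsub>H\<^esub> HComp \<B> \<mu> i = \<mu> \<cdot>\<^bsub>H\<^esub> HComp \<B> i \<mu> \<cdot>\<^bsub>H\<^esub> Assoc \<B> m m m \<and>
      \<mu> \<cdot>\<^bsub>H\<^esub> HComp \<B> \<eta> i = LUnit \<B> m \<and>
      \<mu> \<cdot>\<^bsub>H\<^esub> HComp \<B> i \<eta> = RUnit \<B> m)"

section \<open>The bicategory of polynomials\<close>

text \<open>The polynomial \<open>X \<leftarrow> A \<rightarrow> C \<rightarrow> Y\<close>.\<close>

record 'm polynomial =
  pleft :: 'm
  pmid :: 'm
  pright :: 'm

type_synonym 'm poly_cell = "'m polynomial \<times> ('m \<times> 'm) \<times> 'm polynomial"

definition polynomials :: "('o, 'm) category \<Rightarrow> 'o \<Rightarrow> 'o \<Rightarrow> 'm polynomial set" where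
  "polynomials C X Y = {p. pleft p \<in> hom C (Dom C (pmid p)) X \<and> exponentiable C (pmid p) \<and>
     pright p \<in> hom C (Cod C (pmid p)) Y}"

definition poly_hom ::
  "('o, 'm) category \<Rightarrow> 'o \<Rightarrow> 'o \<Rightarrow> ('m polynomial, 'm poly_cell) category" where
  "poly_hom C X Y = category_of (polynomials C X Y)
     (\<lambda>p (f0, f1) q.
        f0 \<in> hom C (Dom C (pmid p)) (Dom C (pmid q)) \<and>
        f1 \<in> hom C (Cod C (pmid p)) (Cod C (pmid q)) \<and>
        pleft q \<cdot>\<^bsub>C\<^esub> f0 = pleft p \<and> pright q \<cdot>\<^bsub>C\<^esub> f1 = pright p \<and>
        is_pullback C (pmid q) f1 f0 (pmid p))
     (\<lambda>p. (Idn C (Dom C (pmid p)), Idn C (Cod C (pmid p))))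
     (pair_comp C)"

definition poly_id :: "('o, 'm) category \<Rightarrow> 'o \<Rightarrow> 'm polynomial" where
  "poly_id C X = \<lparr>pleft = Idn C X, pmid = Idn C X, pright = Idn C X\<rparr>"

text \<open>The objects and arrows involved in the composite of \<open>p = (X \<leftarrow> A \<rightarrow> C \<rightarrow> Y)\<close> and
  \<open>q = (Y \<leftarrow> A' \<rightarrow> C' \<rightarrow> Z)\<close>. \<open>P\<close> is the pullback of \<open>pright p\<close> and \<open>pleft q\<close>, \<open>F\<close> and \<open>G\<close> belong to
  the distributivity pullback around \<open>(pmid q, P \<rightarrow> A')\<close>, and \<open>H\<close> is the pullback of \<open>pmid p\<close> and
  \<open>F \<rightarrow> P \<rightarrow> C\<close>:
    \<open>arr_PC : P \<rightarrow> C\<close>, \<open>arr_PA : P \<rightarrow> A'\<close>, \<open>arr_FP : F \<rightarrow> P\<close>, \<open>arr_FG : F \<rightarrow> G\<close>, \<open>arr_GC : G \<rightarrow> C'\<close>,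
    \<open>arr_FC : F \<rightarrow> C\<close>, \<open>arr_FA : F \<rightarrow> A'\<close>, \<open>arr_HA : H \<rightarrow> A\<close>, \<open>arr_HF : H \<rightarrow> F\<close>.\<close>

definition arr_PC :: "('o, 'm) category \<Rightarrow> 'm polynomial \<Rightarrow> 'm polynomial \<Rightarrow> 'm" where
  "arr_PC C q p = pb1 C (pright p) (pleft q)"

definition arr_PA :: "('o, 'm) category \<Rightarrow> 'm polynomial \<Rightarrow> 'm polynomial \<Rightarrow> 'm" where
  "arr_PA C q p = pb2 C (pright p) (pleft q)"

definition arr_FP :: "('o, 'm) category \<Rightarrow> 'm polynomial \<Rightarrow> 'm polynomial \<Rightarrow> 'm" where
  "arr_FP C q p = fst (distributivity_pullback C (pmid q) (arr_PA C q p))"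

definition arr_FG :: "('o, 'm) category \<Rightarrow> 'm polynomial \<Rightarrow> 'm polynomial \<Rightarrow> 'm" where
  "arr_FG C q p = fst (snd (distributivity_pullback C (pmid q) (arr_PA C q p)))"

definition arr_GC :: "('o, 'm) category \<Rightarrow> 'm polynomial \<Rightarrow> 'm polynomial \<Rightarrow> 'm" where
  "arr_GC C q p = snd (snd (distributivity_pullback C (pmid q) (arr_PA C q p)))"

definition arr_FC :: "('o, 'm) category \<Rightarrow> 'm polynomial \<Rightarrow> 'm polynomial \<Rightarrow> 'm" where
  "arr_FC C q p = arr_PC C q p \<cdot>\<^bsub>C\<^esub> arr_FP C q p"

definition arr_FA :: "('o, 'm) category \<Rightarrow> 'm polynomial \<Rightarrow> 'm polynomial \<Rightarrow> 'm" where
  "arr_FA C q p = arr_PA C q p \<cdot>\<^bsub>C\<^esub> arr_FP C q p"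

definition arr_HA :: "('o, 'm) category \<Rightarrow> 'm polynomial \<Rightarrow> 'm polynomial \<Rightarrow> 'm" where
  "arr_HA C q p = pb1 C (pmid p) (arr_FC C q p)"

definition arr_HF :: "('o, 'm) category \<Rightarrow> 'm polynomial \<Rightarrow> 'm polynomial \<Rightarrow> 'm" where
  "arr_HF C q p = pb2 C (pmid p) (arr_FC C q p)"

definition poly_comp :: "('o, 'm) category \<Rightarrow> 'm polynomial \<Rightarrow> 'm polynomial \<Rightarrow> 'm polynomial" where
  "poly_comp C q p =
     \<lparr>pleft = pleft p \<cdot>\<^bsub>C\<^esub> arr_HA C q p,
      pmid = arr_FG C q p \<cdot>\<^bsub>C\<^esub> arr_HF C q p,
      pright = pright q \<cdot>\<^bsub>C\<^esub> arr_GC C q p\<rparr>"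

text \<open>For \<open>\<alpha> : p \<Rightarrow> p'\<close> and \<open>\<beta> : q \<Rightarrow> q'\<close>, the arrows \<open>k : P \<rightarrow> P'\<close>, \<open>s : F \<rightarrow> F'\<close>, \<open>t : G \<rightarrow> G'\<close> and
  \<open>h : H \<rightarrow> H'\<close> are successively induced by the universal properties defining \<open>q' \<circ> p'\<close>.\<close>

definition poly_hcomp ::
  "('o, 'm) category \<Rightarrow> 'm poly_cell \<Rightarrow> 'm poly_cell \<Rightarrow> 'm poly_cell" where
  "poly_hcomp C = (\<lambda>(q, (b0, b1), q') (p, (a0, a1), p').
     let k = induced C (arr_PC C q' p') (arr_PA C q' p')
               (a1 \<cdot>\<^bsub>C\<^esub> arr_PC C q p) (b0 \<cdot>\<^bsub>C\<^esub> arr_PA C q p);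
         (s, t) = dist_induced C (pmid q') (arr_PA C q' p')
               (k \<cdot>\<^bsub>C\<^esub> arr_FP C q p, arr_FG C q p, b1 \<cdot>\<^bsub>C\<^esub> arr_GC C q p);
         h = induced C (arr_HA C q' p') (arr_HF C q' p')
               (a0 \<cdot>\<^bsub>C\<^esub> arr_HA C q p) (s \<cdot>\<^bsub>C\<^esub> arr_HF C q p)
     in (poly_comp C q p, (h, t), poly_comp C q' p'))"

text \<open>The associator. \<open>M\<close> (with projections \<open>m1\<close>, \<open>m2\<close>) is the pullback of \<open>G \<rightarrow> G''\<close> and
  \<open>F'' \<rightarrow> G''\<close>, where \<open>F, G, H\<close> belong to \<open>(r \<circ> q) \<circ> p\<close> and \<open>F'', G''\<close> to \<open>r \<circ> q\<close>. Then \<open>n : F \<rightarrow> M\<close> and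
  \<open>m1 : M \<rightarrow> G\<close> are pullbacks of the middle arrows of \<open>q\<close> and \<open>r\<close>. The distributivity pullback of
  \<open>q \<circ> p\<close> induces \<open>s\<close> and \<open>t\<close> on \<open>F\<close> and \<open>M\<close>, that of \<open>r \<circ> (q \<circ> p)\<close> induces \<open>s'\<close> and \<open>t'\<close> on \<open>M\<close> and \<open>G\<close>,
  and the pullbacks \<open>H\<close> of \<open>q \<circ> p\<close> and of \<open>r \<circ> (q \<circ> p)\<close> induce \<open>g\<close> and \<open>h\<close> on \<open>H\<close>.\<close>

definition poly_assoc ::
  "('o, 'm) category \<Rightarrow> 'm polynomial \<Rightarrow> 'm polynomial \<Rightarrow> 'm polynomial \<Rightarrow> 'm poly_cell" where
  "poly_assoc C r q p =
    (let rq = poly_comp C r q; qp = poly_comp C q p;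
         m1 = pb1 C (arr_GC C rq p) (arr_FG C r q);
         m2 = pb2 C (arr_GC C rq p) (arr_FG C r q);
         n = induced C m1 m2 (arr_FG C rq p) (arr_HF C r q \<cdot>\<^bsub>C\<^esub> arr_FA C rq p);
         j = induced C (arr_PC C q p) (arr_PA C q p)
               (arr_FC C rq p) (arr_HA C r q \<cdot>\<^bsub>C\<^esub> arr_FA C rq p);
         (s, t) = dist_induced C (pmid q) (arr_PA C q p) (j, n, arr_FC C r q \<cdot>\<^bsub>C\<^esub> m2);
         k = induced C (arr_PC C r qp) (arr_PA C r qp) t (arr_FA C r q \<cdot>\<^bsub>C\<^esub> m2);
         (s', t') = dist_induced C (pmid r) (arr_PA C r qp)
               (k, m1, arr_GC C r q \<cdot>\<^bsub>C\<^esub> arr_GC C rq p);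
         g = induced C (arr_HA C q p) (arr_HF C q p)
               (arr_HA C rq p) (s \<cdot>\<^bsub>C\<^esub> arr_HF C rq p);
         h = induced C (arr_HA C r qp) (arr_HF C r qp)
               g (s' \<cdot>\<^bsub>C\<^esub> n \<cdot>\<^bsub>C\<^esub> arr_HF C rq p)
     in (poly_comp C rq p, (h, t'), poly_comp C r qp))"

text \<open>In \<open>1 \<circ> p\<close> the arrow \<open>F \<rightarrow> G\<close> is a pullback of an identity; \<open>u : G \<rightarrow> F\<close> is its inverse.\<close>

definition poly_lunit :: "('o, 'm) category \<Rightarrow> 'm polynomial \<Rightarrow> 'm poly_cell" where
  "poly_lunit C p =
    (let i = poly_id C (Cod C (pright p));
         u = induced C (arr_FA C i p) (arr_FG C i p)
               (arr_GC C i p) (Idn C (Dom C (arr_GC C i p)))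
     in (poly_comp C i p, (arr_HA C i p, arr_FC C i p \<cdot>\<^bsub>C\<^esub> u), p))"

definition poly_runit :: "('o, 'm) category \<Rightarrow> 'm polynomial \<Rightarrow> 'm poly_cell" where
  "poly_runit C p =
    (let i = poly_id C (Cod C (pleft p))
     in (poly_comp C p i, (arr_FA C p i \<cdot>\<^bsub>C\<^esub> arr_HF C p i, arr_GC C p i), p))"

definition Poly :: "('o, 'm) category \<Rightarrow> ('o, 'm polynomial, 'm poly_cell) bicategory_data" where
  "Poly C = \<lparr>Obj0 = Obj C, HomCat = poly_hom C, Id1 = poly_id C, Comp1 = poly_comp C,
     HComp = poly_hcomp C, Assoc = poly_assoc C, LUnit = poly_lunit C, RUnit = poly_runit C\<rparr>"

definition poly_of_arrow :: "('o, 'm) category \<Rightarrow> 'm \<Rightarrow> 'm polynomial" where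
  "poly_of_arrow C p =
     \<lparr>pleft = to_terminal C (Dom C p), pmid = p, pright = to_terminal C (Cod C p)\<rparr>"

definition monad_structures :: "('o, 'm) category \<Rightarrow> 'm \<Rightarrow> ('m poly_cell \<times> 'm poly_cell) set" where
  "monad_structures C p =
     {(\<eta>, \<mu>). is_monad (Poly C) (terminal C) (poly_of_arrow C p) \<eta> \<mu>}"

section \<open>Double categories\<close>

text \<open>Graphs internal to \<open>CAT\<close>; \<open>Gr0\<close> is the category of objects and vertical arrows, \<open>Gr1\<close> the
  category of horizontal arrows and squares.\<close>

record ('o, 'm, 'p, 'n) cat_graph =
  Gr0 :: "('o, 'm) category"
  Gr1 :: "('p, 'n) category"
  Src :: "('p, 'n, 'o, 'm) funct"
  Tgt :: "('p, 'n, 'o, 'm) funct"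

definition is_cat_graph :: "('o, 'm, 'p, 'n) cat_graph \<Rightarrow> bool" where
  "is_cat_graph \<G> \<longleftrightarrow> is_category (Gr0 \<G>) \<and> is_category (Gr1 \<G>) \<and>
     is_functor (Gr1 \<G>) (Gr0 \<G>) (Src \<G>) \<and> is_functor (Gr1 \<G>) (Gr0 \<G>) (Tgt \<G>)"

text \<open>The pullback in \<open>CAT\<close> of \<open>Tgt\<close> and \<open>Src\<close>. A pair \<open>(x, y)\<close> is \<open>x\<close> followed by \<open>y\<close>.\<close>

definition composable_pairs :: "('o, 'm, 'p, 'n) cat_graph \<Rightarrow> ('p \<times> 'p, 'n \<times> 'n) category" where
  "composable_pairs \<G> =
     \<lparr>Obj = {(x, y). x \<in> Obj (Gr1 \<G>) \<and> y \<in> Obj (Gr1 \<G>) \<and> FObj (Tgt \<G>) x = FObj (Src \<G>) y},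
      Arr = {(\<alpha>, \<beta>). \<alpha> \<in> Arr (Gr1 \<G>) \<and> \<beta> \<in> Arr (Gr1 \<G>) \<and> FArr (Tgt \<G>) \<alpha> = FArr (Src \<G>) \<beta>},
      Dom = map_prod (Dom (Gr1 \<G>)) (Dom (Gr1 \<G>)),
      Cod = map_prod (Cod (Gr1 \<G>)) (Cod (Gr1 \<G>)),
      Idn = map_prod (Idn (Gr1 \<G>)) (Idn (Gr1 \<G>)),
      Comp = pair_comp (Gr1 \<G>)\<rparr>"

definition is_double_category ::
  "('o, 'm, 'p, 'n) cat_graph \<Rightarrow> ('o, 'm, 'p, 'n) funct \<Rightarrow> ('p \<times> 'p, 'n \<times> 'n, 'p, 'n) funct \<Rightarrow> bool"
where
  "is_double_category \<G> I M \<longleftrightarrow>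
     is_cat_graph \<G> \<and>
     is_functor (Gr0 \<G>) (Gr1 \<G>) I \<and> is_functor (composable_pairs \<G>) (Gr1 \<G>) M \<and>
     (\<forall>a\<in>Obj (Gr0 \<G>). FObj (Src \<G>) (FObj I a) = a \<and> FObj (Tgt \<G>) (FObj I a) = a) \<and>
     (\<forall>k\<in>Arr (Gr0 \<G>). FArr (Src \<G>) (FArr I k) = k \<and> FArr (Tgt \<G>) (FArr I k) = k) \<and>
     (\<forall>(x, y)\<in>Obj (composable_pairs \<G>).
        FObj (Src \<G>) (FObj M (x, y)) = FObj (Src \<G>) x \<and>
        FObj (Tgt \<G>) (FObj M (x, y)) = FObj (Tgt \<G>) y) \<and>
     (\<forall>(\<alpha>, \<beta>)\<in>Arr (composable_pairs \<G>).
        FArr (Src \<G>) (FArr M (\<alpha>, \<beta>)) = FArr (Src \<G>) \<alpha> \<and>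
        FArr (Tgt \<G>) (FArr M (\<alpha>, \<beta>)) = FArr (Tgt \<G>) \<beta>) \<and>
     (\<forall>x\<in>Obj (Gr1 \<G>).
        FObj M (FObj I (FObj (Src \<G>) x), x) = x \<and> FObj M (x, FObj I (FObj (Tgt \<G>) x)) = x) \<and>
     (\<forall>\<alpha>\<in>Arr (Gr1 \<G>).
        FArr M (FArr I (FArr (Src \<G>) \<alpha>), \<alpha>) = \<alpha> \<and> FArr M (\<alpha>, FArr I (FArr (Tgt \<G>) \<alpha>)) = \<alpha>) \<and>
     (\<forall>x y z. (x, y) \<in> Obj (composable_pairs \<G>) \<and> (y, z) \<in> Obj (composable_pairs \<G>) \<longrightarrow>
        FObj M (FObj M (x, y), z) = FObj M (x, FObj M (y, z))) \<and>
     (\<forall>\<alpha> \<beta> \<gamma>. (\<alpha>, \<beta>) \<in> Arr (composable_pairs \<G>) \<and> (\<beta>, \<gamma>) \<in> Arr (composable_pairs \<G>) \<longrightarrow>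
        FArr M (FArr M (\<alpha>, \<beta>), \<gamma>) = FArr M (\<alpha>, FArr M (\<beta>, \<gamma>)))"

definition is_graph_morphism ::
  "('o, 'm, 'p, 'n) cat_graph \<Rightarrow> ('o2, 'm2, 'p2, 'n2) cat_graph \<Rightarrow>
   ('o, 'm, 'o2, 'm2) funct \<Rightarrow> ('p, 'n, 'p2, 'n2) funct \<Rightarrow> bool" where
  "is_graph_morphism \<G> \<G>' U0 U1 \<longleftrightarrow>
     is_functor (Gr0 \<G>) (Gr0 \<G>') U0 \<and> is_functor (Gr1 \<G>) (Gr1 \<G>') U1 \<and>
     (\<forall>x\<in>Obj (Gr1 \<G>). FObj (Src \<G>') (FObj U1 x) = FObj U0 (FObj (Src \<G>) x) \<and>
                      FObj (Tgt \<G>') (FObj U1 x) = FObj U0 (FObj (Tgt \<G>) x)) \<and>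
     (\<forall>\<alpha>\<in>Arr (Gr1 \<G>). FArr (Src \<G>') (FArr U1 \<alpha>) = FArr U0 (FArr (Src \<G>) \<alpha>) \<and>
                      FArr (Tgt \<G>') (FArr U1 \<alpha>) = FArr U0 (FArr (Tgt \<G>) \<alpha>))"

definition is_double_functor ::
  "('o, 'm, 'p, 'n) cat_graph \<Rightarrow> ('o, 'm, 'p, 'n) funct \<Rightarrow> ('p \<times> 'p, 'n \<times> 'n, 'p, 'n) funct \<Rightarrow>
   ('o2, 'm2, 'p2, 'n2) cat_graph \<Rightarrow> ('o2, 'm2, 'p2, 'n2) funct \<Rightarrow>
   ('p2 \<times> 'p2, 'n2 \<times> 'n2, 'p2, 'n2) funct \<Rightarrow>
   ('o, 'm, 'o2, 'm2) funct \<Rightarrow> ('p, 'n, 'p2, 'n2) funct \<Rightarrow> bool" where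
  "is_double_functor \<G> I M \<G>' I' M' U0 U1 \<longleftrightarrow>
     is_double_category \<G> I M \<and> is_double_category \<G>' I' M' \<and> is_graph_morphism \<G> \<G>' U0 U1 \<and>
     (\<forall>a\<in>Obj (Gr0 \<G>). FObj U1 (FObj I a) = FObj I' (FObj U0 a)) \<and>
     (\<forall>k\<in>Arr (Gr0 \<G>). FArr U1 (FArr I k) = FArr I' (FArr U0 k)) \<and>
     (\<forall>(x, y)\<in>Obj (composable_pairs \<G>). FObj U1 (FObj M (x, y)) = FObj M' (FObj U1 x, FObj U1 y)) \<and>
     (\<forall>(\<alpha>, \<beta>)\<in>Arr (composable_pairs \<G>). FArr U1 (FArr M (\<alpha>, \<beta>)) = FArr M' (FArr U1 \<alpha>, FArr U1 \<beta>))"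

subsection \<open>The double category of squares\<close>

definition arrow_category :: "('o, 'm) category \<Rightarrow> ('m, 'm \<times> ('m \<times> 'm) \<times> 'm) category" where
  "arrow_category C = category_of (Arr C)
     (\<lambda>f (h, k) g. h \<in> hom C (Dom C f) (Dom C g) \<and> k \<in> hom C (Cod C f) (Cod C g) \<and>
        g \<cdot>\<^bsub>C\<^esub> h = k \<cdot>\<^bsub>C\<^esub> f)
     (\<lambda>f. (Idn C (Dom C f), Idn C (Cod C f)))
     (pair_comp C)"

definition squares_graph ::
  "('o, 'm) category \<Rightarrow> ('o, 'm, 'm, 'm \<times> ('m \<times> 'm) \<times> 'm) cat_graph" where
  "squares_graph C =
     \<lparr>Gr0 = C, Gr1 = arrow_category C,
      Src = \<lparr>FObj = \<lambda>f\<in>Arr C. Dom C f,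
             FArr = \<lambda>\<alpha>\<in>Arr (arrow_category C). fst (label \<alpha>)\<rparr>,
      Tgt = \<lparr>FObj = \<lambda>f\<in>Arr C. Cod C f,
             FArr = \<lambda>\<alpha>\<in>Arr (arrow_category C). snd (label \<alpha>)\<rparr>\<rparr>"

definition squares_unit ::
  "('o, 'm) category \<Rightarrow> ('o, 'm, 'm, 'm \<times> ('m \<times> 'm) \<times> 'm) funct" where
  "squares_unit C =
     \<lparr>FObj = \<lambda>a\<in>Obj C. Idn C a,
      FArr = \<lambda>k\<in>Arr C. (Idn C (Dom C k), (k, k), Idn C (Cod C k))\<rparr>"

definition squares_comp ::
  "('o, 'm) category \<Rightarrow>
   ('m \<times> 'm, ('m \<times> ('m \<times> 'm) \<times> 'm) \<times> ('m \<times> ('m \<times> 'm) \<times> 'm), 'm, 'm \<times> ('m \<times> 'm) \<times> 'm) funct" where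
  "squares_comp C =
     \<lparr>FObj = \<lambda>(f, g)\<in>Obj (composable_pairs (squares_graph C)). g \<cdot>\<^bsub>C\<^esub> f,
      FArr = \<lambda>(\<alpha>, \<beta>)\<in>Arr (composable_pairs (squares_graph C)).
        (source \<beta> \<cdot>\<^bsub>C\<^esub> source \<alpha>, (fst (label \<alpha>), snd (label \<beta>)), target \<beta> \<cdot>\<^bsub>C\<^esub> target \<alpha>)\<rparr>"

subsection \<open>The internal graph of \<open>p\<close>-fibrations\<close>

type_synonym 'm fib = "'m \<times> 'm \<times> 'm"
type_synonym 'm fib_arrow = "'m fib \<times> ('m \<times> 'm) \<times> 'm fib"

text \<open>A \<open>p\<close>-fibration is a triple \<open>(f, u, v)\<close> such that \<open>p u = v f\<close> is a pullback square.\<close>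

definition fibration_category :: "('o, 'm) category \<Rightarrow> 'm \<Rightarrow> ('m fib, 'm fib_arrow) category" where
  "fibration_category C p = category_of
     {(f, u, v). is_pullback C p v u f}
     (\<lambda>(f1, u1, v1) (u3, v3) (f2, u2, v2).
        u3 \<in> hom C (Dom C f1) (Dom C f2) \<and> v3 \<in> hom C (Cod C f1) (Cod C f2) \<and>
        f2 \<cdot>\<^bsub>C\<^esub> u3 = v3 \<cdot>\<^bsub>C\<^esub> f1 \<and> u2 \<cdot>\<^bsub>C\<^esub> u3 = u1 \<and> v2 \<cdot>\<^bsub>C\<^esub> v3 = v1)
     (\<lambda>(f, u, v). (Idn C (Dom C f), Idn C (Cod C f)))
     (pair_comp C)"

definition fibration_graph :: "('o, 'm) category \<Rightarrow> 'm \<Rightarrow> ('o, 'm, 'm fib, 'm fib_arrow) cat_graph" where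
  "fibration_graph C p =
     \<lparr>Gr0 = C, Gr1 = fibration_category C p,
      Src = \<lparr>FObj = \<lambda>x\<in>Obj (fibration_category C p). Dom C (fst x),
             FArr = \<lambda>\<alpha>\<in>Arr (fibration_category C p). fst (label \<alpha>)\<rparr>,
      Tgt = \<lparr>FObj = \<lambda>x\<in>Obj (fibration_category C p). Cod C (fst x),
             FArr = \<lambda>\<alpha>\<in>Arr (fibration_category C p). snd (label \<alpha>)\<rparr>\<rparr>"

definition forget_fibrations ::
  "('o, 'm) category \<Rightarrow> 'm \<Rightarrow> ('m fib, 'm fib_arrow, 'm, 'm \<times> ('m \<times> 'm) \<times> 'm) funct" where
  "forget_fibrations C p =
     \<lparr>FObj = \<lambda>x\<in>Obj (fibration_category C p). fst x,
      FArr = \<lambda>\<alpha>\<in>Arr (fibration_category C p). (fst (source \<alpha>), label \<alpha>, fst (target \<alpha>))\<rparr>"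

text \<open>The pairs \<open>(I, M)\<close> of horizontal identity and horizontal composition functors making the graph
  of \<open>p\<close>-fibrations a double category, and the forgetful morphism a double functor.\<close>

definition double_category_structures ::
  "('o, 'm) category \<Rightarrow> 'm \<Rightarrow>
   (('o, 'm, 'm fib, 'm fib_arrow) funct \<times>
    ('m fib \<times> 'm fib, 'm fib_arrow \<times> 'm fib_arrow, 'm fib, 'm fib_arrow) funct) set" where
  "double_category_structures C p =
     {(I, M). is_double_category (fibration_graph C p) I M \<and>
        is_double_functor (fibration_graph C p) I M
          (squares_graph C) (squares_unit C) (squares_comp C)
          (identity_functor C) (forget_fibrations C p)}"

end

theory Submission
  imports Defs
begin

text \<open>
  The polynomial \<open>1 \<leftarrow> E \<rightarrow> B \<rightarrow> 1\<close> has trivial legs, so a 2-cell into it from a polynomial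
  \<open>1 \<leftarrow> X \<rightarrow> Y \<rightarrow> 1\<close> is a pullback square from \<open>X \<rightarrow> Y\<close> to \<open>p\<close>, that is, a \<open>p\<close>-fibration structure on
  \<open>X \<rightarrow> Y\<close>. Hence a unit is a \<open>p\<close>-fibration structure on the identity of \<open>1\<close>, and a multiplication is
  a \<open>p\<close>-fibration structure on the middle arrow \<open>H \<rightarrow> F \<rightarrow> G\<close> of \<open>p \<circ> p\<close>.

  The universal properties of the pullback \<open>P\<close>, of the distributivity pullback and of \<open>H\<close> say
  together that \<open>H \<rightarrow> F \<rightarrow> G\<close> is the universal composable pair of \<open>p\<close>-fibrations: every composable
  pair \<open>X \<rightarrow> Y \<rightarrow> Z\<close> has exactly one morphism of pairs into it (\<open>classifies_universal\<close>,
  \<open>classifies_unique\<close>). A choice of \<open>p\<close>-fibration structures on composites that is natural in the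
  pair is therefore determined by its value on \<open>H \<rightarrow> F \<rightarrow> G\<close>, and any value there extends to all pairs
  by pulling back along the classifying morphism. In the same way, a natural choice on identities is
  determined by its value on the identity of \<open>1\<close>, since every object has one arrow to \<open>1\<close>. The
  action of a double category structure on squares leaves no freedom, because the forgetful functor
  to squares is faithful; functoriality is exactly naturality of the two choices.

  It remains to compare the axioms. Whiskerings and the associator of the bicategory of polynomials
  are given by classifying morphisms (\<open>poly_hcomp_classifies\<close>, \<open>poly_assoc_classifies\<close>), and the
  unitors by projections, in one case composed with the inverse of a pullback of an identity.
  Reading the two sides of a monad equation through the classification turns it into the
  corresponding law for fibrations at one universal instance; for associativity this is the
  composable triple into which the middle arrow of \<open>(p \<circ> p) \<circ> p\<close> factors. Every other instance maps
  to the universal one, and a fibration structure is determined by a morphism to another fibration,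
  so the law at the universal instance implies the law in general (\<open>assoc_universal\<close>,
  \<open>unit_law_right\<close>, \<open>unit_law_left\<close>). Both kinds of data are thus in bijection with the quadruples
  satisfying \<open>fib_algebra\<close> (\<open>monad_iff\<close>, \<open>fib_algebra_structure\<close>, \<open>structure_fib_algebra\<close>).

  One ingredient is of a different nature: \<open>p \<circ> p\<close> must be a polynomial, so its middle arrow has to
  be exponentiable. Exponentiability of \<open>f\<close> is shown to be the existence of distributivity pullbacks
  around \<open>(f, g)\<close> for all \<open>g\<close>, and in this form it is seen to be stable under pullback and
  composition.
\<close>

section \<open>Categories with finite limits\<close>

locale categ =
  fixes C :: "('o, 'm) category" (structure)
  assumes cat: "is_category C"
begin

lemma hom_iff: "f \<in> hom C x y \<longleftrightarrow> f \<in> Arr C \<and> Dom C f = x \<and> Cod C f = y"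
  by (simp add: hom_def)

lemma arr_objs [simp]: "f \<in> Arr C \<Longrightarrow> Dom C f \<in> Obj C" "f \<in> Arr C \<Longrightarrow> Cod C f \<in> Obj C"
  using cat by (auto simp: is_category_def)

lemma idn_simps [simp]:
  "x \<in> Obj C \<Longrightarrow> Idn C x \<in> Arr C" "x \<in> Obj C \<Longrightarrow> Dom C (Idn C x) = x"
  "x \<in> Obj C \<Longrightarrow> Cod C (Idn C x) = x"
  using cat by (auto simp: is_category_def hom_def)

lemma comp_simps [simp]:
  assumes "f \<in> Arr C" "g \<in> Arr C" "Cod C f = Dom C g"
  shows "g \<cdot> f \<in> Arr C" "Dom C (g \<cdot> f) = Dom C f" "Cod C (g \<cdot> f) = Cod C g"
  using cat assms by (auto simp: is_category_def hom_def)

lemma comp_idn [simp]: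
  "f \<in> Arr C \<Longrightarrow> Dom C f = x \<Longrightarrow> f \<cdot> Idn C x = f"
  "f \<in> Arr C \<Longrightarrow> Cod C f = y \<Longrightarrow> Idn C y \<cdot> f = f"
  using cat by (auto simp: is_category_def)

lemma assoc [simp]:
  "f \<in> Arr C \<Longrightarrow> g \<in> Arr C \<Longrightarrow> h \<in> Arr C \<Longrightarrow> Cod C f = Dom C g \<Longrightarrow> Cod C g = Dom C h \<Longrightarrow>
   (h \<cdot> g) \<cdot> f = h \<cdot> (g \<cdot> f)"
  using cat by (auto simp: is_category_def)

text \<open>Composites are kept bracketed to the right. In this form an equation between composites
  applies inside a longer composite only after it has been extended by an arrow \<open>x\<close> on the right;
  the lemma and its variants below produce such extended rewrite rules.\<close>

lemma comp_extend:
  assumes "g \<cdot> f = k \<cdot> h"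
    and "f \<in> Arr C" "g \<in> Arr C" "h \<in> Arr C" "k \<in> Arr C" "x \<in> Arr C"
    and "Cod C f = Dom C g" "Cod C h = Dom C k" "Cod C x = Dom C f" "Cod C x = Dom C h"
  shows "g \<cdot> (f \<cdot> x) = k \<cdot> (h \<cdot> x)"
  using assms by (metis assoc)

lemma comp_extend1:
  assumes "g \<cdot> f = k"
    and "f \<in> Arr C" "g \<in> Arr C" "x \<in> Arr C" "Cod C f = Dom C g" "Cod C x = Dom C f"
  shows "g \<cdot> (f \<cdot> x) = k \<cdot> x"
  using assms by (metis assoc)

end

locale finitely_complete = categ C for C :: "('o, 'm) category" (structure) +
  assumes lims: "has_finite_limits C"
begin

lemma terminal_exists: "\<exists>t. is_terminal C t"
proof -
  \<comment> \<open>A terminal object is a limit of the empty diagram.\<close>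
  define J :: "(nat, nat) category" where
    "J = \<lparr>Obj = {}, Arr = {}, Dom = \<lambda>_. 0, Cod = \<lambda>_. 0, Idn = \<lambda>_. 0, Comp = \<lambda>_ _. 0\<rparr>"
  define D :: "(nat, nat, 'o, 'm) funct" where
    "D = \<lparr>FObj = \<lambda>_. undefined, FArr = \<lambda>_. undefined\<rparr>"
  have "is_category J \<and> finite (Obj J) \<and> finite (Arr J) \<and> is_functor J C D"
    by (simp add: is_category_def J_def D_def is_functor_def)
  then obtain x \<pi> where "is_limit J C D x \<pi>"
    using lims unfolding has_finite_limits_def by blast
  then have "is_terminal C x"
    by (auto simp: is_limit_def is_cone_def is_terminal_def J_def)
  then show ?thesis ..
qed

lemma terminal_is_terminal: "is_terminal C (terminal C)"
  unfolding terminal_def using terminal_exists by (rule someI_ex)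

lemma terminal_obj [simp]: "terminal C \<in> Obj C"
  using terminal_is_terminal by (simp add: is_terminal_def)

lemma to_terminal_simps [simp]:
  assumes "x \<in> Obj C"
  shows "to_terminal C x \<in> Arr C" "Dom C (to_terminal C x) = x"
    "Cod C (to_terminal C x) = terminal C"
proof -
  have "\<exists>!h. h \<in> hom C x (terminal C)"
    using terminal_is_terminal assms by (simp add: is_terminal_def)
  from theI'[OF this] show "to_terminal C x \<in> Arr C" "Dom C (to_terminal C x) = x"
    "Cod C (to_terminal C x) = terminal C"
    by (auto simp: to_terminal_def hom_def)
qed

lemma terminal_unique:
  assumes "f \<in> Arr C" "g \<in> Arr C" "Dom C f = Dom C g" "Cod C f = terminal C" "Cod C g = terminal C"
  shows "f = g"
  using terminal_is_terminal assms unfolding is_terminal_def hom_def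
  by (metis (mono_tags, lifting) arr_objs(1) mem_Collect_eq)

lemma pullbackD:
  assumes "is_pullback C f g a b"
  shows "f \<in> Arr C" "g \<in> Arr C" "a \<in> Arr C" "b \<in> Arr C" "Cod C f = Cod C g" "Dom C a = Dom C b"
    "Cod C a = Dom C f" "Cod C b = Dom C g" "f \<cdot> a = g \<cdot> b"
  using assms by (auto simp: is_pullback_def)

lemma pullback_lift:
  assumes "is_pullback C f g a b"
    and "x \<in> Arr C" "y \<in> Arr C" "Dom C x = Dom C y" "Cod C x = Dom C f" "Cod C y = Dom C g"
    and "f \<cdot> x = g \<cdot> y"
  obtains w where "w \<in> Arr C" "Dom C w = Dom C x" "Cod C w = Dom C a" "a \<cdot> w = x" "b \<cdot> w = y"
proof -
  have "\<exists>!w. w \<in> hom C (Dom C x) (Dom C a) \<and> a \<cdot> w = x \<and> b \<cdot> w = y"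
    using assms(1-7) unfolding is_pullback_def by blast
  then obtain w where "w \<in> hom C (Dom C x) (Dom C a)" "a \<cdot> w = x" "b \<cdot> w = y" by blast
  then show thesis by (intro that[of w]) (simp_all add: hom_iff)
qed

lemma pullback_eq:
  assumes "is_pullback C f g a b"
    and "w \<in> Arr C" "w' \<in> Arr C" "Dom C w = Dom C w'" "Cod C w = Dom C a" "Cod C w' = Dom C a"
    and "a \<cdot> w = a \<cdot> w'" "b \<cdot> w = b \<cdot> w'"
  shows "w = w'"
proof -
  note D = pullbackD[OF assms(1)]
  have "f \<cdot> (a \<cdot> w) = g \<cdot> (b \<cdot> w)"
    by (rule comp_extend) (use D assms in auto)
  moreover have "a \<cdot> w \<in> Arr C" "b \<cdot> w \<in> Arr C" "Dom C (a \<cdot> w) = Dom C (b \<cdot> w)"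
    "Cod C (a \<cdot> w) = Dom C f" "Cod C (b \<cdot> w) = Dom C g"
    using assms D by auto
  ultimately have "\<exists>!v. v \<in> hom C (Dom C (a \<cdot> w)) (Dom C a) \<and> a \<cdot> v = a \<cdot> w \<and> b \<cdot> v = b \<cdot> w"
    using assms(1) unfolding is_pullback_def by blast
  moreover have "w \<in> hom C (Dom C (a \<cdot> w)) (Dom C a)" "w' \<in> hom C (Dom C (a \<cdot> w)) (Dom C a)"
    using assms D by (auto simp: hom_def)
  ultimately show ?thesis using assms(7,8) by metis
qed

lemma pullbackI:
  assumes "f \<in> Arr C" "g \<in> Arr C" "a \<in> Arr C" "b \<in> Arr C" "Cod C f = Cod C g" "Dom C a = Dom C b"
    "Cod C a = Dom C f" "Cod C b = Dom C g" "f \<cdot> a = g \<cdot> b"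
    and ex: "\<And>x y. x \<in> Arr C \<Longrightarrow> y \<in> Arr C \<Longrightarrow> Dom C x = Dom C y \<Longrightarrow> Cod C x = Dom C f \<Longrightarrow>
      Cod C y = Dom C g \<Longrightarrow> f \<cdot> x = g \<cdot> y \<Longrightarrow>
      \<exists>w. w \<in> Arr C \<and> Dom C w = Dom C x \<and> Cod C w = Dom C a \<and> a \<cdot> w = x \<and> b \<cdot> w = y"
    and un: "\<And>w w'. w \<in> Arr C \<Longrightarrow> w' \<in> Arr C \<Longrightarrow> Dom C w = Dom C w' \<Longrightarrow> Cod C w = Dom C a \<Longrightarrow>
      Cod C w' = Dom C a \<Longrightarrow> a \<cdot> w = a \<cdot> w' \<Longrightarrow> b \<cdot> w = b \<cdot> w' \<Longrightarrow> w = w'"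
  shows "is_pullback C f g a b"
  unfolding is_pullback_def
proof (intro conjI ballI impI)
  fix x y assume xy: "x \<in> Arr C" "y \<in> Arr C"
    "Dom C x = Dom C y \<and> Cod C x = Dom C f \<and> Cod C y = Dom C g \<and> f \<cdot> x = g \<cdot> y"
  then obtain w where "w \<in> Arr C" "Dom C w = Dom C x" "Cod C w = Dom C a" "a \<cdot> w = x" "b \<cdot> w = y"
    using ex by blast
  then show "\<exists>!w. w \<in> hom C (Dom C x) (Dom C a) \<and> a \<cdot> w = x \<and> b \<cdot> w = y"
    by (intro ex1I[of _ w]) (auto simp: hom_def intro: un)
qed (use assms in auto)

lemma pullback_sym: "is_pullback C f g a b \<Longrightarrow> is_pullback C g f b a"
  unfolding is_pullback_def by (metis (no_types, lifting))

lemma pullback_exists: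
  assumes "f \<in> Arr C" "g \<in> Arr C" "Cod C f = Cod C g"
  shows "\<exists>a b. is_pullback C f g a b"
proof -
  \<comment> \<open>The cospan: objects 0, 1, 2, their identities 0, 1, 2, and the arrows 3 from 0 to 2 and 4 from
      1 to 2.\<close>
  define J :: "(nat, nat) category" where
    "J = \<lparr>Obj = {0, 1, 2}, Arr = {0, 1, 2, 3, 4},
          Dom = \<lambda>n. if n = 3 then 0 else if n = 4 then 1 else n,
          Cod = \<lambda>n. if n \<ge> 3 then 2 else n, Idn = \<lambda>n. n,
          Comp = \<lambda>n m. if n \<le> 2 then m else n\<rparr>"
  define D :: "(nat, nat, 'o, 'm) funct" where
    "D = \<lparr>FObj = \<lambda>n\<in>{0, 1, 2}. if n = 0 then Dom C f else if n = 1 then Dom C g else Cod C f,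
          FArr = \<lambda>n\<in>{0, 1, 2, 3, 4}. if n = 0 then Idn C (Dom C f) else if n = 1 then Idn C (Dom C g)
             else if n = 2 then Idn C (Cod C f) else if n = 3 then f else g\<rparr>"
  have J: "is_category J"
    unfolding is_category_def J_def hom_def by auto
  have D: "is_functor J C D"
    unfolding is_functor_def J_def D_def using assms by auto
  have "finite (Obj J)" "finite (Arr J)" by (auto simp: J_def)
  then obtain x \<pi> where lim: "is_limit J C D x \<pi>"
    using lims J D unfolding has_finite_limits_def by blast
  have cone_iff: "is_cone J C D y \<rho> \<longleftrightarrow> y \<in> Obj C \<and> \<rho> 0 \<in> hom C y (Dom C f) \<and> \<rho> 1 \<in> hom C y (Dom C g)
     \<and> \<rho> 2 \<in> hom C y (Cod C f) \<and> f \<cdot> \<rho> 0 = \<rho> 2 \<and> g \<cdot> \<rho> 1 = \<rho> 2" for y \<rho>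
    unfolding is_cone_def J_def D_def by (auto simp: hom_def)
  have c: "is_cone J C D x \<pi>" using lim by (simp add: is_limit_def)
  then have c': "\<pi> 0 \<in> hom C x (Dom C f)" "\<pi> 1 \<in> hom C x (Dom C g)" "f \<cdot> \<pi> 0 = \<pi> 2" "g \<cdot> \<pi> 1 = \<pi> 2"
    by (auto simp: cone_iff)
  have "is_pullback C f g (\<pi> 0) (\<pi> 1)"
    unfolding is_pullback_def
  proof (intro conjI ballI impI)
    fix y z assume yz: "y \<in> Arr C" "z \<in> Arr C"
      "Dom C y = Dom C z \<and> Cod C y = Dom C f \<and> Cod C z = Dom C g \<and> f \<cdot> y = g \<cdot> z"
    define \<rho> where "\<rho> = (\<lambda>n::nat. if n = 0 then y else if n = 1 then z else f \<cdot> y)"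
    have "is_cone J C D (Dom C y) \<rho>"
      using yz assms by (auto simp: cone_iff \<rho>_def hom_def)
    then have ex: "\<exists>!h. h \<in> hom C (Dom C y) x \<and> (\<forall>i\<in>Obj J. \<pi> i \<cdot> h = \<rho> i)"
      using lim by (simp add: is_limit_def)
    have eq: "h \<in> hom C (Dom C y) x \<and> (\<forall>i\<in>Obj J. \<pi> i \<cdot> h = \<rho> i) \<longleftrightarrow>
        h \<in> hom C (Dom C y) (Dom C (\<pi> 0)) \<and> \<pi> 0 \<cdot> h = y \<and> \<pi> 1 \<cdot> h = z" (is "?l \<longleftrightarrow> ?r") for h
    proof
      assume ?l then show ?r using c' by (auto simp: J_def \<rho>_def hom_def)
    next
      assume r: ?r
      have "\<pi> 2 \<cdot> h = f \<cdot> y" using r c' assms(1)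
        by (metis (no_types, lifting) assoc hom_iff)
      then show ?l using r c' by (auto simp: J_def \<rho>_def hom_def)
    qed
    show "\<exists>!w. w \<in> hom C (Dom C y) (Dom C (\<pi> 0)) \<and> \<pi> 0 \<cdot> w = y \<and> \<pi> 1 \<cdot> w = z"
      using ex unfolding eq .
  qed (use assms c' in \<open>auto simp: hom_def\<close>)
  then show ?thesis by blast
qed

lemma pb_pullback:
  assumes "f \<in> Arr C" "g \<in> Arr C" "Cod C f = Cod C g"
  shows "is_pullback C f g (pb1 C f g) (pb2 C f g)"
proof -
  have "\<exists>x. case x of (a, b) \<Rightarrow> is_pullback C f g a b"
    using pullback_exists[OF assms] by auto
  from someI_ex[OF this] show ?thesis
    unfolding pb1_def pb2_def pb_def by (simp add: case_prod_unfold)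
qed

lemma induced_props:
  assumes "is_pullback C f g a b"
    and "x \<in> Arr C" "y \<in> Arr C" "Dom C x = Dom C y" "Cod C x = Dom C f" "Cod C y = Dom C g"
    and "f \<cdot> x = g \<cdot> y"
  shows "induced C a b x y \<in> Arr C" "Dom C (induced C a b x y) = Dom C x"
    "Cod C (induced C a b x y) = Dom C a" "a \<cdot> induced C a b x y = x" "b \<cdot> induced C a b x y = y"
proof -
  have "\<exists>!w. w \<in> hom C (Dom C x) (Dom C a) \<and> a \<cdot> w = x \<and> b \<cdot> w = y"
    using assms unfolding is_pullback_def by blast
  from theI'[OF this] show "induced C a b x y \<in> Arr C" "Dom C (induced C a b x y) = Dom C x"
    "Cod C (induced C a b x y) = Dom C a" "a \<cdot> induced C a b x y = x" "b \<cdot> induced C a b x y = y"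
    unfolding induced_def hom_def by auto
qed

lemma pullback_paste:
  assumes 1: "is_pullback C q v u f" and 2: "is_pullback C f w x g"
  shows "is_pullback C q (v \<cdot> w) (u \<cdot> x) g"
proof -
  note D = pullbackD(1-4,7)[OF 1] pullbackD(2-8)[OF 2] pullbackD(5,6,8)[OF 1]
  show ?thesis
  proof (rule pullbackI)
    note D = pullbackD[OF 1] pullbackD(1-5)[OF 2] pullbackD(6-9)[OF 2]
    have D6: "Dom C u = Dom C f" using D by simp
    show "q \<cdot> u \<cdot> x = (v \<cdot> w) \<cdot> g"
      using D by (simp add: comp_extend[OF pullbackD(9)[OF 1]])
    fix y z assume a: "y \<in> Arr C" "z \<in> Arr C" "Dom C y = Dom C z" "Cod C y = Dom C q"
      "Cod C z = Dom C (v \<cdot> w)" "q \<cdot> y = (v \<cdot> w) \<cdot> z"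
    have "Cod C z = Dom C w" "q \<cdot> y = v \<cdot> (w \<cdot> z)" using a D by auto
    note a = a(1-4) this
    obtain r where r: "r \<in> Arr C" "Dom C r = Dom C y" "Cod C r = Dom C u" "u \<cdot> r = y" "f \<cdot> r = w \<cdot> z"
      by (rule pullback_lift[OF 1, of y "w \<cdot> z"]) (use a D in auto)
    obtain s where "s \<in> Arr C" "Dom C s = Dom C r" "Cod C s = Dom C x" "x \<cdot> s = r" "g \<cdot> s = z"
      by (rule pullback_lift[OF 2, of r z]) (use a D r D6 in auto)
    then show "\<exists>s. s \<in> Arr C \<and> Dom C s = Dom C y \<and> Cod C s = Dom C (u \<cdot> x) \<and> (u \<cdot> x) \<cdot> s = y \<and> g \<cdot> s = z"
      using D r by (intro exI[of _ s]) auto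
  next
    note D = pullbackD[OF 1] pullbackD(1-5)[OF 2] pullbackD(6-9)[OF 2]
    fix s t assume a: "s \<in> Arr C" "t \<in> Arr C" "Dom C s = Dom C t" "Cod C s = Dom C (u \<cdot> x)"
      "Cod C t = Dom C (u \<cdot> x)" "(u \<cdot> x) \<cdot> s = (u \<cdot> x) \<cdot> t" "g \<cdot> s = g \<cdot> t"
    have b: "Cod C s = Dom C x" "Cod C t = Dom C x" using a D by auto
    have "x \<cdot> s = x \<cdot> t"
    proof (rule pullback_eq[OF 1])
      show "f \<cdot> x \<cdot> s = f \<cdot> x \<cdot> t"
        using a b D by (simp add: comp_extend[OF pullbackD(9)[OF 2]])
    qed (use a b D in auto)
    then show "s = t"
      by (rule pullback_eq[OF 2, rotated 5]) (use a(1-3,7) b in simp_all)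
  qed (use D in simp_all)
qed

lemma pullback_paste_vertical:
  assumes "is_pullback C f b a f'" and "is_pullback C g c b g'"
  shows "is_pullback C (g \<cdot> f) c a (g' \<cdot> f')"
  by (rule pullback_sym, rule pullback_paste[OF pullback_sym[OF assms(2)] pullback_sym[OF assms(1)]])

lemma pullback_cancel:
  assumes 1: "is_pullback C q v u f" and 2: "is_pullback C q (v \<cdot> w) (u \<cdot> x) g"
    and w: "w \<in> Arr C" "Cod C w = Cod C f" "x \<in> Arr C" "Cod C x = Dom C f" "f \<cdot> x = w \<cdot> g"
    "Dom C w = Cod C g" "Dom C x = Dom C g"
  shows "is_pullback C f w x g"
proof (rule pullbackI)
  note D = pullbackD(1-5,7-9)[OF 1] pullbackD(1-4)[OF 2] w pullbackD(6)[OF 1]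
  fix y z assume a: "y \<in> Arr C" "z \<in> Arr C" "Dom C y = Dom C z" "Cod C y = Dom C f"
    "Cod C z = Dom C w" "f \<cdot> y = w \<cdot> z"
  have "q \<cdot> u \<cdot> y = v \<cdot> w \<cdot> z"
    using a D by (simp add: comp_extend[OF pullbackD(9)[OF 1]])
  then obtain r where r: "r \<in> Arr C" "Dom C r = Dom C y" "Cod C r = Dom C x"
      "u \<cdot> x \<cdot> r = u \<cdot> y" "g \<cdot> r = z"
    by (rule_tac pullback_lift[OF 2, of "u \<cdot> y" z]) (use a D in auto)
  have "x \<cdot> r = y"
  proof (rule pullback_eq[OF 1])
    show "f \<cdot> x \<cdot> r = f \<cdot> y"
      using a r D by (simp add: comp_extend[OF w(5)])
  qed (use a r D in auto)
  then show "\<exists>r. r \<in> Arr C \<and> Dom C r = Dom C y \<and> Cod C r = Dom C x \<and> x \<cdot> r = y \<and> g \<cdot> r = z"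
    using r by blast
next
  note D = pullbackD(1-5,7-9)[OF 1] pullbackD(1-4)[OF 2] w pullbackD(6)[OF 1]
  fix s t assume a: "s \<in> Arr C" "t \<in> Arr C" "Dom C s = Dom C t" "Cod C s = Dom C x"
    "Cod C t = Dom C x" "x \<cdot> s = x \<cdot> t" "g \<cdot> s = g \<cdot> t"
  show "s = t"
    by (rule pullback_eq[OF 2]) (use a D in auto)
qed (use w pullbackD(4)[OF 2] pullbackD(4)[OF 1] in auto)

lemma pullback_idn: "f \<in> Arr C \<Longrightarrow> is_pullback C f (Idn C (Cod C f)) (Idn C (Dom C f)) f"
proof (rule pullbackI)
  fix x y assume "f \<in> Arr C" "x \<in> Arr C" "y \<in> Arr C" "Cod C x = Dom C f"
    "Cod C y = Dom C (Idn C (Cod C f))" "f \<cdot> x = Idn C (Cod C f) \<cdot> y"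
  then show "\<exists>w. w \<in> Arr C \<and> Dom C w = Dom C x \<and> Cod C w = Dom C (Idn C (Dom C f)) \<and>
      Idn C (Dom C f) \<cdot> w = x \<and> f \<cdot> w = y"
    by (intro exI[of _ x]) simp
qed simp_all

end

section \<open>Adjoints and universal arrows\<close>

lemma category_ofI:
  assumes "\<And>x. x \<in> A \<Longrightarrow> R x (i x) x"
    and "\<And>x y z h k. \<lbrakk>x \<in> A; y \<in> A; z \<in> A; R x h y; R y k z\<rbrakk> \<Longrightarrow> R x (c k h) z"
    and "\<And>x y h. \<lbrakk>x \<in> A; y \<in> A; R x h y\<rbrakk> \<Longrightarrow> c h (i x) = h"
    and "\<And>x y h. \<lbrakk>x \<in> A; y \<in> A; R x h y\<rbrakk> \<Longrightarrow> c (i y) h = h"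
    and "\<And>w x y z h k l. \<lbrakk>w \<in> A; x \<in> A; y \<in> A; z \<in> A; R w h x; R x k y; R y l z\<rbrakk> \<Longrightarrow>
      c (c l k) h = c l (c k h)"
  shows "is_category (category_of A R i c)"
  unfolding is_category_def category_of_def hom_def
  apply (simp add: split_beta)
  apply (intro conjI ballI impI allI)
  using assms(1) apply blast
  using assms(2) apply blast
  using assms(3) apply blast
  using assms(4) apply blast
  using assms(5) apply blast
  done

text \<open>Membership in a hom-set is expressed through the components of an arrow, since the statement
  must apply to arrows that are not displayed as triples.\<close>

lemma category_of_simps [simp]:
  "Obj (category_of A R i c) = A"
  "\<alpha> \<in> Arr (category_of A R i c) \<longleftrightarrow>
     source \<alpha> \<in> A \<and> target \<alpha> \<in> A \<and> R (source \<alpha>) (label \<alpha>) (target \<alpha>)"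
  "Dom (category_of A R i c) \<alpha> = source \<alpha>"
  "Cod (category_of A R i c) \<alpha> = target \<alpha>"
  "Idn (category_of A R i c) x = (x, i x, x)"
  "Comp (category_of A R i c) \<beta> \<alpha> = (source \<alpha>, c (label \<beta>) (label \<alpha>), target \<beta>)"
  "\<alpha> \<in> hom (category_of A R i c) x y \<longleftrightarrow>
     source \<alpha> = x \<and> target \<alpha> = y \<and> x \<in> A \<and> y \<in> A \<and> R x (label \<alpha>) y"
  by (auto simp: category_of_def hom_def split_beta intro: prod_eqI)

definition universal_arrow ::
  "('o, 'm) category \<Rightarrow> ('p, 'n) category \<Rightarrow> ('o, 'm, 'p, 'n) funct \<Rightarrow> 'p \<Rightarrow> 'o \<Rightarrow> 'n \<Rightarrow> bool" where
  "universal_arrow C D F y c e \<longleftrightarrow> c \<in> Obj C \<and> e \<in> hom D (FObj F c) y \<and>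
     (\<forall>x\<in>Obj C. \<forall>h\<in>hom D (FObj F x) y. \<exists>!t. t \<in> hom C x c \<and> e \<cdot>\<^bsub>D\<^esub> FArr F t = h)"

lemma functorD:
  assumes "is_functor C D F"
  shows "x \<in> Obj C \<Longrightarrow> FObj F x \<in> Obj D"
    and "f \<in> hom C x y \<Longrightarrow> FArr F f \<in> hom D (FObj F x) (FObj F y)"
    and "x \<in> Obj C \<Longrightarrow> FArr F (Idn C x) = Idn D (FObj F x)"
    and "f \<in> hom C x y \<Longrightarrow> g \<in> hom C y z \<Longrightarrow> FArr F (g \<cdot>\<^bsub>C\<^esub> f) = FArr F g \<cdot>\<^bsub>D\<^esub> FArr F f"
  using assms unfolding is_functor_def hom_def by auto

lemma (in categ) hom_comp [intro]: "f \<in> hom C x y \<Longrightarrow> g \<in> hom C y z \<Longrightarrow> g \<cdot> f \<in> hom C x z"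
  by (simp add: hom_iff)

lemma (in categ) hom_idn [intro]: "x \<in> Obj C \<Longrightarrow> Idn C x \<in> hom C x x"
  by (simp add: hom_iff)

lemma (in categ) hom_assoc:
  "f \<in> hom C w x \<Longrightarrow> g \<in> hom C x y \<Longrightarrow> h \<in> hom C y z \<Longrightarrow> (h \<cdot> g) \<cdot> f = h \<cdot> (g \<cdot> f)"
  by (simp add: hom_iff)

text \<open>The universal arrow is the counit at \<open>y\<close>, obtained as the transpose of the identity of \<open>G y\<close>.\<close>

lemma universal_arrows_of_right_adjoint:
  assumes "is_category C" "is_category D" and G: "right_adjoint_of C D F G" and y: "y \<in> Obj D"
  shows "\<exists>c e. universal_arrow C D F y c e"
proof -
  interpret C: categ C by standard fact
  interpret D: categ D by standard fact
  have F: "is_functor C D F" and G': "is_functor D C G"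
    using G by (auto simp: right_adjoint_of_def)
  obtain \<phi> where bij: "\<And>x y. x \<in> Obj C \<Longrightarrow> y \<in> Obj D \<Longrightarrow>
      bij_betw (\<phi> x y) (hom D (FObj F x) y) (hom C x (FObj G y))"
    and nat: "\<And>x' x y y' f k h. \<lbrakk>x' \<in> Obj C; x \<in> Obj C; y \<in> Obj D; y' \<in> Obj D; f \<in> hom C x' x;
      k \<in> hom D y y'; h \<in> hom D (FObj F x) y\<rbrakk> \<Longrightarrow>
      \<phi> x' y' (k \<cdot>\<^bsub>D\<^esub> h \<cdot>\<^bsub>D\<^esub> FArr F f) = FArr G k \<cdot>\<^bsub>C\<^esub> \<phi> x y h \<cdot>\<^bsub>C\<^esub> f"
    using G unfolding right_adjoint_of_def by blast
  define c where "c = FObj G y"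
  have c: "c \<in> Obj C" unfolding c_def using functorD(1)[OF G' y] .
  have "Idn C c \<in> hom C c c" using c by (rule C.hom_idn)
  then obtain e where e: "e \<in> hom D (FObj F c) y" "\<phi> c y e = Idn C c"
    using bij[OF c y] unfolding bij_betw_def c_def by (metis imageE)
  have tr: "\<phi> x y (e \<cdot>\<^bsub>D\<^esub> FArr F t) = t" if "x \<in> Obj C" "t \<in> hom C x c" for x t
  proof -
    have m: "FArr F t \<in> hom D (FObj F x) (FObj F c)" using functorD(2)[OF F that(2)] .
    have "\<phi> x y (Idn D y \<cdot>\<^bsub>D\<^esub> e \<cdot>\<^bsub>D\<^esub> FArr F t) = FArr G (Idn D y) \<cdot>\<^bsub>C\<^esub> \<phi> c y e \<cdot>\<^bsub>C\<^esub> t"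
      by (rule nat) (use that c y e D.hom_idn in auto)
    then show ?thesis using m e that y c functorD(3)[OF G' y]
      by (simp add: C.hom_iff D.hom_iff c_def[symmetric])
  qed
  have "\<exists>!t. t \<in> hom C x c \<and> e \<cdot>\<^bsub>D\<^esub> FArr F t = h" if x: "x \<in> Obj C" and h: "h \<in> hom D (FObj F x) y" for x h
  proof (rule ex1I[of _ "\<phi> x y h"])
    have t: "\<phi> x y h \<in> hom C x c" using bij[OF x y] h unfolding bij_betw_def c_def by blast
    have m: "e \<cdot>\<^bsub>D\<^esub> FArr F (\<phi> x y h) \<in> hom D (FObj F x) y"
      using D.hom_comp functorD(2)[OF F t] e by blast
    have "inj_on (\<phi> x y) (hom D (FObj F x) y)" using bij[OF x y] by (simp add: bij_betw_def)
    then have "e \<cdot>\<^bsub>D\<^esub> FArr F (\<phi> x y h) = h" by (rule inj_onD) (use tr[OF x t] m h in auto)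
    then show "\<phi> x y h \<in> hom C x c \<and> e \<cdot>\<^bsub>D\<^esub> FArr F (\<phi> x y h) = h" using t by simp
  qed (use tr[OF x] in auto)
  then show ?thesis unfolding universal_arrow_def using c e by blast
qed

text \<open>Only the values of the adjoint on objects are chosen, as the sources of universal arrows. Its
  action on arrows and the hom-bijections are then forced by the uniqueness of factorisations, which
  also yields functoriality and naturality.\<close>

lemma right_adjoint_of_universal_arrows:
  assumes "is_category C" "is_category D" and F: "is_functor C D F"
    and "\<And>y. y \<in> Obj D \<Longrightarrow> \<exists>c e. universal_arrow C D F y c e"
  shows "\<exists>G. right_adjoint_of C D F G"
proof -
  interpret C: categ C by standard fact
  interpret D: categ D by standard fact
  obtain c e where u: "\<And>y. y \<in> Obj D \<Longrightarrow> universal_arrow C D F y (c y) (e y)"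
    using assms(4) by metis
  have c: "y \<in> Obj D \<Longrightarrow> c y \<in> Obj C" and e: "y \<in> Obj D \<Longrightarrow> e y \<in> hom D (FObj F (c y)) y" for y
    using u unfolding universal_arrow_def by auto
  define \<phi> where "\<phi> x y h = (THE t. t \<in> hom C x (c y) \<and> e y \<cdot>\<^bsub>D\<^esub> FArr F t = h)" for x y h
  have \<phi>: "\<phi> x y h \<in> hom C x (c y)" "e y \<cdot>\<^bsub>D\<^esub> FArr F (\<phi> x y h) = h"
    if "x \<in> Obj C" "y \<in> Obj D" "h \<in> hom D (FObj F x) y" for x y h
  proof -
    have "\<exists>!t. t \<in> hom C x (c y) \<and> e y \<cdot>\<^bsub>D\<^esub> FArr F t = h"
      using u[OF that(2)] that(1,3) unfolding universal_arrow_def by blast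
    from theI'[OF this] show "\<phi> x y h \<in> hom C x (c y)" "e y \<cdot>\<^bsub>D\<^esub> FArr F (\<phi> x y h) = h"
      by (auto simp: \<phi>_def)
  qed
  have eq: "t = t'" if y: "y \<in> Obj D" and t: "t \<in> hom C x (c y)" and t': "t' \<in> hom C x (c y)"
    and r: "e y \<cdot>\<^bsub>D\<^esub> FArr F t = e y \<cdot>\<^bsub>D\<^esub> FArr F t'" for x y t t'
  proof -
    have x: "x \<in> Obj C" using t by (auto simp: C.hom_iff)
    have "e y \<cdot>\<^bsub>D\<^esub> FArr F t' \<in> hom D (FObj F x) y"
      using D.hom_comp functorD(2)[OF F t'] e[OF y] by blast
    then have "\<exists>!t. t \<in> hom C x (c y) \<and> e y \<cdot>\<^bsub>D\<^esub> FArr F t = e y \<cdot>\<^bsub>D\<^esub> FArr F t'"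
      using u[OF y] x unfolding universal_arrow_def by blast
    then show ?thesis using t t' r by blast
  qed
  define G where "G = \<lparr>FObj = \<lambda>y\<in>Obj D. c y,
    FArr = \<lambda>k\<in>Arr D. \<phi> (c (Dom D k)) (Cod D k) (k \<cdot>\<^bsub>D\<^esub> e (Dom D k))\<rparr>"
  have GO: "FObj G y = c y" if "y \<in> Obj D" for y using that by (simp add: G_def)
  have GA: "FArr G k \<in> hom C (c y) (c y')" "e y' \<cdot>\<^bsub>D\<^esub> FArr F (FArr G k) = k \<cdot>\<^bsub>D\<^esub> e y"
    if "k \<in> hom D y y'" for k y y'
  proof -
    have yy: "y \<in> Obj D" "y' \<in> Obj D" using that by (auto simp: D.hom_iff)
    have *: "FArr G k = \<phi> (c y) y' (k \<cdot>\<^bsub>D\<^esub> e y)" using that by (simp add: G_def D.hom_iff)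
    have "k \<cdot>\<^bsub>D\<^esub> e y \<in> hom D (FObj F (c y)) y'" using D.hom_comp that e yy by blast
    from \<phi>[OF c[OF yy(1)] yy(2) this] show "FArr G k \<in> hom C (c y) (c y')"
      "e y' \<cdot>\<^bsub>D\<^esub> FArr F (FArr G k) = k \<cdot>\<^bsub>D\<^esub> e y" by (simp_all add: *)
  qed
  have G: "is_functor D C G"
    unfolding is_functor_def
  proof (intro conjI ballI impI)
    show "FObj G \<in> Obj D \<rightarrow>\<^sub>E Obj C" using c by (auto simp: G_def)
    have "k \<in> hom D (Dom D k) (Cod D k)" if "k \<in> Arr D" for k using that by (simp add: D.hom_iff)
    from GA(1)[OF this] have *: "FArr G k \<in> Arr C" "Dom C (FArr G k) = c (Dom D k)"
       "Cod C (FArr G k) = c (Cod D k)" if "k \<in> Arr D" for k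
      using that by (simp_all add: C.hom_iff)
    have "FArr G \<in> extensional (Arr D)" by (simp add: G_def)
    then show "FArr G \<in> Arr D \<rightarrow>\<^sub>E Arr C" using * by (auto simp: PiE_def)
    fix k assume k: "k \<in> Arr D"
    show "Dom C (FArr G k) = FObj G (Dom D k)" "Cod C (FArr G k) = FObj G (Cod D k)"
      using *[OF k] k by (simp_all add: GO)
  next
    fix y assume y: "y \<in> Obj D"
    note i = D.hom_idn[OF y]
    have "FArr G (Idn D y) = Idn C (c y)"
      by (rule eq[OF y GA(1)[OF i] C.hom_idn[OF c[OF y]]])
        (use GA(2)[OF i] e[OF y] y c[OF y] in \<open>simp add: functorD(3)[OF F] D.hom_iff\<close>)
    then show "FArr G (Idn D y) = Idn C (FObj G y)" using y by (simp add: GO)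
  next
    fix k l assume kl: "k \<in> Arr D" "l \<in> Arr D" "Cod D k = Dom D l"
    define x y z where "x = Dom D k" and "y = Cod D k" and "z = Cod D l"
    have k: "k \<in> hom D x y" and l: "l \<in> hom D y z" using kl by (auto simp: x_def y_def z_def D.hom_iff)
    have o: "x \<in> Obj D" "y \<in> Obj D" "z \<in> Obj D" using kl by (auto simp: x_def y_def z_def)
    note lk = D.hom_comp[OF k l]
    show "FArr G (l \<cdot>\<^bsub>D\<^esub> k) = FArr G l \<cdot>\<^bsub>C\<^esub> FArr G k"
    proof (rule eq[OF o(3) GA(1)[OF lk] C.hom_comp[OF GA(1)[OF k] GA(1)[OF l]]])
      note m = functorD(2)[OF F GA(1)[OF k]] functorD(2)[OF F GA(1)[OF l]]
      have "e z \<cdot>\<^bsub>D\<^esub> FArr F (FArr G l \<cdot>\<^bsub>C\<^esub> FArr G k) = (e z \<cdot>\<^bsub>D\<^esub> FArr F (FArr G l)) \<cdot>\<^bsub>D\<^esub> FArr F (FArr G k)"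
        using D.hom_assoc[OF m e[OF o(3)]] functorD(4)[OF F GA(1)[OF k] GA(1)[OF l]] by simp
      also have "\<dots> = l \<cdot>\<^bsub>D\<^esub> (e y \<cdot>\<^bsub>D\<^esub> FArr F (FArr G k))"
        unfolding GA(2)[OF l] using D.hom_assoc[OF m(1) e[OF o(2)] l] .
      also have "\<dots> = (l \<cdot>\<^bsub>D\<^esub> k) \<cdot>\<^bsub>D\<^esub> e x"
        unfolding GA(2)[OF k] using D.hom_assoc[OF e[OF o(1)] k l] by simp
      finally show "e z \<cdot>\<^bsub>D\<^esub> FArr F (FArr G (l \<cdot>\<^bsub>D\<^esub> k)) = e z \<cdot>\<^bsub>D\<^esub> FArr F (FArr G l \<cdot>\<^bsub>C\<^esub> FArr G k)"
        using GA(2)[OF lk] by simp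
    qed
  qed
  have "right_adjoint_of C D F G"
    unfolding right_adjoint_of_def
  proof (intro conjI F G exI[of _ \<phi>] ballI)
    fix x y assume x: "x \<in> Obj C" and y: "y \<in> Obj D"
    show "bij_betw (\<phi> x y) (hom D (FObj F x) y) (hom C x (FObj G y))"
    proof (rule bij_betw_byWitness[where f' = "\<lambda>t. e y \<cdot>\<^bsub>D\<^esub> FArr F t"])
      have m: "e y \<cdot>\<^bsub>D\<^esub> FArr F t \<in> hom D (FObj F x) y" if "t \<in> hom C x (c y)" for t
        using D.hom_comp functorD(2)[OF F that] e[OF y] by blast
      then show "(\<lambda>t. e y \<cdot>\<^bsub>D\<^esub> FArr F t) ` hom C x (FObj G y) \<subseteq> hom D (FObj F x) y"
        using GO[OF y] by auto
      show "\<forall>t\<in>hom C x (FObj G y). \<phi> x y (e y \<cdot>\<^bsub>D\<^esub> FArr F t) = t"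
      proof
        fix t assume t: "t \<in> hom C x (FObj G y)"
        then have t: "t \<in> hom C x (c y)" using GO[OF y] by simp
        show "\<phi> x y (e y \<cdot>\<^bsub>D\<^esub> FArr F t) = t"
          by (rule eq[OF y \<phi>(1)[OF x y m[OF t]] t \<phi>(2)[OF x y m[OF t]]])
      qed
    qed (use \<phi>[OF x y] GO[OF y] in auto)
  next
    fix x' x y y' f k h
    assume o: "x' \<in> Obj C" "x \<in> Obj C" "y \<in> Obj D" "y' \<in> Obj D"
      and f: "f \<in> hom C x' x" and k: "k \<in> hom D y y'" and h: "h \<in> hom D (FObj F x) y"
    note Ff = functorD(2)[OF F f]
    have khf: "k \<cdot>\<^bsub>D\<^esub> h \<cdot>\<^bsub>D\<^esub> FArr F f \<in> hom D (FObj F x') y'" using D.hom_comp k h Ff by blast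
    note ph = \<phi>[OF o(2,3) h]
    have pf: "\<phi> x y h \<cdot>\<^bsub>C\<^esub> f \<in> hom C x' (c y)" using C.hom_comp f ph by blast
    have kpf: "FArr G k \<cdot>\<^bsub>C\<^esub> \<phi> x y h \<cdot>\<^bsub>C\<^esub> f \<in> hom C x' (c y')" using C.hom_comp pf GA(1)[OF k] by blast
    show "\<phi> x' y' (k \<cdot>\<^bsub>D\<^esub> h \<cdot>\<^bsub>D\<^esub> FArr F f) = FArr G k \<cdot>\<^bsub>C\<^esub> \<phi> x y h \<cdot>\<^bsub>C\<^esub> f"
    proof (rule eq[OF o(4) \<phi>(1)[OF o(1,4) khf] kpf])
      have "e y' \<cdot>\<^bsub>D\<^esub> FArr F (FArr G k \<cdot>\<^bsub>C\<^esub> \<phi> x y h \<cdot>\<^bsub>C\<^esub> f)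
          = e y' \<cdot>\<^bsub>D\<^esub> (FArr F (FArr G k) \<cdot>\<^bsub>D\<^esub> (FArr F (\<phi> x y h) \<cdot>\<^bsub>D\<^esub> FArr F f))"
        using functorD(4)[OF F pf GA(1)[OF k]] functorD(4)[OF F f ph(1)] by simp
      also have "\<dots> = (e y' \<cdot>\<^bsub>D\<^esub> FArr F (FArr G k)) \<cdot>\<^bsub>D\<^esub> (FArr F (\<phi> x y h) \<cdot>\<^bsub>D\<^esub> FArr F f)"
        using D.hom_assoc[OF D.hom_comp[OF Ff functorD(2)[OF F ph(1)]] functorD(2)[OF F GA(1)[OF k]]
            e[OF o(4)]]
        by simp
      also have "\<dots> = k \<cdot>\<^bsub>D\<^esub> (e y \<cdot>\<^bsub>D\<^esub> (FArr F (\<phi> x y h) \<cdot>\<^bsub>D\<^esub> FArr F f))"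
        unfolding GA(2)[OF k]
        using D.hom_assoc[OF D.hom_comp[OF Ff functorD(2)[OF F ph(1)]] e[OF o(3)] k] .
      also have "\<dots> = k \<cdot>\<^bsub>D\<^esub> ((e y \<cdot>\<^bsub>D\<^esub> FArr F (\<phi> x y h)) \<cdot>\<^bsub>D\<^esub> FArr F f)"
        using D.hom_assoc[OF Ff functorD(2)[OF F ph(1)] e[OF o(3)]] by simp
      finally show "e y' \<cdot>\<^bsub>D\<^esub> FArr F (\<phi> x' y' (k \<cdot>\<^bsub>D\<^esub> h \<cdot>\<^bsub>D\<^esub> FArr F f))
          = e y' \<cdot>\<^bsub>D\<^esub> FArr F (FArr G k \<cdot>\<^bsub>C\<^esub> \<phi> x y h \<cdot>\<^bsub>C\<^esub> f)"
        using \<phi>(2)[OF o(1,4) khf] ph(2) by simp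
    qed
  qed
  then show ?thesis ..
qed

section \<open>Exponentiable arrows and distributivity pullbacks\<close>

context finitely_complete begin

lemma slice_category: "is_category (slice C y)"
  unfolding slice_def
proof (rule category_ofI)
  fix a b c h k
  assume "h \<in> hom C (Dom C a) (Dom C b) \<and> b \<cdot> h = a" "k \<in> hom C (Dom C b) (Dom C c) \<and> c \<cdot> k = b"
    and "c \<in> {a \<in> Arr C. Cod C a = y}"
  then show "k \<cdot> h \<in> hom C (Dom C a) (Dom C c) \<and> c \<cdot> (k \<cdot> h) = a"
    using comp_extend1[of c k b h] by (simp add: hom_iff)
qed (simp_all add: hom_iff)

text \<open>Objects, arrows and terminal objects of the category of pullbacks around \<open>(f, g)\<close>, with the
  triples unpacked.\<close>

definition around :: "'m \<Rightarrow> 'm \<Rightarrow> 'm \<Rightarrow> 'm \<Rightarrow> 'm \<Rightarrow> bool" where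
  "around f g a b c \<longleftrightarrow> a \<in> Arr C \<and> Cod C a = Dom C g \<and> is_pullback C f c (g \<cdot> a) b"

definition around_mor :: "'m \<Rightarrow> 'm \<Rightarrow> 'm \<Rightarrow> 'm \<Rightarrow> 'm \<Rightarrow> 'm \<Rightarrow> 'm \<Rightarrow> 'm \<Rightarrow> bool" where
  "around_mor a' b' c' a b c s t \<longleftrightarrow>
     s \<in> hom C (Dom C a') (Dom C a) \<and> t \<in> hom C (Dom C c') (Dom C c) \<and>
     a \<cdot> s = a' \<and> b \<cdot> s = t \<cdot> b' \<and> c \<cdot> t = c'"

definition distributive :: "'m \<Rightarrow> 'm \<Rightarrow> 'm \<Rightarrow> 'm \<Rightarrow> 'm \<Rightarrow> bool" where
  "distributive f g a b c \<longleftrightarrow> around f g a b c \<and>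
     (\<forall>a' b' c'. around f g a' b' c' \<longrightarrow> (\<exists>!w. around_mor a' b' c' a b c (fst w) (snd w)))"

lemma terminal_pullback_around:
  "is_terminal (pullbacks_around C f g) (a, b, c) \<longleftrightarrow> distributive f g a b c"
proof -
  have 1: "(a, b, c) \<in> Obj (pullbacks_around C f g) \<longleftrightarrow> around f g a b c" for a b c
    by (simp add: pullbacks_around_def around_def)
  have 2: "(\<exists>!h. h \<in> hom (pullbacks_around C f g) (a', b', c') (a, b, c)) \<longleftrightarrow>
     (\<exists>!w. around_mor a' b' c' a b c (fst w) (snd w))" (is "?l \<longleftrightarrow> ?r")
    if "around f g a b c" "around f g a' b' c'" for a' b' c'
  proof -
    have *: "h \<in> hom (pullbacks_around C f g) (a', b', c') (a, b, c) \<longleftrightarrow>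
       source h = (a', b', c') \<and> target h = (a, b, c) \<and>
           around_mor a' b' c' a b c (fst (label h)) (snd (label h))" for h
      using that by (auto simp: pullbacks_around_def around_def around_mor_def split_beta)
    show ?thesis
    proof
      assume ?l
      then obtain h where h: "h \<in> hom (pullbacks_around C f g) (a', b', c') (a, b, c)"
        and u: "\<And>h'. h' \<in> hom (pullbacks_around C f g) (a', b', c') (a, b, c) \<Longrightarrow> h' = h" by blast
      show ?r
      proof (rule ex1I[of _ "label h"])
        show "around_mor a' b' c' a b c (fst (label h)) (snd (label h))" using h by (simp only: *)
        fix w assume "around_mor a' b' c' a b c (fst w) (snd w)"
        then have "((a', b', c'), w, (a, b, c)) = h" by (intro u) (simp only: * fst_conv snd_conv)
        then show "w = label h" by auto
      qed
    next
      assume ?r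
      then obtain w where w: "around_mor a' b' c' a b c (fst w) (snd w)"
        and u: "\<And>w'. around_mor a' b' c' a b c (fst w') (snd w') \<Longrightarrow> w' = w" by blast
      show ?l
      proof (rule ex1I[of _ "((a', b', c'), w, (a, b, c))"])
        show "((a', b', c'), w, (a, b, c)) \<in> hom (pullbacks_around C f g) (a', b', c') (a, b, c)"
          using w by (simp only: * fst_conv snd_conv)
        fix h assume "h \<in> hom (pullbacks_around C f g) (a', b', c') (a, b, c)"
        then have h: "source h = (a', b', c')" "target h = (a, b, c)"
          "around_mor a' b' c' a b c (fst (label h)) (snd (label h))" by (simp_all only: *)
        from u[OF h(3)] show "h = ((a', b', c'), w, (a, b, c))" using h(1,2) by (metis prod.collapse)
      qed
    qed
  qed
  have "is_terminal (pullbacks_around C f g) (a, b, c) \<longleftrightarrow> around f g a b c \<and>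
      (\<forall>a' b' c'. around f g a' b' c' \<longrightarrow>
        (\<exists>!h. h \<in> hom (pullbacks_around C f g) (a', b', c') (a, b, c)))"
    unfolding is_terminal_def by (simp add: Ball_def split_paired_All 1)
  also have "\<dots> \<longleftrightarrow> distributive f g a b c"
    unfolding distributive_def
    by (rule conj_cong[OF refl], intro all_cong1 imp_cong refl) (rule 2)
  finally show ?thesis .
qed

lemma aroundD:
  assumes "around f g a b c" "g \<in> Arr C" "Cod C g = Dom C f"
  shows "f \<in> Arr C" "a \<in> Arr C" "b \<in> Arr C" "c \<in> Arr C" "Cod C c = Cod C f" "Cod C a = Dom C g"
    "Dom C b = Dom C a" "Cod C b = Dom C c" "c \<cdot> b = f \<cdot> (g \<cdot> a)" "is_pullback C f c (g \<cdot> a) b"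
proof -
  have p: "is_pullback C f c (g \<cdot> a) b" and a: "a \<in> Arr C" "Cod C a = Dom C g"
    using assms(1) by (auto simp: around_def)
  from p a show "is_pullback C f c (g \<cdot> a) b" "a \<in> Arr C" "Cod C a = Dom C g" by simp_all
  show "f \<in> Arr C" "b \<in> Arr C" "c \<in> Arr C" "Cod C c = Cod C f"
    "Dom C b = Dom C a" "Cod C b = Dom C c" "c \<cdot> b = f \<cdot> (g \<cdot> a)"
    using pullbackD[OF p] assms(2,3) a by simp_all
qed

lemma around_morD:
  assumes "around_mor a' b' c' a b c s t"
  shows "s \<in> Arr C" "t \<in> Arr C" "Dom C s = Dom C a'" "Cod C s = Dom C a" "Dom C t = Dom C c'"
    "Cod C t = Dom C c" "a \<cdot> s = a'" "b \<cdot> s = t \<cdot> b'" "c \<cdot> t = c'"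
  using assms unfolding around_mor_def by (auto simp: hom_iff)

lemma around_morI:
  assumes "s \<in> Arr C" "t \<in> Arr C" "Dom C s = Dom C a'" "Cod C s = Dom C a" "Dom C t = Dom C c'"
    "Cod C t = Dom C c" "a \<cdot> s = a'" "b \<cdot> s = t \<cdot> b'" "c \<cdot> t = c'"
  shows "around_mor a' b' c' a b c s t"
  using assms unfolding around_mor_def by (auto simp: hom_iff)

lemma distributive_around: "distributive f g a b c \<Longrightarrow> around f g a b c"
  by (simp add: distributive_def)

lemma distributive_lift:
  assumes "distributive f g a b c" "around f g a' b' c'"
  obtains s t where "around_mor a' b' c' a b c s t"
  using assms unfolding distributive_def by blast

lemma distributive_eq:
  assumes "distributive f g a b c" "around f g a' b' c'"
    and "around_mor a' b' c' a b c s t" "around_mor a' b' c' a b c s' t'"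
  shows "s = s'" "t = t'"
proof -
  have "\<exists>!w. around_mor a' b' c' a b c (fst w) (snd w)"
    using assms(1,2) unfolding distributive_def by blast
  then have "(s, t) = (s', t')" using assms(3,4) by (metis fst_conv snd_conv)
  then show "s = s'" "t = t'" by auto
qed

lemma distributiveI:
  assumes "around f g a b c"
    and "\<And>a' b' c'. around f g a' b' c' \<Longrightarrow> \<exists>s t. around_mor a' b' c' a b c s t"
    and "\<And>a' b' c' s t s' t'. \<lbrakk>around f g a' b' c'; around_mor a' b' c' a b c s t;
      around_mor a' b' c' a b c s' t'\<rbrakk> \<Longrightarrow> s = s' \<and> t = t'"
  shows "distributive f g a b c"
  unfolding distributive_def
proof (intro conjI assms(1) allI impI)
  fix a' b' c' assume r: "around f g a' b' c'"
  then obtain s t where "around_mor a' b' c' a b c s t" using assms(2) by blast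
  then show "\<exists>!w. around_mor a' b' c' a b c (fst w) (snd w)"
    by (intro ex1I[of _ "(s, t)"]) (use assms(3)[OF r] in \<open>auto simp: prod_eq_iff\<close>)
qed

lemma pullback_functor_arrow:
  assumes f: "f \<in> Arr C" and \<alpha>: "(x, t, y) \<in> Arr (slice C (Cod C f))"
  obtains w where "FArr (pullback_functor C f) (x, t, y) = (pb1 C f x, w, pb1 C f y)"
    "w \<in> Arr C" "Dom C w = Dom C (pb1 C f x)" "Cod C w = Dom C (pb1 C f y)"
    "pb1 C f y \<cdot> w = pb1 C f x" "pb2 C f y \<cdot> w = t \<cdot> pb2 C f x"
proof -
  have xy: "x \<in> Arr C" "y \<in> Arr C" "t \<in> Arr C" "Cod C x = Cod C f" "Cod C y = Cod C f"
    "Dom C t = Dom C x" "Cod C t = Dom C y" "y \<cdot> t = x"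
    using \<alpha> by (auto simp: slice_def hom_iff)
  have px: "is_pullback C f x (pb1 C f x) (pb2 C f x)" and py: "is_pullback C f y (pb1 C f y) (pb2 C f y)"
    using f xy by (auto intro: pb_pullback)
  note D = pullbackD[OF px]
  have "y \<cdot> t \<cdot> pb2 C f x = x \<cdot> pb2 C f x"
    by (rule comp_extend1) (use xy D in simp_all)
  then have e: "f \<cdot> pb1 C f x = y \<cdot> (t \<cdot> pb2 C f x)" using D by simp
  show thesis
    by (rule that, use \<alpha> in \<open>simp add: pullback_functor_def\<close>;
      (rule induced_props[OF py]); (use xy D e in simp; fail)?)
qed

lemma pullback_functor_object: "x \<in> Arr C \<Longrightarrow> Cod C x = Cod C f \<Longrightarrow> FObj (pullback_functor C f) x = pb1 C f x"
  by (simp add: pullback_functor_def slice_def)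

lemma pullback_functor_functor:
  assumes f: "f \<in> Arr C"
  shows "is_functor (slice C (Cod C f)) (slice C (Dom C f)) (pullback_functor C f)"
proof -
  have pb: "is_pullback C f x (pb1 C f x) (pb2 C f x)" if "x \<in> Arr C" "Cod C x = Cod C f" for x
    using f that by (auto intro: pb_pullback)
  show ?thesis
    unfolding is_functor_def
  proof (intro conjI ballI impI)
    show "FObj (pullback_functor C f) \<in> Obj (slice C (Cod C f)) \<rightarrow>\<^sub>E Obj (slice C (Dom C f))"
      using pullbackD[OF pb] by (auto simp: pullback_functor_def slice_def)
    have arr: "FArr (pullback_functor C f) \<alpha> \<in> Arr (slice C (Dom C f)) \<and>
       source (FArr (pullback_functor C f) \<alpha>) = FObj (pullback_functor C f) (source \<alpha>) \<and>
       target (FArr (pullback_functor C f) \<alpha>) = FObj (pullback_functor C f) (target \<alpha>)"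
      if \<alpha>: "\<alpha> \<in> Arr (slice C (Cod C f))" for \<alpha>
    proof -
      obtain x t y where a: "\<alpha> = (x, t, y)" by (metis prod.collapse)
      have xy: "x \<in> Arr C" "y \<in> Arr C" "Cod C x = Cod C f" "Cod C y = Cod C f"
        using \<alpha> by (auto simp: slice_def hom_iff a)
      show ?thesis
        by (rule pullback_functor_arrow[OF f \<alpha>[unfolded a]])
          (use xy pullbackD[OF pb[OF xy(1,3)]] pullbackD[OF pb[OF xy(2,4)]]
            in \<open>simp add: a slice_def hom_iff pullback_functor_object\<close>)
    qed
    have "FArr (pullback_functor C f) \<in> extensional (Arr (slice C (Cod C f)))"
      by (simp add: pullback_functor_def)
    then show "FArr (pullback_functor C f) \<in> Arr (slice C (Cod C f)) \<rightarrow>\<^sub>E Arr (slice C (Dom C f))"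
      using arr by (auto simp: PiE_def)
    fix \<alpha> assume "\<alpha> \<in> Arr (slice C (Cod C f))"
    from arr[OF this] show "Dom (slice C (Dom C f)) (FArr (pullback_functor C f) \<alpha>) =
         FObj (pullback_functor C f) (Dom (slice C (Cod C f)) \<alpha>)"
      "Cod (slice C (Dom C f)) (FArr (pullback_functor C f) \<alpha>) =
         FObj (pullback_functor C f) (Cod (slice C (Cod C f)) \<alpha>)"
      by (auto simp: slice_def)
  next
    fix x assume "x \<in> Obj (slice C (Cod C f))"
    then have x: "x \<in> Arr C" "Cod C x = Cod C f" by (auto simp: slice_def)
    note D = pullbackD[OF pb[OF x]]
    have m: "(x, Idn C (Dom C x), x) \<in> Arr (slice C (Cod C f))" using x by (auto simp: slice_def hom_iff)
    obtain w where w: "FArr (pullback_functor C f) (x, Idn C (Dom C x), x) = (pb1 C f x, w, pb1 C f x)"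
      "w \<in> Arr C" "Dom C w = Dom C (pb1 C f x)" "Cod C w = Dom C (pb1 C f x)"
      "pb1 C f x \<cdot> w = pb1 C f x" "pb2 C f x \<cdot> w = Idn C (Dom C x) \<cdot> pb2 C f x"
      by (rule pullback_functor_arrow[OF f m])
    have "w = Idn C (Dom C (pb1 C f x))"
      by (rule pullback_eq[OF pb[OF x]]) (use D x w in simp_all)
    then show "FArr (pullback_functor C f) (Idn (slice C (Cod C f)) x) =
      Idn (slice C (Dom C f)) (FObj (pullback_functor C f) x)"
      using x D w(1) by (simp add: pullback_functor_object slice_def)
  next
    fix \<alpha> \<beta> assume ab: "\<alpha> \<in> Arr (slice C (Cod C f))" "\<beta> \<in> Arr (slice C (Cod C f))"
      "Cod (slice C (Cod C f)) \<alpha> = Dom (slice C (Cod C f)) \<beta>"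
    obtain x t y where a: "\<alpha> = (x, t, y)" by (metis prod.collapse)
    obtain y' t' z where b0: "\<beta> = (y', t', z)" by (metis prod.collapse)
    have "y' = y" using ab(3) by (simp add: a b0 slice_def)
    then have b: "\<beta> = (y, t', z)" using b0 by simp
    have xy: "x \<in> Arr C" "y \<in> Arr C" "z \<in> Arr C" "t \<in> Arr C" "t' \<in> Arr C" "Cod C x = Cod C f" "Cod C y =
        Cod C f"
        "Cod C z = Cod C f" "Dom C t = Dom C x" "Cod C t = Dom C y" "y \<cdot> t = x"
         "Dom C t' = Dom C y" "Cod C t' = Dom C z" "z \<cdot> t' = y"
      using ab by (simp_all add: slice_def hom_iff a b)
    note e = comp_extend1[OF xy(14)]
    have m: "(x, t' \<cdot> t, z) \<in> Arr (slice C (Cod C f))" using xy by (auto simp: slice_def hom_iff e)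
    note px = pb[OF xy(1,6)] and py = pb[OF xy(2,7)] and pz = pb[OF xy(3,8)]
    note D = pullbackD(3,4,6-8)[OF px] pullbackD(3,4,6-8)[OF py] pullbackD(3,4,6-8)[OF pz]
    obtain w where w: "FArr (pullback_functor C f) (x, t, y) = (pb1 C f x, w, pb1 C f y)"
      "w \<in> Arr C" "Dom C w = Dom C (pb1 C f x)" "Cod C w = Dom C (pb1 C f y)"
      "pb1 C f y \<cdot> w = pb1 C f x" "pb2 C f y \<cdot> w = t \<cdot> pb2 C f x"
      by (rule pullback_functor_arrow[OF f ab(1)[unfolded a]])
    obtain w' where w': "FArr (pullback_functor C f) (y, t', z) = (pb1 C f y, w', pb1 C f z)"
      "w' \<in> Arr C" "Dom C w' = Dom C (pb1 C f y)" "Cod C w' = Dom C (pb1 C f z)"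
      "pb1 C f z \<cdot> w' = pb1 C f y" "pb2 C f z \<cdot> w' = t' \<cdot> pb2 C f y"
      by (rule pullback_functor_arrow[OF f ab(2)[unfolded b]])
    obtain w2 where w2: "FArr (pullback_functor C f) (x, t' \<cdot> t, z) = (pb1 C f x, w2, pb1 C f z)"
      "w2 \<in> Arr C" "Dom C w2 = Dom C (pb1 C f x)" "Cod C w2 = Dom C (pb1 C f z)"
      "pb1 C f z \<cdot> w2 = pb1 C f x" "pb2 C f z \<cdot> w2 = (t' \<cdot> t) \<cdot> pb2 C f x"
      by (rule pullback_functor_arrow[OF f m])
    have "w2 = w' \<cdot> w"
      by (rule pullback_eq[OF pz])
        (use D xy w w' w2 in \<open>simp_all add: comp_extend1[OF w'(5)] comp_extend[OF w'(6)]\<close>)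
    then show "FArr (pullback_functor C f) (\<beta> \<cdot>\<^bsub>slice C (Cod C f)\<^esub> \<alpha>) =
      FArr (pullback_functor C f) \<beta> \<cdot>\<^bsub>slice C (Dom C f)\<^esub> FArr (pullback_functor C f) \<alpha>"
      using w w' w2 by (simp add: a b slice_def)
  qed
qed

lemma comp_extend2:
  assumes "g \<cdot> f \<cdot> e = k"
    and "e \<in> Arr C" "f \<in> Arr C" "g \<in> Arr C" "x \<in> Arr C" "Cod C e = Dom C f" "Cod C f = Dom C g"
        "Cod C x = Dom C e"
  shows "g \<cdot> f \<cdot> e \<cdot> x = k \<cdot> x"
  using comp_extend1[of g "f \<cdot> e" k x] assms by simp

text \<open>A distributivity pullback around \<open>(f, g)\<close> is a universal arrow to \<open>g\<close> from the pullback
  functor along \<open>f\<close>. The functor uses chosen pullbacks of \<open>f\<close>, while the objects around \<open>(f, g)\<close>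
  carry arbitrary ones; the proof transports arrows along the comparison \<open>i\<close> with inverse \<open>j\<close>.\<close>

lemma exponentiable_distributive:
  assumes ex: "exponentiable C f" and g: "g \<in> Arr C" "Cod C g = Dom C f"
  shows "\<exists>a b c. distributive f g a b c"
proof -
  have f: "f \<in> Arr C" using ex by (simp add: exponentiable_def)
  let ?F = "pullback_functor C f"
  obtain G where "right_adjoint_of (slice C (Cod C f)) (slice C (Dom C f)) ?F G"
    using ex by (auto simp: exponentiable_def)
  from universal_arrows_of_right_adjoint[OF slice_category slice_category this, of g]
  obtain c e where u: "universal_arrow (slice C (Cod C f)) (slice C (Dom C f)) ?F g c e"
    using g by (auto simp: slice_def)
  define a where "a = label e"
  have c: "c \<in> Arr C" "Cod C c = Cod C f" using u by (simp_all add: universal_arrow_def slice_def)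
  have "e \<in> hom (slice C (Dom C f)) (pb1 C f c) g"
    using u c by (simp add: universal_arrow_def pullback_functor_object)
  then have e: "e = (pb1 C f c, a, g)" and a: "a \<in> Arr C" "Dom C a = Dom C (pb1 C f c)" "Cod C a = Dom C g"
    and ga: "g \<cdot> a = pb1 C f c"
    unfolding a_def by (simp_all add: slice_def hom_iff prod_eq_iff)
  have pc: "is_pullback C f c (pb1 C f c) (pb2 C f c)" using f c by (auto intro: pb_pullback)
  note Dc = pullbackD(3,4,6-9)[OF pc]
  have uni: "\<exists>!t. t \<in> hom (slice C (Cod C f)) x c \<and> e \<cdot>\<^bsub>slice C (Dom C f)\<^esub> FArr ?F t = (pb1 C f x, h, g)"
    if "x \<in> Arr C" "Cod C x = Cod C f" "h \<in> hom C (Dom C (pb1 C f x)) (Dom C g)" "g \<cdot> h = pb1 C f x" for x h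
  proof -
    have "is_pullback C f x (pb1 C f x) (pb2 C f x)" using f that by (auto intro: pb_pullback)
    note D = pullbackD[OF this]
    have "(pb1 C f x, h, g) \<in> hom (slice C (Dom C f)) (FObj ?F x) g"
      using that D g by (simp add: slice_def hom_iff pullback_functor_object)
    moreover have "x \<in> Obj (slice C (Cod C f))" using that by (simp add: slice_def)
    ultimately show ?thesis using u unfolding universal_arrow_def by blast
  qed
  have "distributive f g a (pb2 C f c) c"
  proof (rule distributiveI)
    show ar: "around f g a (pb2 C f c) c" unfolding around_def using a ga pc by simp
    fix a' b' c' assume r: "around f g a' b' c'"
    note R = aroundD[OF r g]
    have p': "is_pullback C f c' (pb1 C f c') (pb2 C f c')" using f R by (auto intro: pb_pullback)
    note D' = pullbackD(3,4,6-9)[OF p']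
    obtain i where i: "i \<in> Arr C" "Dom C i = Dom C (pb1 C f c')" "Cod C i = Dom C a'"
        "(g \<cdot> a') \<cdot> i = pb1 C f c'" "b' \<cdot> i = pb2 C f c'"
      by (rule pullback_lift[OF R(10), of "pb1 C f c'" "pb2 C f c'"]) (use D' R g in simp_all)
    obtain j where j: "j \<in> Arr C" "Dom C j = Dom C a'" "Cod C j = Dom C (pb1 C f c')"
        "pb1 C f c' \<cdot> j = g \<cdot> a'" "pb2 C f c' \<cdot> j = b'"
      by (rule pullback_lift[OF p', of "g \<cdot> a'" b']) (use D' R g in simp_all)
    have gi: "g \<cdot> a' \<cdot> i = pb1 C f c'" using i R g by simp
    have ij: "i \<cdot> j = Idn C (Dom C a')"
      by (rule pullback_eq[OF R(10)])
        (use i j R g gi D' in \<open>simp_all add: comp_extend1[OF i(5)] comp_extend2[OF gi]\<close>)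
    have h: "a' \<cdot> i \<in> hom C (Dom C (pb1 C f c')) (Dom C g)" using i R by (simp add: hom_iff)
    note U = uni[OF R(4,5) h gi]
    have eF: "e \<cdot>\<^bsub>slice C (Dom C f)\<^esub> FArr ?F \<tau> = (pb1 C f c', a \<cdot> w, g)"
      if "FArr ?F \<tau> = (pb1 C f c', w, pb1 C f c)" for \<tau> w
      using that by (simp add: e slice_def)
    have key: "around_mor a' b' c' a (pb2 C f c) c s t \<longleftrightarrow>
       (c', t, c) \<in> hom (slice C (Cod C f)) c' c \<and>
       e \<cdot>\<^bsub>slice C (Dom C f)\<^esub> FArr ?F (c', t, c) = (pb1 C f c', a' \<cdot> i, g) \<and>
       s = label (FArr ?F (c', t, c)) \<cdot> j" (is "?l \<longleftrightarrow> ?r") for s t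
    proof
      assume l: ?l
      note S = around_morD[OF l]
      have t: "(c', t, c) \<in> Arr (slice C (Cod C f))" using S R c by (simp add: slice_def hom_iff)
      obtain w where w: "FArr ?F (c', t, c) = (pb1 C f c', w, pb1 C f c)"
        "w \<in> Arr C" "Dom C w = Dom C (pb1 C f c')" "Cod C w = Dom C (pb1 C f c)"
        "pb1 C f c \<cdot> w = pb1 C f c'" "pb2 C f c \<cdot> w = t \<cdot> pb2 C f c'"
        by (rule pullback_functor_arrow[OF f t])
      have gs: "pb1 C f c \<cdot> s = g \<cdot> a'" using comp_extend1[OF ga, of s] S a g by simp
      have "w = s \<cdot> i"
        by (rule pullback_eq[OF pc])
          (use w S i R a g gi D' Dc in \<open>simp_all add: comp_extend1[OF gs] comp_extend[OF S(8)]\<close>)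
      then have sw: "s = w \<cdot> j" "a \<cdot> w = a' \<cdot> i" using i j ij S a R by (simp_all add: comp_extend1[OF S(7)])
      show ?r using t sw eF[OF w(1)] w(1) by (simp add: slice_def)
    next
      assume r: ?r
      have t: "(c', t, c) \<in> Arr (slice C (Cod C f))" using r by (simp add: slice_def)
      obtain w where w: "FArr ?F (c', t, c) = (pb1 C f c', w, pb1 C f c)"
        "w \<in> Arr C" "Dom C w = Dom C (pb1 C f c')" "Cod C w = Dom C (pb1 C f c)"
        "pb1 C f c \<cdot> w = pb1 C f c'" "pb2 C f c \<cdot> w = t \<cdot> pb2 C f c'"
        by (rule pullback_functor_arrow[OF f t])
      have t': "t \<in> Arr C" "Dom C t = Dom C c'" "Cod C t = Dom C c" "c \<cdot> t = c'"
        using t by (simp_all add: slice_def hom_iff)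
      have s: "s = w \<cdot> j" "a \<cdot> w = a' \<cdot> i" using r eF[OF w(1)] w(1) by simp_all
      show ?l
        by (rule around_morI) (use s w t' a i j ij R D' Dc in
            \<open>simp_all add: comp_extend1[OF s(2)] comp_extend[OF w(6)]\<close>)
    qed
    obtain \<tau> where T: "\<tau> \<in> hom (slice C (Cod C f)) c' c"
      "e \<cdot>\<^bsub>slice C (Dom C f)\<^esub> FArr ?F \<tau> = (pb1 C f c', a' \<cdot> i, g)" using U by blast
    have "\<tau> = (c', label \<tau>, c)" using T(1) by (simp add: slice_def prod_eq_iff)
    then have "around_mor a' b' c' a (pb2 C f c) c (label (FArr ?F (c', label \<tau>, c)) \<cdot> j) (label \<tau>)"
      unfolding key using T by metis
    then show "\<exists>s t. around_mor a' b' c' a (pb2 C f c) c s t" by blast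
    fix s t s' t' assume "around_mor a' b' c' a (pb2 C f c) c s t" "around_mor a' b' c' a (pb2 C f c) c s' t'"
    then have k: "(c', t, c) \<in> hom (slice C (Cod C f)) c' c"
       "e \<cdot>\<^bsub>slice C (Dom C f)\<^esub> FArr ?F (c', t, c) = (pb1 C f c', a' \<cdot> i, g)"
       "s = label (FArr ?F (c', t, c)) \<cdot> j"
       "(c', t', c) \<in> hom (slice C (Cod C f)) c' c"
       "e \<cdot>\<^bsub>slice C (Dom C f)\<^esub> FArr ?F (c', t', c) = (pb1 C f c', a' \<cdot> i, g)"
       "s' = label (FArr ?F (c', t', c)) \<cdot> j"
      unfolding key by blast+
    have "(c', t, c) = (c', t', c)" using U k(1,2,4,5) by blast
    then show "s = s' \<and> t = t'" using k(3,6) by simp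
  qed
  then show ?thesis by blast
qed

text \<open>Composing \<open>a\<close> with the comparison \<open>i\<close> from the chosen pullback turns a distributivity pullback
  \<open>(a, b, c)\<close> around \<open>(f, g)\<close> into a universal arrow to \<open>g\<close>; universal arrows to all \<open>g\<close> assemble to
  a right adjoint.\<close>

lemma distributive_exponentiable:
  assumes f: "f \<in> Arr C" and d: "\<And>g. g \<in> Arr C \<Longrightarrow> Cod C g = Dom C f \<Longrightarrow> \<exists>a b c. distributive f g a b c"
  shows "exponentiable C f"
proof -
  let ?F = "pullback_functor C f"
  have "\<exists>c e. universal_arrow (slice C (Cod C f)) (slice C (Dom C f)) ?F g c e"
    if "g \<in> Obj (slice C (Dom C f))" for g
  proof -
    have g: "g \<in> Arr C" "Cod C g = Dom C f" using that by (simp_all add: slice_def)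
    obtain a b c where dis: "distributive f g a b c" using d[OF g] by blast
    note R = aroundD[OF distributive_around[OF dis] g]
    have pc: "is_pullback C f c (pb1 C f c) (pb2 C f c)" using f R by (auto intro: pb_pullback)
    note Dc = pullbackD(3,4,6-9)[OF pc]
    obtain i where i: "i \<in> Arr C" "Dom C i = Dom C (pb1 C f c)" "Cod C i = Dom C a"
        "(g \<cdot> a) \<cdot> i = pb1 C f c" "b \<cdot> i = pb2 C f c"
      by (rule pullback_lift[OF R(10), of "pb1 C f c" "pb2 C f c"]) (use Dc R g in simp_all)
    have gi: "g \<cdot> a \<cdot> i = pb1 C f c" using i R g by simp
    let ?e = "(pb1 C f c, a \<cdot> i, g)"
    have "universal_arrow (slice C (Cod C f)) (slice C (Dom C f)) ?F g c ?e"
      unfolding universal_arrow_def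
    proof (intro conjI ballI)
      show "c \<in> Obj (slice C (Cod C f))" using R by (simp add: slice_def)
      show "?e \<in> hom (slice C (Dom C f)) (FObj ?F c) g"
        using g Dc R i gi by (simp add: slice_def hom_iff pullback_functor_object)
      fix x h0 assume x0: "x \<in> Obj (slice C (Cod C f))" and h0: "h0 \<in> hom (slice C (Dom C f)) (FObj ?F x) g"
      have x: "x \<in> Arr C" "Cod C x = Cod C f" using x0 by (simp_all add: slice_def)
      have px: "is_pullback C f x (pb1 C f x) (pb2 C f x)" using f x by (auto intro: pb_pullback)
      note Dx = pullbackD(3,4,6-9)[OF px]
      define h where "h = label h0"
      have h0': "h0 = (pb1 C f x, h, g)" and h: "h \<in> Arr C" "Dom C h = Dom C (pb1 C f x)" "Cod C h =
          Dom C g" "g \<cdot> h = pb1 C f x"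
        using h0 x by (simp_all add: slice_def hom_iff prod_eq_iff pullback_functor_object h_def)
      have r: "around f g h (pb2 C f x) x" unfolding around_def using h px by simp
      have key: "(x, t, c) \<in> hom (slice C (Cod C f)) x c \<and> ?e \<cdot>\<^bsub>slice C (Dom C f)\<^esub> FArr ?F (x, t, c) = h0 \<longleftrightarrow>
         (\<exists>s. around_mor h (pb2 C f x) x a b c s t)" (is "?l \<longleftrightarrow> ?r") for t
      proof -
        { assume t: "(x, t, c) \<in> Arr (slice C (Cod C f))"
          have t': "t \<in> Arr C" "Dom C t = Dom C x" "Cod C t = Dom C c" "c \<cdot> t = x"
            using t by (simp_all add: slice_def hom_iff)
          obtain w where w: "FArr ?F (x, t, c) = (pb1 C f x, w, pb1 C f c)"
            "w \<in> Arr C" "Dom C w = Dom C (pb1 C f x)" "Cod C w = Dom C (pb1 C f c)"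
            "pb1 C f c \<cdot> w = pb1 C f x" "pb2 C f c \<cdot> w = t \<cdot> pb2 C f x"
            by (rule pullback_functor_arrow[OF f t])
          have giw: "g \<cdot> a \<cdot> i \<cdot> w = pb1 C f x"
            using comp_extend2[OF gi, of w] w i R g by simp
          have "?e \<cdot>\<^bsub>slice C (Dom C f)\<^esub> FArr ?F (x, t, c) = (pb1 C f x, (a \<cdot> i) \<cdot> w,
              g)" using w(1) by (simp add: slice_def)
          also have "(a \<cdot> i) \<cdot> w = a \<cdot> i \<cdot> w" using w i R by simp
          finally have 1: "?l \<longleftrightarrow> a \<cdot> i \<cdot> w = h" using t by (auto simp: h0' slice_def)
          have 2: "around_mor h (pb2 C f x) x a b c s t \<longleftrightarrow> s = i \<cdot> w \<and> a \<cdot> i \<cdot> w = h" for s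
          proof
            assume m: "around_mor h (pb2 C f x) x a b c s t"
            note S = around_morD[OF m]
            have "s = i \<cdot> w"
              by (rule pullback_eq[OF R(10)])
                (use S w t' giw h i g R Dx Dc in \<open>simp_all add: comp_extend1[OF S(7)] comp_extend1[OF i(5)]\<close>)
            then show "s = i \<cdot> w \<and> a \<cdot> i \<cdot> w = h" using S by simp
          next
            assume m: "s = i \<cdot> w \<and> a \<cdot> i \<cdot> w = h"
            then show "around_mor h (pb2 C f x) x a b c s t"
              by (intro around_morI)
               (use w t' i h R Dx Dc in \<open>simp_all add: comp_extend1[OF i(5)]\<close>)
          qed
          have "?l \<longleftrightarrow> ?r" using 1 2 by auto }
        moreover have "(x, t, c) \<in> Arr (slice C (Cod C f))" if "?l \<or> ?r"
          using that x R by (auto simp: slice_def around_mor_def)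
        ultimately show ?thesis by blast
      qed
      obtain s t where st: "around_mor h (pb2 C f x) x a b c s t" using distributive_lift[OF dis r] by blast
      show "\<exists>!t. t \<in> hom (slice C (Cod C f)) x c \<and> ?e \<cdot>\<^bsub>slice C (Dom C f)\<^esub> FArr ?F t = h0"
      proof (rule ex1I[of _ "(x, t, c)"])
        show "(x, t, c) \<in> hom (slice C (Cod C f)) x c \<and> ?e \<cdot>\<^bsub>slice C (Dom C f)\<^esub> FArr ?F (x, t, c) = h0"
          unfolding key using st by blast
        fix \<tau> assume T: "\<tau> \<in> hom (slice C (Cod C f)) x c \<and> ?e \<cdot>\<^bsub>slice C (Dom C f)\<^esub> FArr ?F \<tau> = h0"
        then have \<tau>: "\<tau> = (x, label \<tau>, c)" by (simp add: slice_def prod_eq_iff)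
        then obtain s' where "around_mor h (pb2 C f x) x a b c s' (label \<tau>)" using key[of
            "label \<tau>"] T by metis
        then show "\<tau> = (x, t, c)" using distributive_eq(2)[OF dis r st] \<tau> by metis
      qed
    qed
    then show ?thesis by blast
  qed
  then show ?thesis
    unfolding exponentiable_def
    using f right_adjoint_of_universal_arrows[OF slice_category slice_category pullback_functor_functor[OF f]]
    by blast
qed

lemma distributivity_pullback_terminal:
  assumes "exponentiable C f" "g \<in> Arr C" "Cod C g = Dom C f"
  shows "is_terminal (pullbacks_around C f g) (distributivity_pullback C f g)"
  unfolding distributivity_pullback_def terminal_def
  by (rule someI_ex) (use exponentiable_distributive[OF assms] terminal_pullback_around in blast)

end

section \<open>Stability of exponentiable arrows\<close>

context finitely_complete begin

text \<open>Write \<open>\<Pi>(h)\<close> for the base of the distributivity pullback around \<open>(f, h)\<close>, and let \<open>V'\<close> be the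
  codomain of \<open>f'\<close>. An arrow \<open>Y \<rightarrow> V'\<close> together with a map over the domain of \<open>f'\<close> from the pullback
  of \<open>f'\<close> along it to \<open>g\<close> amounts to an arrow \<open>Y \<rightarrow> \<Pi>(u g)\<close> whose image in \<open>\<Pi>(u)\<close> comes from the
  canonical arrow \<open>V' \<rightarrow> \<Pi>(u)\<close>. The distributivity pullback for \<open>f'\<close> is therefore the pullback of
  \<open>\<Pi>(u g)\<close> and \<open>V'\<close> over \<open>\<Pi>(u)\<close>.\<close>

lemma exponentiable_pullback:
  assumes ex: "exponentiable C f" and pf: "is_pullback C f v u f'"
  shows "exponentiable C f'"
proof (rule distributive_exponentiable)
  note P = pullbackD(1-4,6-9)[OF pf] pullbackD(5)[OF pf, symmetric]
  show "f' \<in> Arr C" using P by simp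
  fix g assume g: "g \<in> Arr C" "Cod C g = Dom C f'"
  have ug: "u \<cdot> g \<in> Arr C" "Cod C (u \<cdot> g) = Dom C f" using g P by simp_all
  have u: "u \<in> Arr C" "Cod C u = Dom C f" using P by simp_all
  obtain a0 b0 c0 where d0: "distributive f (u \<cdot> g) a0 b0 c0"
    using exponentiable_distributive[OF ex ug] by blast
  obtain a1 b1 c1 where d1: "distributive f u a1 b1 c1"
    using exponentiable_distributive[OF ex u] by blast
  note A0 = distributive_around[OF d0] and A1 = distributive_around[OF d1]
  note R0' = aroundD[OF A0 ug] and R1 = aroundD[OF A1 u]
  have a0: "Cod C a0 = Dom C g" using R0' g P by simp
  have ga0: "(u \<cdot> g) \<cdot> a0 = u \<cdot> g \<cdot> a0" using R0' g P a0 by simp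
  have cb0: "c0 \<cdot> b0 = f \<cdot> u \<cdot> g \<cdot> a0" using R0' by (simp add: ga0)
  have A0': "around f u (g \<cdot> a0) b0 c0" unfolding around_def
    using R0' g a0 P by (simp add: ga0)
  note R0 = R0'(1-5) a0 R0'(7,8) cb0
  \<comment> \<open>Here \<open>t\<close> is the arrow \<open>\<Pi>(u g) \<rightarrow> \<Pi>(u)\<close> given by functoriality in \<open>g : u g \<rightarrow> u\<close>.\<close>
  obtain s t where S: "around_mor (g \<cdot> a0) b0 c0 a1 b1 c1 s t" using distributive_lift[OF d1 A0'] .
  have Ai: "around f u (Idn C (Dom C u)) f' v" unfolding around_def using P pf by simp
  \<comment> \<open>Here \<open>\<tau>\<close> is the canonical arrow \<open>V' \<rightarrow> \<Pi>(u)\<close>, with \<open>V'\<close> the codomain of \<open>f'\<close>.\<close>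
  obtain \<sigma> \<tau> where T: "around_mor (Idn C (Dom C u)) f' v a1 b1 c1 \<sigma> \<tau>" using distributive_lift[OF d1 Ai] .
  have s: "s \<in> Arr C" "t \<in> Arr C" "Dom C s = Dom C a0" "Cod C s = Dom C a1" "Dom C t = Dom C c0"
    "Cod C t = Dom C c1" "a1 \<cdot> s = g \<cdot> a0" "b1 \<cdot> s = t \<cdot> b0" "c1 \<cdot> t = c0"
    using around_morD[OF S] R0 g by simp_all
  have \<sigma>: "\<sigma> \<in> Arr C" "\<tau> \<in> Arr C" "Dom C \<sigma> = Dom C f'" "Cod C \<sigma> = Dom C a1" "Dom C \<tau> = Cod C f'"
    "Cod C \<tau> = Dom C c1" "a1 \<cdot> \<sigma> = Idn C (Dom C f')" "b1 \<cdot> \<sigma> = \<tau> \<cdot> f'" "c1 \<cdot> \<tau> = v"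
    using around_morD[OF T] P by simp_all
  obtain y0 y1 where py: "is_pullback C t \<tau> y0 y1" using pullback_exists[of t \<tau>] s \<sigma> by auto
  note Y = pullbackD(3,4,6-9)[OF py]
  obtain x0 b where px: "is_pullback C b0 y0 x0 b" using pullback_exists[of b0 y0] R0 Y s by auto
  note X = pullbackD(3,4,7-9)[OF px] pullbackD(6)[OF px, symmetric]
  have cy: "c0 \<cdot> y0 = v \<cdot> y1"
  proof -
    have "c0 \<cdot> y0 = c1 \<cdot> t \<cdot> y0" using comp_extend1[OF s(9), of y0] s R1 Y by simp
    also have "\<dots> = v \<cdot> y1" using comp_extend1[OF \<sigma>(9), of y1] \<sigma> R1 Y by simp
    finally show ?thesis .
  qed
  have Q: "is_pullback C f (v \<cdot> y1) (u \<cdot> (g \<cdot> a0 \<cdot> x0)) b"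
  proof -
    have "is_pullback C f c0 (u \<cdot> g \<cdot> a0) b0" using A0' g P R0 by (simp add: around_def)
    from pullback_paste[OF this px] show ?thesis using cy g P R0 X s Y by simp
  qed
  have fgb: "f' \<cdot> (g \<cdot> a0 \<cdot> x0) = y1 \<cdot> b"
  proof -
    \<comment> \<open>The arrow with the required image under \<open>f'\<close>; it equals \<open>g a0 x0\<close> because both lift to the
        pullback of \<open>f\<close> along \<open>\<Pi>(u) \<rightarrow> V\<close> and agree there.\<close>
    obtain w where w: "w \<in> Arr C" "Dom C w = Dom C x0" "Cod C w = Dom C u"
      "u \<cdot> w = u \<cdot> g \<cdot> a0 \<cdot> x0" "f' \<cdot> w = y1 \<cdot> b"
      by (rule pullback_lift[OF pf, of "u \<cdot> g \<cdot> a0 \<cdot> x0" "y1 \<cdot> b"])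
        (use pullbackD(9)[OF Q] P g R0 X Y s \<sigma> in simp_all)
    have "s \<cdot> x0 = \<sigma> \<cdot> w"
    proof (rule pullback_eq[OF R1(10)])
      show "(u \<cdot> a1) \<cdot> s \<cdot> x0 = (u \<cdot> a1) \<cdot> \<sigma> \<cdot> w"
        using w P g R0 R1 X Y s \<sigma> by (simp add: comp_extend[OF s(7)] comp_extend1[OF \<sigma>(7)])
      show "b1 \<cdot> s \<cdot> x0 = b1 \<cdot> \<sigma> \<cdot> w"
        using w P g R0 R1 X Y s \<sigma>
        by (simp add: comp_extend[OF s(8)] comp_extend[OF \<sigma>(8)] comp_extend[OF Y(6)])
    qed (use w P g R0 R1 X Y s \<sigma> in simp_all)
    then have "a1 \<cdot> s \<cdot> x0 = a1 \<cdot> \<sigma> \<cdot> w" by simp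
    then have "g \<cdot> a0 \<cdot> x0 = w"
      using w P g R0 R1 X Y s \<sigma> by (simp add: comp_extend[OF s(7)] comp_extend1[OF \<sigma>(7)])
    then show ?thesis using w by simp
  qed
  have ar: "around f' g (a0 \<cdot> x0) b y1"
    unfolding around_def
  proof (intro conjI)
    show "is_pullback C f' y1 (g \<cdot> a0 \<cdot> x0) b"
      by (rule pullback_cancel[OF pf Q]) (use P g R0 X Y s \<sigma> fgb in simp_all)
  qed (use P g R0 X Y s \<sigma> in simp_all)
  have "distributive f' g (a0 \<cdot> x0) b y1"
  proof (rule distributiveI[OF ar])
    fix a' b' c' assume A': "around f' g a' b' c'"
    note R' = aroundD[OF A' g]
    have A2: "around f (u \<cdot> g) a' b' (v \<cdot> c')"
      unfolding around_def using pullback_paste[OF pf R'(10)] R' P g by simp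
    obtain s2 t2 where S2: "around_mor a' b' (v \<cdot> c') a0 b0 c0 s2 t2" using distributive_lift[OF d0 A2] .
    have s2: "s2 \<in> Arr C" "t2 \<in> Arr C" "Dom C s2 = Dom C a'" "Cod C s2 = Dom C a0" "Dom C t2 = Dom C c'"
      "Cod C t2 = Dom C c0" "a0 \<cdot> s2 = a'" "b0 \<cdot> s2 = t2 \<cdot> b'" "c0 \<cdot> t2 = v \<cdot> c'"
      using around_morD[OF S2] R' P by simp_all
    have A3: "around f u (g \<cdot> a') b' (v \<cdot> c')"
      unfolding around_def using pullback_paste[OF pf R'(10)] R' P g by simp
    have "around_mor (g \<cdot> a') b' (v \<cdot> c') a1 b1 c1 (s \<cdot> s2) (t \<cdot> t2)"
      by (rule around_morI)
        (use s s2 g R' R0 R1 P in \<open>simp_all add: comp_extend[OF s(7)] comp_extend[OF s(8)]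
            comp_extend1[OF s(9)]\<close>)
    moreover have "around_mor (g \<cdot> a') b' (v \<cdot> c') a1 b1 c1 (\<sigma> \<cdot> g \<cdot> a') (\<tau> \<cdot> c')"
      by (rule around_morI)
        (use \<sigma> g R' R1 P in \<open>simp_all add: comp_extend1[OF \<sigma>(7)] comp_extend[OF \<sigma>(8)] comp_extend1[OF \<sigma>(9)]\<close>)
    ultimately have tt: "t \<cdot> t2 = \<tau> \<cdot> c'" using distributive_eq(2)[OF d1 A3] by blast
    obtain t3 where t3: "t3 \<in> Arr C" "Dom C t3 = Dom C t2" "Cod C t3 = Dom C y0" "y0 \<cdot> t3 = t2" "y1 \<cdot> t3 = c'"
      by (rule pullback_lift[OF py, of t2 c']) (use tt s2 s \<sigma> R' P in simp_all)
    obtain s3 where s3: "s3 \<in> Arr C" "Dom C s3 = Dom C s2" "Cod C s3 = Dom C x0" "x0 \<cdot> s3 = s2"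
        "b \<cdot> s3 = t3 \<cdot> b'"
      by (rule pullback_lift[OF px, of s2 "t3 \<cdot> b'"]) (use t3 s2 R' P R0 Y in
          \<open>simp_all add: comp_extend1[OF t3(4)]\<close>)
    have "around_mor a' b' c' (a0 \<cdot> x0) b y1 s3 t3"
      by (rule around_morI) (use s3 t3 s2 R0 X Y in simp_all)
    then show "\<exists>s t. around_mor a' b' c' (a0 \<cdot> x0) b y1 s t" by blast
    have uni: "y0 \<cdot> t4 = t2 \<and> x0 \<cdot> s4 = s2" if "around_mor a' b' c' (a0 \<cdot> x0) b y1 s4 t4" for s4 t4
    proof -
      note m = around_morD[OF that]
      have m4: "Cod C s4 = Dom C x0" "a0 \<cdot> x0 \<cdot> s4 = a'" "Cod C t4 = Dom C y0" using m X R0 Y by simp_all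
      have "around_mor a' b' (v \<cdot> c') a0 b0 c0 (x0 \<cdot> s4) (y0 \<cdot> t4)"
      proof (rule around_morI)
        show "c0 \<cdot> y0 \<cdot> t4 = v \<cdot> c'"
          using m m4 R0 Y \<sigma> P s by (simp add: comp_extend[OF cy])
        show "b0 \<cdot> x0 \<cdot> s4 = (y0 \<cdot> t4) \<cdot> b'"
          using m m4 R0 Y R' X \<sigma> P s by (simp add: comp_extend[OF X(5)])
      qed (use m m4 R0 Y X R' P s in simp_all)
      from distributive_eq[OF d0 A2 this S2] show ?thesis by simp
    qed
    fix s4 t4 s5 t5 assume m4: "around_mor a' b' c' (a0 \<cdot> x0) b y1 s4 t4" and m5:
        "around_mor a' b' c' (a0 \<cdot> x0) b y1 s5 t5"
    note M4 = around_morD[OF m4] and M5 = around_morD[OF m5]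
    have "t4 = t5"
      by (rule pullback_eq[OF py]) (use M4 M5 uni[OF m4] uni[OF m5] Y in simp_all)
    moreover have "s4 = s5"
      by (rule pullback_eq[OF px]) (use M4 M5 uni[OF m4] uni[OF m5] X R0 Y \<open>t4 = t5\<close> in simp_all)
    ultimately show "s4 = s5 \<and> t4 = t5" by simp
  qed
  then show "\<exists>a b c. distributive f' g a b c" by blast
qed

text \<open>The right adjoint for \<open>k f\<close> is the composite of the right adjoints for \<open>f\<close> and \<open>k\<close>: a
  distributivity pullback around \<open>(f, g)\<close> with base arrow \<open>c\<close> is followed by one around \<open>(k, c)\<close>,
  and the two are pasted along a pullback.\<close>

lemma exponentiable_comp:
  assumes ef: "exponentiable C f" and ek: "exponentiable C k" and kf: "Cod C f = Dom C k"
  shows "exponentiable C (k \<cdot> f)"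
proof (rule distributive_exponentiable)
  have f: "f \<in> Arr C" and k: "k \<in> Arr C" using ef ek by (auto simp: exponentiable_def)
  note kf' = kf[symmetric]
  show "k \<cdot> f \<in> Arr C" using f k kf by simp
  fix g assume g0: "g \<in> Arr C" "Cod C g = Dom C (k \<cdot> f)"
  then have g: "g \<in> Arr C" "Cod C g = Dom C f" using f k kf by simp_all
  obtain a b c where d0: "distributive f g a b c" using exponentiable_distributive[OF ef g] by blast
  note R = aroundD[OF distributive_around[OF d0] g]
  have c: "c \<in> Arr C" "Cod C c = Dom C k" using R kf by simp_all
  obtain a1 b1 c1 where d1: "distributive k c a1 b1 c1" using exponentiable_distributive[OF ek c] by blast
  note R1 = aroundD[OF distributive_around[OF d1] c]
  obtain x x1 where px: "is_pullback C b a1 x x1" using pullback_exists[of b a1] R R1 by auto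
  note X = pullbackD(3,4,7-9)[OF px] pullbackD(6)[OF px, symmetric]
  have ar: "around (k \<cdot> f) g (a \<cdot> x) (b1 \<cdot> x1) c1"
    unfolding around_def
  proof (intro conjI)
    have "is_pullback C f (c \<cdot> a1) ((g \<cdot> a) \<cdot> x) x1" by (rule pullback_paste[OF R(10) px])
    from pullback_paste_vertical[OF this R1(10)]
    show "is_pullback C (k \<cdot> f) c1 (g \<cdot> a \<cdot> x) (b1 \<cdot> x1)" using g R X by simp
  qed (use R X in simp_all)
  have "distributive (k \<cdot> f) g (a \<cdot> x) (b1 \<cdot> x1) c1"
  proof (rule distributiveI[OF ar])
    fix p q r assume A: "around (k \<cdot> f) g p q r"
    note S0 = aroundD[OF A g0]
    have S: "p \<in> Arr C" "q \<in> Arr C" "r \<in> Arr C" "Cod C r = Cod C k" "Cod C p = Dom C g"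
    "Dom C q = Dom C p" "Cod C q = Dom C r" "r \<cdot> q = k \<cdot> f \<cdot> g \<cdot> p"
      using S0 f k kf g by simp_all
    \<comment> \<open>The pullback of \<open>k f\<close> along \<open>r\<close> is split into pullbacks of \<open>k\<close> and of \<open>f\<close>.\<close>
    obtain r1 r2 where pr: "is_pullback C k r r1 r2" using pullback_exists[of k r] S k by auto
    note RR = pullbackD(3,4,6-9)[OF pr]
    obtain n where n: "n \<in> Arr C" "Dom C n = Dom C (f \<cdot> g \<cdot> p)" "Cod C n = Dom C r1"
       "r1 \<cdot> n = f \<cdot> g \<cdot> p" "r2 \<cdot> n = q"
      by (rule pullback_lift[OF pr, of "f \<cdot> g \<cdot> p" q]) (use S f g k kf in simp_all)
    have n': "Dom C n = Dom C p" using n S f g by simp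
    have "is_pullback C r1 f n (g \<cdot> p)"
    proof (rule pullback_cancel[OF pullback_sym[OF pr]])
      show "is_pullback C r (k \<cdot> f) (r2 \<cdot> n) (g \<cdot> p)" using pullback_sym[OF S0(10)] n by simp
    qed (use n S f g k kf RR in simp_all)
    then have A1: "around f g p n r1" unfolding around_def using S pullback_sym by simp
    obtain s1 t1 where M1: "around_mor p n r1 a b c s1 t1" using distributive_lift[OF d0 A1] .
    note m1 = around_morD[OF M1]
    have A2: "around k c t1 r2 r" unfolding around_def using m1 pr by simp
    obtain s2 t2 where M2: "around_mor t1 r2 r a1 b1 c1 s2 t2" using distributive_lift[OF d1 A2] .
    note m2 = around_morD[OF M2]
    obtain s3 where s3: "s3 \<in> Arr C" "Dom C s3 = Dom C s1" "Cod C s3 = Dom C x" "x \<cdot> s3 = s1" "x1 \<cdot> s3 =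
        s2 \<cdot> n"
      by (rule pullback_lift[OF px, of s1 "s2 \<cdot> n"])
        (use m1 m2 n n' R R1 RR in \<open>simp_all add: comp_extend1[OF m2(7)]\<close>)
    have "around_mor p q r (a \<cdot> x) (b1 \<cdot> x1) c1 s3 t2"
      by (rule around_morI) (use s3 m1 m2 n n' R R1 X RR S in \<open>simp_all add: comp_extend[OF m2(8)]\<close>)
    then show "\<exists>s t. around_mor p q r (a \<cdot> x) (b1 \<cdot> x1) c1 s t" by blast
    have uni: "x \<cdot> s = s1 \<and> x1 \<cdot> s = s2 \<cdot> n \<and> t = t2" if M:
        "around_mor p q r (a \<cdot> x) (b1 \<cdot> x1) c1 s t" for s t
    proof -
      note m0 = around_morD[OF M]
      have m: "s \<in> Arr C" "t \<in> Arr C" "Dom C s = Dom C p" "Cod C s = Dom C x" "Dom C t = Dom C r"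
         "Cod C t = Dom C c1" "a \<cdot> x \<cdot> s = p" "b1 \<cdot> x1 \<cdot> s = t \<cdot> q" "c1 \<cdot> t = r"
        using m0 R R1 X by simp_all
      obtain w where w: "w \<in> Arr C" "Dom C w = Dom C r1" "Cod C w = Dom C (c \<cdot> a1)" "(c \<cdot> a1) \<cdot> w = r1"
          "b1 \<cdot> w = t \<cdot> r2"
        by (rule pullback_lift[OF R1(10), of r1 "t \<cdot> r2"])
          (use m RR R1 S in \<open>simp_all add: comp_extend1[OF m(9)]\<close>)
      have w': "Cod C w = Dom C a1" "c \<cdot> a1 \<cdot> w = r1" using w R1 R by simp_all
      have wn: "w \<cdot> n = x1 \<cdot> s"
      proof (rule pullback_eq[OF R1(10)])
        have "(c \<cdot> a1) \<cdot> w \<cdot> n = f \<cdot> g \<cdot> p"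
          using w w' n n' RR R1 S c by (simp add: comp_extend2[OF w'(2)])
        moreover have "(c \<cdot> a1) \<cdot> x1 \<cdot> s = c \<cdot> b \<cdot> x \<cdot> s"
          using R R1 X m by (simp add: comp_extend[OF X(5)[symmetric]])
        moreover have "\<dots> = f \<cdot> g \<cdot> p"
          using R R1 X m g f by (simp add: comp_extend[OF R(9)])
        ultimately show "(c \<cdot> a1) \<cdot> w \<cdot> n = (c \<cdot> a1) \<cdot> x1 \<cdot> s" by simp
        show "b1 \<cdot> w \<cdot> n = b1 \<cdot> x1 \<cdot> s"
          using w w' n n' RR R1 S m by (simp add: comp_extend[OF w(5)])
      qed (use w w' n n' RR R1 X m in simp_all)
      have 1: "around_mor p n r1 a b c (x \<cdot> s) (a1 \<cdot> w)"
        by (rule around_morI) (use w w' n n' RR R R1 X m wn in \<open>simp_all add: comp_extend[OF X(5)]\<close>)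
      note e1 = distributive_eq[OF d0 A1 1 M1]
      have 2: "around_mor t1 r2 r a1 b1 c1 w t"
        by (rule around_morI) (use w w' m m1 RR e1 in simp_all)
      note e2 = distributive_eq[OF d1 A2 2 M2]
      show ?thesis using e1 e2 wn by simp
    qed
    fix s t s' t' assume m4: "around_mor p q r (a \<cdot> x) (b1 \<cdot> x1) c1 s t" and m5:
        "around_mor p q r (a \<cdot> x) (b1 \<cdot> x1) c1 s' t'"
    note M4 = around_morD[OF m4] and M5 = around_morD[OF m5]
    have "s = s'"
      by (rule pullback_eq[OF px]) (use M4 M5 uni[OF m4] uni[OF m5] X R in simp_all)
    then show "s = s' \<and> t = t'" using uni[OF m4] uni[OF m5] by simp
  qed
  then show "\<exists>a b c. distributive (k \<cdot> f) g a b c" by blast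
qed

end

section \<open>Composite polynomials classify composable pairs\<close>

context finitely_complete begin

abbreviation "PC \<equiv> arr_PC C"
abbreviation "PA \<equiv> arr_PA C"
abbreviation "FP \<equiv> arr_FP C"
abbreviation "FG \<equiv> arr_FG C"
abbreviation "GC \<equiv> arr_GC C"
abbreviation "FC \<equiv> arr_FC C"
abbreviation "FA \<equiv> arr_FA C"
abbreviation "HA \<equiv> arr_HA C"
abbreviation "HF \<equiv> arr_HF C"

lemma dist_induced_mor:
  assumes ef: "exponentiable C f" and g: "g \<in> Arr C" "Cod C g = Dom C f"
    and D: "distributivity_pullback C f g = (a, b, c)" and r: "around f g a' b' c'"
    and st: "dist_induced C f g (a', b', c') = (s, t)"
  shows "around_mor a' b' c' a b c s t"
proof -
  let ?K = "pullbacks_around C f g"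
  have T: "is_terminal ?K (a, b, c)" using distributivity_pullback_terminal[OF ef g] D by simp
  moreover have o: "(a', b', c') \<in> Obj ?K" using r by (simp add: pullbacks_around_def around_def)
  ultimately have "\<exists>!h. h \<in> hom ?K (a', b', c') (a, b, c)" unfolding is_terminal_def by blast
  from theI'[OF this] have "to_terminal ?K (a', b', c') \<in> hom ?K (a', b', c') (a, b, c)"
    using D by (simp add: to_terminal_def distributivity_pullback_def)
  then show ?thesis using st
    by (simp add: dist_induced_def pullbacks_around_def around_mor_def split_beta)
qed

lemma polynomialsD:
  assumes "p \<in> polynomials C X Y"
  shows "exponentiable C (pmid p)" "pmid p \<in> Arr C" "pleft p \<in> Arr C" "pright p \<in> Arr C"
    "Dom C (pleft p) = Dom C (pmid p)" "Cod C (pleft p) = X" "Dom C (pright p) = Cod C (pmid p)"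
    "Cod C (pright p) = Y"
  using assms by (simp_all add: polynomials_def hom_iff exponentiable_def)

lemma poly_comp_pullbacks:
  assumes p: "p \<in> polynomials C X Y" and q: "q \<in> polynomials C Y Z"
  shows "is_pullback C (pright p) (pleft q) (PC q p) (PA q p)"
    and "distributive (pmid q) (PA q p) (FP q p) (FG q p) (GC q p)"
    and "is_pullback C (pmid q) (GC q p) (FA q p) (FG q p)"
    and "is_pullback C (pmid p) (FC q p) (HA q p) (HF q p)"
proof -
  note P = polynomialsD[OF p] and Q = polynomialsD[OF q]
  show pb: "is_pullback C (pright p) (pleft q) (PC q p) (PA q p)"
    unfolding arr_PC_def arr_PA_def by (rule pb_pullback) (use P Q in simp_all)
  note B = pullbackD[OF pb]
  have PA: "PA q p \<in> Arr C" "Cod C (PA q p) = Dom C (pmid q)" using B Q by simp_all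
  show d: "distributive (pmid q) (PA q p) (FP q p) (FG q p) (GC q p)"
    using distributivity_pullback_terminal[OF Q(1) PA]
    by (simp add: terminal_pullback_around[symmetric] arr_FP_def arr_FG_def arr_GC_def)
  note R = aroundD[OF distributive_around[OF d] PA]
  show "is_pullback C (pmid q) (GC q p) (FA q p) (FG q p)"
    using R(10) by (simp add: arr_FA_def)
  show "is_pullback C (pmid p) (FC q p) (HA q p) (HF q p)"
    unfolding arr_HA_def arr_HF_def by (rule pb_pullback) (use P Q R B in \<open>simp_all add: arr_FC_def\<close>)
qed

lemma poly_comp_arrows:
  assumes p: "p \<in> polynomials C X Y" and q: "q \<in> polynomials C Y Z"
  shows "PC q p \<in> Arr C" "PA q p \<in> Arr C" "FP q p \<in> Arr C" "FG q p \<in> Arr C"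
    "GC q p \<in> Arr C" "FC q p \<in> Arr C" "FA q p \<in> Arr C" "HA q p \<in> Arr C"
    "HF q p \<in> Arr C"
    "Dom C (PA q p) = Dom C (PC q p)"
    "Cod C (PC q p) = Cod C (pmid p)" "Cod C (PA q p) = Dom C (pmid q)"
    "Cod C (FP q p) = Dom C (PC q p)" "Dom C (FP q p) = Dom C (FG q p)"
    "Cod C (FG q p) = Dom C (GC q p)" "Cod C (GC q p) = Cod C (pmid q)"
    "Dom C (FC q p) = Dom C (FG q p)" "Cod C (FC q p) = Cod C (pmid p)"
    "Dom C (FA q p) = Dom C (FG q p)" "Cod C (FA q p) = Dom C (pmid q)"
    "Dom C (HA q p) = Dom C (HF q p)" "Cod C (HA q p) = Dom C (pmid p)"
    "Cod C (HF q p) = Dom C (FG q p)"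
    "PC q p \<cdot> FP q p = FC q p" "PA q p \<cdot> FP q p = FA q p"
    "pmid p \<cdot> HA q p = FC q p \<cdot> HF q p"
    "pmid q \<cdot> FA q p = GC q p \<cdot> FG q p"
    "pright p \<cdot> PC q p = pleft q \<cdot> PA q p"
    "pright p \<cdot> FC q p = pleft q \<cdot> FA q p"
proof -
  note pbs = poly_comp_pullbacks[OF p q]
  note P = polynomialsD[OF p] and Q = polynomialsD[OF q]
  note B = pullbackD[OF pbs(1)]
  have PA: "PA q p \<in> Arr C" "Cod C (PA q p) = Dom C (pmid q)" using B Q by simp_all
  note R = aroundD[OF distributive_around[OF pbs(2)] PA]
  have FA: "PA q p \<cdot> FP q p = FA q p" and FC: "PC q p \<cdot> FP q p = FC q p"
    by (simp_all add: arr_FA_def arr_FC_def)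
  show a1: "PC q p \<in> Arr C" "PA q p \<in> Arr C" "FP q p \<in> Arr C" "FG q p \<in> Arr C"
    "GC q p \<in> Arr C"
    "Dom C (PA q p) = Dom C (PC q p)"
    "Cod C (PC q p) = Cod C (pmid p)" "Cod C (PA q p) = Dom C (pmid q)"
    "Cod C (FP q p) = Dom C (PC q p)" "Dom C (FP q p) = Dom C (FG q p)"
    "Cod C (FG q p) = Dom C (GC q p)" "Cod C (GC q p) = Cod C (pmid q)"
    using B P Q R by simp_all
  then show a2: "Dom C (FC q p) = Dom C (FG q p)" "Cod C (FC q p) = Cod C (pmid p)"
    "Dom C (FA q p) = Dom C (FG q p)" "Cod C (FA q p) = Dom C (pmid q)"
    "FC q p \<in> Arr C" "FA q p \<in> Arr C"
    by (simp_all add: arr_FA_def arr_FC_def)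
  note Hp = pullbackD[OF pbs(4)]
  show "HA q p \<in> Arr C" "HF q p \<in> Arr C" "Dom C (HA q p) = Dom C (HF q p)" "Cod C (HA q p) = Dom C (pmid p)"
    "Cod C (HF q p) = Dom C (FG q p)"
    using Hp a2 by simp_all
  show "PC q p \<cdot> FP q p = FC q p" "PA q p \<cdot> FP q p = FA q p"
    by (fact FC, fact FA)
  show "pmid p \<cdot> HA q p = FC q p \<cdot> HF q p" by (fact Hp(9))
  show "pmid q \<cdot> FA q p = GC q p \<cdot> FG q p" by (rule pullbackD(9)[OF pbs(3)])
  show b: "pright p \<cdot> PC q p = pleft q \<cdot> PA q p" by (fact B(9))
  show "pright p \<cdot> FC q p = pleft q \<cdot> FA q p"
    using a1 P Q B by (simp add: FA[symmetric] FC[symmetric] comp_extend[OF b])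
qed

lemma poly_comp_polynomial:
  assumes p: "p \<in> polynomials C X Y" and q: "q \<in> polynomials C Y Z"
  shows "poly_comp C q p \<in> polynomials C X Z"
proof -
  note A = poly_comp_arrows[OF p q] and pbs = poly_comp_pullbacks[OF p q]
  note P = polynomialsD[OF p] and Q = polynomialsD[OF q]
  have "exponentiable C (FG q p \<cdot> HF q p)"
    by (rule exponentiable_comp[OF exponentiable_pullback[OF P(1) pbs(4)] exponentiable_pullback[OF Q(1)
        pbs(3)]])
      (use A in simp)
  then show ?thesis using A P Q by (simp add: polynomials_def poly_comp_def hom_iff)
qed

text \<open>Polynomials \<open>p\<close> and \<open>q\<close> are used here as classifiers of pairs \<open>X \<rightarrow> Y \<rightarrow> Z\<close>: the first arrow \<open>f\<close>
  is a pullback of the middle arrow of \<open>p\<close>, the second arrow \<open>g\<close> is a pullback of the middle arrow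
  of \<open>q\<close>, and the legs meeting at \<open>Y\<close> agree.\<close>

definition fib_pair :: "'m polynomial \<Rightarrow> 'm polynomial \<Rightarrow> 'm \<Rightarrow> 'm \<Rightarrow> 'm \<Rightarrow> 'm \<Rightarrow> 'm \<Rightarrow> 'm \<Rightarrow> bool" where
  "fib_pair q p f u v g u' v' \<longleftrightarrow> is_pullback C (pmid p) v u f \<and> is_pullback C (pmid q) v' u' g \<and>
     Cod C f = Dom C g \<and> pright p \<cdot> v = pleft q \<cdot> u'"

text \<open>A morphism of pairs, with components \<open>a\<close>, \<open>b\<close>, \<open>c\<close>, from \<open>(f, g)\<close> to the factors \<open>H \<rightarrow> F\<close> and
  \<open>F \<rightarrow> G\<close> of the middle arrow of \<open>q \<circ> p\<close>, compatible with the two pullback structures.\<close>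

definition classifies :: "'m polynomial \<Rightarrow> 'm polynomial \<Rightarrow> 'm \<Rightarrow> 'm \<Rightarrow> 'm \<Rightarrow> 'm \<Rightarrow> 'm \<Rightarrow> 'm \<Rightarrow>
    'm \<Rightarrow> 'm \<Rightarrow> 'm \<Rightarrow> bool" where
  "classifies q p f u v g u' v' a b c \<longleftrightarrow>
     a \<in> hom C (Dom C f) (Dom C (HF q p)) \<and> b \<in> hom C (Dom C g) (Dom C (FG q p)) \<and>
     c \<in> hom C (Cod C g) (Dom C (GC q p)) \<and>
     HA q p \<cdot> a = u \<and> HF q p \<cdot> a = b \<cdot> f \<and> FC q p \<cdot> b = v \<and>
     FA q p \<cdot> b = u' \<and> FG q p \<cdot> b = c \<cdot> g \<and> GC q p \<cdot> c = v'"

lemma classifiesD: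
  assumes "classifies q p f u v g u' v' a b c"
  shows "a \<in> Arr C" "b \<in> Arr C" "c \<in> Arr C" "Dom C a = Dom C f" "Cod C a = Dom C (HF q p)"
    "Dom C b = Dom C g" "Cod C b = Dom C (FG q p)" "Dom C c = Cod C g" "Cod C c = Dom C (GC q p)"
    "HA q p \<cdot> a = u" "HF q p \<cdot> a = b \<cdot> f" "FC q p \<cdot> b = v"
    "FA q p \<cdot> b = u'" "FG q p \<cdot> b = c \<cdot> g" "GC q p \<cdot> c = v'"
  using assms by (simp_all add: classifies_def hom_iff)

lemma classifiesI:
  assumes "a \<in> Arr C" "b \<in> Arr C" "c \<in> Arr C" "Dom C a = Dom C f" "Cod C a = Dom C (HF q p)"
    "Dom C b = Dom C g" "Cod C b = Dom C (FG q p)" "Dom C c = Cod C g" "Cod C c = Dom C (GC q p)"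
    "HA q p \<cdot> a = u" "HF q p \<cdot> a = b \<cdot> f" "FC q p \<cdot> b = v"
    "FA q p \<cdot> b = u'" "FG q p \<cdot> b = c \<cdot> g" "GC q p \<cdot> c = v'"
  shows "classifies q p f u v g u' v' a b c"
  using assms by (simp add: classifies_def hom_iff)

lemma fib_pairD:
  assumes "fib_pair q p f u v g u' v'"
  shows "is_pullback C (pmid p) v u f" "is_pullback C (pmid q) v' u' g" "Cod C f = Dom C g"
    "pright p \<cdot> v = pleft q \<cdot> u'"
    "f \<in> Arr C" "u \<in> Arr C" "v \<in> Arr C" "g \<in> Arr C" "u' \<in> Arr C" "v' \<in> Arr C"
    "Dom C u = Dom C f" "Dom C v = Dom C g" "Dom C u' = Dom C g" "Dom C v' = Cod C g"
    "Cod C u = Dom C (pmid p)" "Cod C v = Cod C (pmid p)" "Cod C u' = Dom C (pmid q)" "Cod C v' =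
        Cod C (pmid q)"
    "pmid p \<cdot> u = v \<cdot> f" "pmid q \<cdot> u' = v' \<cdot> g"
proof -
  show 1: "is_pullback C (pmid p) v u f" "is_pullback C (pmid q) v' u' g" "Cod C f = Dom C g"
      "pright p \<cdot> v = pleft q \<cdot> u'"
    using assms by (simp_all add: fib_pair_def)
  note F = pullbackD[OF 1(1)] and G = pullbackD[OF 1(2)]
  show "f \<in> Arr C" "u \<in> Arr C" "v \<in> Arr C" "g \<in> Arr C" "u' \<in> Arr C" "v' \<in> Arr C" by (fact F G)+
  show "Dom C u = Dom C f" "Dom C v = Dom C g" "Dom C u' = Dom C g" "Dom C v' = Cod C g"
    "Cod C u = Dom C (pmid p)" "Cod C v = Cod C (pmid p)" "Cod C u' = Dom C (pmid q)" "Cod C v' =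
        Cod C (pmid q)"
    using F(5-8) G(5-8) 1(3) by (metis)+
  show "pmid p \<cdot> u = v \<cdot> f" "pmid q \<cdot> u' = v' \<cdot> g" by (fact F G)+
qed

text \<open>The three stages of the composite are used in turn: \<open>v\<close> and \<open>u'\<close> give an arrow \<open>k\<close> into the
  pullback \<open>P\<close>, this and \<open>g\<close> form a pullback around the middle arrow of \<open>q\<close> and so give \<open>b\<close> and \<open>c\<close>,
  and finally \<open>u\<close> and \<open>b f\<close> give \<open>a\<close> by the pullback property of \<open>H\<close>.\<close>

lemma classifies_universal:
  assumes p: "p \<in> polynomials C X Y" and q: "q \<in> polynomials C Y Z"
    and fp: "fib_pair q p f u v g u' v'"
  shows "\<exists>a b c. classifies q p f u v g u' v' a b c"
proof -
  note A = poly_comp_arrows[OF p q] and pbs = poly_comp_pullbacks[OF p q]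
  note P = polynomialsD[OF p] and Q = polynomialsD[OF q] and F = fib_pairD[OF fp]
  obtain k where k: "k \<in> Arr C" "Dom C k = Dom C v" "Cod C k = Dom C (PC q p)"
     "PC q p \<cdot> k = v" "PA q p \<cdot> k = u'"
    by (rule pullback_lift[OF pbs(1), of v u']) (use F P Q in simp_all)
  have "around (pmid q) (PA q p) k g v'"
    unfolding around_def using k F(2) A by simp
  then obtain b c where m: "around_mor k g v' (FP q p) (FG q p) (GC q p) b c"
    using distributive_lift[OF pbs(2)] by blast
  note M = around_morD[OF m]
  have fc: "FC q p \<cdot> b = v" "FA q p \<cdot> b = u'"
    using comp_extend1[OF A(24), of b] comp_extend1[OF A(25), of b] A M k by simp_all
  obtain a where "a \<in> Arr C" "Dom C a = Dom C u" "Cod C a = Dom C (HA q p)" "HA q p \<cdot> a = u"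
    "HF q p \<cdot> a = b \<cdot> f"
    by (rule pullback_lift[OF pbs(4), of u "b \<cdot> f"]) (use M k A F fc in
        \<open>simp_all add: comp_extend1[OF fc(1)]\<close>)
  then have "classifies q p f u v g u' v' a b c"
    by (intro classifiesI) (use M k A F fc in simp_all)
  then show ?thesis by blast
qed

lemma classifies_unique:
  assumes p: "p \<in> polynomials C X Y" and q: "q \<in> polynomials C Y Z"
    and fp: "fib_pair q p f u v g u' v'"
    and 1: "classifies q p f u v g u' v' a b c" and 2: "classifies q p f u v g u' v' a' b' c'"
  shows "a = a'" "b = b'" "c = c'"
proof -
  note A = poly_comp_arrows[OF p q] and pbs = poly_comp_pullbacks[OF p q]
  note P = polynomialsD[OF p] and Q = polynomialsD[OF q] and F = fib_pairD[OF fp]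
  note M = classifiesD[OF 1] and N = classifiesD[OF 2]
  have eq: "FP q p \<cdot> b = FP q p \<cdot> b'"
    by (rule pullback_eq[OF pbs(1)])
      (use A M N in \<open>simp_all add: comp_extend1[OF A(24)] comp_extend1[OF A(25)]\<close>)
  have "around (pmid q) (PA q p) (FP q p \<cdot> b) g v'"
    unfolding around_def using M F(2) A by (simp add: comp_extend1[OF A(25)])
  moreover have "around_mor (FP q p \<cdot> b) g v' (FP q p) (FG q p) (GC q p) b c"
    by (rule around_morI) (use A M F in simp_all)
  moreover have "around_mor (FP q p \<cdot> b) g v' (FP q p) (FG q p) (GC q p) b' c'"
    unfolding eq by (rule around_morI) (use A N F in simp_all)
  ultimately show b: "b = b'" and c: "c = c'" using distributive_eq[OF pbs(2)] by blast+
  show "a = a'"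
    by (rule pullback_eq[OF pbs(4)]) (use A M N b in simp_all)
qed

text \<open>Precomposing a classifying morphism with a morphism of pairs classifies the source pair. This
  is the naturality from which all naturality statements about composites of fibrations derive.\<close>

lemma classifies_precomp:
  assumes p: "p \<in> polynomials C X Y" and q: "q \<in> polynomials C Y Z"
    and 1: "classifies q p f u v g u' v' a b c"
    and "i \<in> Arr C" "j \<in> Arr C" "k \<in> Arr C" "f \<in> Arr C" "g \<in> Arr C" "f' \<in> Arr C" "g' \<in> Arr C"
    and "Cod C f = Dom C g" "Cod C f' = Dom C g'"
    and "Dom C i = Dom C f'" "Cod C i = Dom C f" "Dom C j = Dom C g'" "Cod C j = Dom C g"
    and "Dom C k = Cod C g'" "Cod C k = Cod C g" and fi: "f \<cdot> i = j \<cdot> f'" and gj: "g \<cdot> j = k \<cdot> g'"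
  shows "classifies q p f' (u \<cdot> i) (v \<cdot> j) g' (u' \<cdot> j) (v' \<cdot> k) (a \<cdot> i) (b \<cdot> j) (c \<cdot> k)"
proof -
  note A = poly_comp_arrows[OF p q] and M = classifiesD[OF 1]
  show ?thesis
    by (rule classifiesI)
      (use assms A M in \<open>simp_all add: comp_extend1[OF M(10)] comp_extend[OF M(11)] comp_extend1[OF M(12)]
        comp_extend1[OF M(13)] comp_extend[OF M(14)] comp_extend1[OF M(15)]\<close>)
qed

text \<open>Both squares of a classifying morphism are pullbacks, so pasting them makes the composite
  \<open>g f\<close> a pullback of the middle arrow of \<open>q \<circ> p\<close>.\<close>

lemma classifies_fibration:
  assumes p: "p \<in> polynomials C X Y" and q: "q \<in> polynomials C Y Z"
    and fp: "fib_pair q p f u v g u' v'" and 1: "classifies q p f u v g u' v' a b c"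
  shows "is_pullback C (pmid (poly_comp C q p)) c a (g \<cdot> f)"
proof -
  note A = poly_comp_arrows[OF p q] and pbs = poly_comp_pullbacks[OF p q]
  note F = fib_pairD[OF fp] and M = classifiesD[OF 1]
  have "is_pullback C (FG q p) c b g"
    by (rule pullback_cancel[OF pbs(3)]) (use A F M in simp_all)
  moreover have "is_pullback C (HF q p) b a f"
    by (rule pullback_cancel[OF pbs(4)]) (use A F M in simp_all)
  ultimately show ?thesis
    unfolding poly_comp_def using pullback_paste_vertical by simp
qed

end

section \<open>Horizontal composition and associator as classifying arrows\<close>

context finitely_complete begin

text \<open>The horizontal composite of 2-cells is the classifying morphism of the universal pair of
  \<open>q \<circ> p\<close> whose fibration structures have been composed with the two cells.\<close>

lemma poly_hcomp_classifies:
  assumes p: "p \<in> polynomials C X Y" and q: "q \<in> polynomials C Y Z"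
    and p': "p' \<in> polynomials C X Y" and q': "q' \<in> polynomials C Y Z"
    and \<alpha>: "is_pullback C (pmid p') a1 a0 (pmid p)" "pright p' \<cdot> a1 = pright p"
    and \<beta>: "is_pullback C (pmid q') b1 b0 (pmid q)" "pleft q' \<cdot> b0 = pleft q"
  shows "\<exists>h s t. poly_hcomp C (q, (b0, b1), q') (p, (a0, a1), p') = (poly_comp C q p, (h, t),
      poly_comp C q' p') \<and>
     classifies q' p' (HF q p) (a0 \<cdot> HA q p) (a1 \<cdot> FC q p)
       (FG q p) (b0 \<cdot> FA q p) (b1 \<cdot> GC q p) h s t"
proof -
  note A = poly_comp_arrows[OF p q] and pbs = poly_comp_pullbacks[OF p q]
  note P = polynomialsD[OF p] and Q = polynomialsD[OF q]
  note A' = poly_comp_arrows[OF p' q'] and pbs' = poly_comp_pullbacks[OF p' q']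
  note P' = polynomialsD[OF p'] and Q' = polynomialsD[OF q']
  note a = pullbackD[OF \<alpha>(1)] and b = pullbackD[OF \<beta>(1)]
  have a': "a0 \<in> Arr C" "a1 \<in> Arr C" "Dom C a0 = Dom C (pmid p)" "Cod C a0 = Dom C (pmid p')"
    "Dom C a1 = Cod C (pmid p)" "Cod C a1 = Cod C (pmid p')" using a by simp_all
  have b': "b0 \<in> Arr C" "b1 \<in> Arr C" "Dom C b0 = Dom C (pmid q)" "Cod C b0 = Dom C (pmid q')"
    "Dom C b1 = Cod C (pmid q)" "Cod C b1 = Cod C (pmid q')" using b by simp_all
  define k where "k = induced C (PC q' p') (PA q' p') (a1 \<cdot> PC q p) (b0 \<cdot> PA q p)"
  have "pright p' \<cdot> (a1 \<cdot> PC q p) = pleft q' \<cdot> (b0 \<cdot> PA q p)"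
    using comp_extend1[OF \<alpha>(2), of "PC q p"] comp_extend1[OF \<beta>(2), of "PA q p"] a' b' A P P' Q Q'
    by simp
  then have k: "k \<in> Arr C" "Dom C k = Dom C (PC q p)" "Cod C k = Dom C (PC q' p')"
    "PC q' p' \<cdot> k = a1 \<cdot> PC q p" "PA q' p' \<cdot> k = b0 \<cdot> PA q p"
    using induced_props[OF pbs'(1), of "a1 \<cdot> PC q p" "b0 \<cdot> PA q p"] a' b' A P P' Q Q'
    by (simp_all add: k_def)
  have PA': "PA q' p' \<in> Arr C" "Cod C (PA q' p') = Dom C (pmid q')" using A' by simp_all
  have kf: "PA q' p' \<cdot> (k \<cdot> FP q p) = b0 \<cdot> FA q p"
    using k A A' b' by (simp add: comp_extend[OF k(5)])
  have kc: "PC q' p' \<cdot> (k \<cdot> FP q p) = a1 \<cdot> FC q p"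
    using k A A' a' by (simp add: comp_extend[OF k(4)])
  have ar: "around (pmid q') (PA q' p') (k \<cdot> FP q p) (FG q p) (b1 \<cdot> GC q p)"
    unfolding around_def kf using pullback_paste[OF \<beta>(1) pbs(3)] k A A' by simp
  obtain s t where st: "dist_induced C (pmid q') (PA q' p')
      (k \<cdot> FP q p, FG q p, b1 \<cdot> GC q p) = (s, t)" by (metis prod.collapse)
  have D: "distributivity_pullback C (pmid q') (PA q' p') = (FP q' p', FG q' p', GC q' p')"
    by (simp add: arr_FP_def arr_FG_def arr_GC_def)
  note m = around_morD[OF dist_induced_mor[OF Q'(1) PA' D ar st]]
  have s: "FC q' p' \<cdot> s = a1 \<cdot> FC q p" "FA q' p' \<cdot> s = b0 \<cdot> FA q p"
    using comp_extend1[OF A'(24), of s] comp_extend1[OF A'(25), of s] m A A' k kf kc by simp_all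
  define h where "h = induced C (HA q' p') (HF q' p') (a0 \<cdot> HA q p) (s \<cdot> HF q p)"
  have "pmid p' \<cdot> (a0 \<cdot> HA q p) = FC q' p' \<cdot> (s \<cdot> HF q p)"
    using m k A A' a' P P' by (simp add: comp_extend[OF a(9)] comp_extend[OF s(1)])
  then have h: "h \<in> Arr C" "Dom C h = Dom C (HF q p)" "Cod C h = Dom C (HF q' p')"
    "HA q' p' \<cdot> h = a0 \<cdot> HA q p" "HF q' p' \<cdot> h = s \<cdot> HF q p"
    using induced_props[OF pbs'(4), of "a0 \<cdot> HA q p" "s \<cdot> HF q p"] m k A A' a' P P'
    by (simp_all add: h_def)
  have "classifies q' p' (HF q p) (a0 \<cdot> HA q p) (a1 \<cdot> FC q p)
       (FG q p) (b0 \<cdot> FA q p) (b1 \<cdot> GC q p) h s t"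
    by (rule classifiesI) (use h m s k A A' b' in simp_all)
  moreover have "poly_hcomp C (q, (b0, b1), q') (p, (a0, a1), p') = (poly_comp C q p, (h, t),
      poly_comp C q' p')"
    by (simp add: poly_hcomp_def Let_def k_def[symmetric] st h_def[symmetric])
  ultimately show ?thesis by blast
qed

text \<open>The arrow \<open>F \<rightarrow> G\<close> belonging to \<open>(r \<circ> q) \<circ> p\<close> is a pullback of the middle arrow of \<open>r \<circ> q\<close>, and
  hence factors as \<open>n\<close>, a pullback of the middle arrow of \<open>q\<close>, followed by \<open>m1\<close>, a pullback of that
  of \<open>r\<close>. With \<open>H \<rightarrow> F\<close> in front this is the universal composable triple.\<close>

definition middle_factorisation :: "'m polynomial \<Rightarrow> 'm polynomial \<Rightarrow> 'm polynomial \<Rightarrow> 'm \<Rightarrow> 'm \<Rightarrow> 'm \<Rightarrow> bool" where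
  "middle_factorisation r q p n m1 m2 \<longleftrightarrow>
     is_pullback C (GC (poly_comp C r q) p) (FG r q) m1 m2 \<and>
     n \<in> hom C (Dom C (FG (poly_comp C r q) p)) (Dom C m1) \<and>
     m1 \<cdot> n = FG (poly_comp C r q) p \<and> m2 \<cdot> n = HF r q \<cdot> FA (poly_comp C r q) p"

lemma middle_factorisationD:
  assumes p: "p \<in> polynomials C X Y" and q: "q \<in> polynomials C Y Z" and r: "r \<in> polynomials C Z W"
    and m: "middle_factorisation r q p n m1 m2"
  shows "n \<in> Arr C" "m1 \<in> Arr C" "m2 \<in> Arr C" "Dom C n = Dom C (FG (poly_comp C r q) p)"
    "Dom C m1 = Cod C n" "Dom C m2 = Cod C n" "Cod C m1 = Dom C (GC (poly_comp C r q) p)" "Cod C m2 =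
        Dom C (FG r q)"
    "m1 \<cdot> n = FG (poly_comp C r q) p" "m2 \<cdot> n = HF r q \<cdot> FA (poly_comp C r q) p"
    "GC (poly_comp C r q) p \<cdot> m1 = FG r q \<cdot> m2"
    "is_pullback C (pmid q) (FC r q \<cdot> m2) (HA r q \<cdot> FA (poly_comp C r q) p) n"
    "is_pullback C (pmid r) (GC r q \<cdot> GC (poly_comp C r q) p) (FA r q \<cdot> m2) m1"
proof -
  let ?rq = "poly_comp C r q"
  note rq = poly_comp_polynomial[OF q r]
  note A = poly_comp_arrows[OF q r] and pbs = poly_comp_pullbacks[OF q r]
  note A' = poly_comp_arrows[OF p rq] and pbs' = poly_comp_pullbacks[OF p rq]
  have pm: "is_pullback C (GC ?rq p) (FG r q) m1 m2" using m by (simp add: middle_factorisation_def)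
  note M = pullbackD[OF pm]
  have mid: "pmid ?rq = FG r q \<cdot> HF r q" by (simp add: poly_comp_def)
  show 1: "n \<in> Arr C" "m1 \<in> Arr C" "m2 \<in> Arr C" "Dom C n = Dom C (FG ?rq p)"
    "Dom C m1 = Cod C n" "Dom C m2 = Cod C n" "Cod C m1 = Dom C (GC ?rq p)" "Cod C m2 = Dom C (FG r q)"
    "m1 \<cdot> n = FG ?rq p" "m2 \<cdot> n = HF r q \<cdot> FA ?rq p"
    "GC ?rq p \<cdot> m1 = FG r q \<cdot> m2"
    using m M by (simp_all add: middle_factorisation_def hom_iff)
  have "is_pullback C (HF r q) m2 (FA ?rq p) n"
  proof (rule pullback_sym, rule pullback_cancel[OF pm])
    show "is_pullback C (GC ?rq p) (FG r q \<cdot> HF r q) (m1 \<cdot> n) (FA ?rq p)"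
      using pullback_sym[OF pbs'(3)] by (simp only: mid 1(9))
  qed (use A A' 1 mid in simp_all)
  then show "is_pullback C (pmid q) (FC r q \<cdot> m2) (HA r q \<cdot> FA ?rq p) n"
    by (rule pullback_paste[OF pbs(4)])
  show "is_pullback C (pmid r) (GC r q \<cdot> GC ?rq p) (FA r q \<cdot> m2) m1"
    by (rule pullback_paste[OF pbs(3) pullback_sym[OF pm]])
qed

text \<open>The associator is the result of classifying the universal triple in the other order: first the
  pair formed by its first two arrows, by \<open>q \<circ> p\<close>, and then their composite with the last arrow, by
  \<open>r \<circ> (q \<circ> p)\<close>.\<close>

lemma poly_assoc_classifies:
  assumes p: "p \<in> polynomials C X Y" and q: "q \<in> polynomials C Y Z" and r: "r \<in> polynomials C Z W"
  shows "\<exists>n m1 m2 g s t h s' t'. middle_factorisation r q p n m1 m2 \<and>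
     poly_assoc C r q p = (poly_comp C (poly_comp C r q) p, (h, t'), poly_comp C r (poly_comp C q p)) \<and>
     classifies q p (HF (poly_comp C r q) p) (HA (poly_comp C r q) p) (FC (poly_comp C r q) p)
       n (HA r q \<cdot> FA (poly_comp C r q) p) (FC r q \<cdot> m2) g s t \<and>
     classifies r (poly_comp C q p) (n \<cdot> HF (poly_comp C r q) p) g t
       m1 (FA r q \<cdot> m2) (GC r q \<cdot> GC (poly_comp C r q) p) h s' t'"
proof -
  define rq where "rq = poly_comp C r q"
  define qp where "qp = poly_comp C q p"
  have rq: "rq \<in> polynomials C Y W" and qp: "qp \<in> polynomials C X Z"
    using poly_comp_polynomial p q r by (auto simp: rq_def qp_def)
  note A1 = poly_comp_arrows[OF p q] and pbs1 = poly_comp_pullbacks[OF p q]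
  note A2 = poly_comp_arrows[OF q r] and pbs2 = poly_comp_pullbacks[OF q r]
  note A3 = poly_comp_arrows[OF p rq] and pbs3 = poly_comp_pullbacks[OF p rq]
  note A4 = poly_comp_arrows[OF qp r] and pbs4 = poly_comp_pullbacks[OF qp r]
  note P = polynomialsD[OF p] and Q = polynomialsD[OF q] and R = polynomialsD[OF r]
  have rqs: "pleft rq = pleft q \<cdot> HA r q" "pmid rq = FG r q \<cdot> HF r q"
    "pright rq = pright r \<cdot> GC r q" by (simp_all add: rq_def poly_comp_def)
  have qps: "pleft qp = pleft p \<cdot> HA q p" "pmid qp = FG q p \<cdot> HF q p"
    "pright qp = pright q \<cdot> GC q p" by (simp_all add: qp_def poly_comp_def)
  define m1 where "m1 = pb1 C (GC rq p) (FG r q)"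
  define m2 where "m2 = pb2 C (GC rq p) (FG r q)"
  define n where "n = induced C m1 m2 (FG rq p) (HF r q \<cdot> FA rq p)"
  have pm: "is_pullback C (GC rq p) (FG r q) m1 m2"
    unfolding m1_def m2_def by (rule pb_pullback) (use A2 A3 in \<open>simp_all add: rqs\<close>)
  have "GC rq p \<cdot> FG rq p = FG r q \<cdot> (HF r q \<cdot> FA rq p)"
    using A3(27) A2 A3 by (simp add: rqs)
  then have n: "n \<in> Arr C" "Dom C n = Dom C (FG rq p)" "Cod C n = Dom C m1"
    "m1 \<cdot> n = FG rq p" "m2 \<cdot> n = HF r q \<cdot> FA rq p"
    using induced_props[OF pm, of "FG rq p" "HF r q \<cdot> FA rq p"] A2 A3
    by (simp_all add: n_def rqs)
  have tm: "middle_factorisation r q p n m1 m2" unfolding middle_factorisation_def rq_def[symmetric]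
      using n pm by (simp add: hom_iff)
  note T = middle_factorisationD[OF p q r tm, folded rq_def]
  have PA1: "PA q p \<in> Arr C" "Cod C (PA q p) = Dom C (pmid q)" using A1 by simp_all
  define j where "j = induced C (PC q p) (PA q p) (FC rq p) (HA r q \<cdot> FA rq p)"
  have "pright p \<cdot> FC rq p = pleft q \<cdot> (HA r q \<cdot> FA rq p)"
    using A3(29) A2 A3 Q by (simp add: rqs)
  then have j: "j \<in> Arr C" "Dom C j = Dom C (FG rq p)" "Cod C j = Dom C (PC q p)"
    "PC q p \<cdot> j = FC rq p" "PA q p \<cdot> j = HA r q \<cdot> FA rq p"
    using induced_props[OF pbs1(1), of "FC rq p" "HA r q \<cdot> FA rq p"] A1 A2 A3 P Q
    by (simp_all add: j_def rqs)
  have ar: "around (pmid q) (PA q p) j n (FC r q \<cdot> m2)"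
    unfolding around_def using j T(12) A1 by simp
  obtain s t where st: "dist_induced C (pmid q) (PA q p) (j, n, FC r q \<cdot> m2) = (s, t)"
    by (metis prod.collapse)
  have D1: "distributivity_pullback C (pmid q) (PA q p) = (FP q p, FG q p, GC q p)"
    by (simp add: arr_FP_def arr_FG_def arr_GC_def)
  have m: "s \<in> Arr C" "t \<in> Arr C" "Dom C s = Dom C (FG rq p)" "Cod C s = Dom C (FG q p)"
    "Dom C t = Dom C m1" "Cod C t = Dom C (GC q p)" "FP q p \<cdot> s = j" "FG q p \<cdot> s = t \<cdot> n"
    "GC q p \<cdot> t = FC r q \<cdot> m2"
    using around_morD[OF dist_induced_mor[OF Q(1) PA1 D1 ar st]] j A1 A2 T by simp_all
  have s: "FC q p \<cdot> s = FC rq p" "FA q p \<cdot> s = HA r q \<cdot> FA rq p"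
    using comp_extend1[OF A1(24), of s] comp_extend1[OF A1(25), of s] m A1 j by simp_all
  have PA4: "PA r qp \<in> Arr C" "Cod C (PA r qp) = Dom C (pmid r)" using A4 by simp_all
  define k where "k = induced C (PC r qp) (PA r qp) t (FA r q \<cdot> m2)"
  have "pright qp \<cdot> t = pleft r \<cdot> (FA r q \<cdot> m2)"
    using m A1 A2 T Q R by (simp add: qps comp_extend[OF A2(29)])
  then have k: "k \<in> Arr C" "Dom C k = Dom C m1" "Cod C k = Dom C (PC r qp)"
    "PC r qp \<cdot> k = t" "PA r qp \<cdot> k = FA r q \<cdot> m2"
    using induced_props[OF pbs4(1), of t "FA r q \<cdot> m2"] m T A1 A2 A4 Q R
    by (simp_all add: k_def qps)
  have ar': "around (pmid r) (PA r qp) k m1 (GC r q \<cdot> GC rq p)"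
    unfolding around_def using k T(13) A4 by simp
  obtain s' t' where st': "dist_induced C (pmid r) (PA r qp) (k, m1, GC r q \<cdot> GC rq p) = (s', t')"
    by (metis prod.collapse)
  have D4: "distributivity_pullback C (pmid r) (PA r qp) = (FP r qp, FG r qp, GC r qp)"
    by (simp add: arr_FP_def arr_FG_def arr_GC_def)
  have m': "s' \<in> Arr C" "t' \<in> Arr C" "Dom C s' = Dom C m1" "Cod C s' = Dom C (FG r qp)"
    "Dom C t' = Dom C (GC rq p)" "Cod C t' = Dom C (GC r qp)"
    "FP r qp \<cdot> s' = k" "FG r qp \<cdot> s' = t' \<cdot> m1"
    "GC r qp \<cdot> t' = GC r q \<cdot> GC rq p"
    using around_morD[OF dist_induced_mor[OF R(1) PA4 D4 ar' st']] k A2 A3 A4 T by (simp_all add: rqs)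
  have s': "FC r qp \<cdot> s' = t" "FA r qp \<cdot> s' = FA r q \<cdot> m2"
    using comp_extend1[OF A4(24), of s'] comp_extend1[OF A4(25), of s'] m' A4 k by simp_all
  define g where "g = induced C (HA q p) (HF q p) (HA rq p) (s \<cdot> HF rq p)"
  have "pmid p \<cdot> HA rq p = FC q p \<cdot> (s \<cdot> HF rq p)"
    using A3 A1 m P by (simp add: comp_extend1[OF s(1)])
  then have g: "g \<in> Arr C" "Dom C g = Dom C (HF rq p)" "Cod C g = Dom C (HF q p)"
    "HA q p \<cdot> g = HA rq p" "HF q p \<cdot> g = s \<cdot> HF rq p"
    using induced_props[OF pbs1(4), of "HA rq p" "s \<cdot> HF rq p"] m A1 A3 P
    by (simp_all add: g_def)
  define h where "h = induced C (HA r qp) (HF r qp) g (s' \<cdot> n \<cdot> HF rq p)"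
  have "pmid qp \<cdot> g = FC r qp \<cdot> (s' \<cdot> n \<cdot> HF rq p)"
    using A3 A1 A4 m m' g T by (simp add: qps comp_extend1[OF s'(1)] comp_extend[OF m(8)])
  then have h: "h \<in> Arr C" "Dom C h = Dom C (HF rq p)" "Cod C h = Dom C (HF r qp)"
    "HA r qp \<cdot> h = g" "HF r qp \<cdot> h = s' \<cdot> n \<cdot> HF rq p"
    using induced_props[OF pbs4(4), of g "s' \<cdot> n \<cdot> HF rq p"] m' A1 A3 A4 g T
    by (simp_all add: h_def qps)
  have "classifies q p (HF rq p) (HA rq p) (FC rq p)
       n (HA r q \<cdot> FA rq p) (FC r q \<cdot> m2) g s t"
    by (rule classifiesI) (use g m s T A3 in simp_all)
  moreover have "classifies r qp (n \<cdot> HF rq p) g t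
       m1 (FA r q \<cdot> m2) (GC r q \<cdot> GC rq p) h s' t'"
    by (rule classifiesI) (use g h m m' s' T A3 in simp_all)
  moreover have "poly_assoc C r q p = (poly_comp C rq p, (h, t'), poly_comp C r qp)"
    unfolding poly_assoc_def Let_def
    by (simp add: rq_def[symmetric] qp_def[symmetric] m1_def[symmetric] m2_def[symmetric] n_def[symmetric]
      j_def[symmetric] st k_def[symmetric] st' g_def[symmetric] h_def[symmetric])
  ultimately show ?thesis using tm unfolding rq_def qp_def by blast
qed

end

section \<open>Composition of fibrations induced by two pullback squares\<close>

locale exponentiable_arrow = finitely_complete C for C :: "('o, 'm) category" (structure) +
  fixes p :: 'm
  assumes exponentiable_p: "exponentiable C p"
begin

abbreviation "T \<equiv> terminal C"
abbreviation "P \<equiv> poly_of_arrow C p"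
abbreviation "PP \<equiv> poly_comp C P P"

lemma p_arr [simp]: "p \<in> Arr C"
  using exponentiable_p by (simp add: exponentiable_def)

lemma P_simps [simp]: "pmid P = p" "pleft P = to_terminal C (Dom C p)" "pright P = to_terminal C (Cod C p)"
  by (simp_all add: poly_of_arrow_def)

lemma P_poly: "P \<in> polynomials C T T"
  by (simp add: polynomials_def hom_iff exponentiable_p)

lemma PP_poly: "PP \<in> polynomials C T T"
  by (rule poly_comp_polynomial[OF P_poly P_poly])

text \<open>For polynomials from \<open>1\<close> to \<open>1\<close> the compatibility of legs holds automatically.\<close>

lemma terminal_fib_pair:
  assumes "r \<in> polynomials C T T" "q \<in> polynomials C T T"
    and 1: "is_pullback C (pmid r) v u f" and 2: "is_pullback C (pmid q) v' u' g" and "Cod C f = Dom C g"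
  shows "fib_pair q r f u v g u' v'"
proof -
  note R = polynomialsD[OF assms(1)] and Q = polynomialsD[OF assms(2)]
  note D1 = pullbackD[OF 1] and D2 = pullbackD[OF 2]
  have "pright r \<cdot> v = pleft q \<cdot> u'"
    by (rule terminal_unique) (use R Q D1 D2 assms(5) in simp_all)
  then show ?thesis using assms by (simp add: fib_pair_def)
qed

definition fibration :: "'m fib \<Rightarrow> bool" where
  "fibration = (\<lambda>(f, u, v). is_pullback C p v u f)"

definition fib_mor :: "'m fib \<Rightarrow> 'm \<Rightarrow> 'm \<Rightarrow> 'm fib \<Rightarrow> bool" where
  "fib_mor = (\<lambda>(f1, u1, v1) u3 v3 (f2, u2, v2).
     u3 \<in> hom C (Dom C f1) (Dom C f2) \<and> v3 \<in> hom C (Cod C f1) (Cod C f2) \<and>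
     f2 \<cdot> u3 = v3 \<cdot> f1 \<and> u2 \<cdot> u3 = u1 \<and> v2 \<cdot> v3 = v1)"

text \<open>A fibration structure is recovered from a morphism to another fibration. This is how laws are
  carried over from universal fibrations to arbitrary ones.\<close>

lemma fib_mor_unique:
  "fib_mor x i j z \<Longrightarrow> fib_mor y i j z \<Longrightarrow> fst x = fst y \<Longrightarrow> x = y"
  by (auto simp: fib_mor_def split_beta prod_eq_iff)

lemma fibrationD:
  assumes "fibration (f, u, v)"
  shows "is_pullback C p v u f" "f \<in> Arr C" "u \<in> Arr C" "v \<in> Arr C" "Dom C u = Dom C f" "Dom C v = Cod C f"
    "Cod C u = Dom C p" "Cod C v = Cod C p" "p \<cdot> u = v \<cdot> f"
  using assms pullbackD[of p v u f] by (simp_all add: fibration_def)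

lemma fib_morI:
  assumes "i \<in> Arr C" "j \<in> Arr C" "Dom C i = Dom C f" "Cod C i = Dom C f'" "Dom C j = Cod C f"
      "Cod C j = Cod C f'"
    "f' \<cdot> i = j \<cdot> f" "u' \<cdot> i = u" "v' \<cdot> j = v"
  shows "fib_mor (f, u, v) i j (f', u', v')"
  using assms by (simp add: fib_mor_def hom_iff)

lemma fib_morD:
  assumes "fib_mor (f, u, v) i j (f', u', v')"
  shows "i \<in> Arr C" "j \<in> Arr C" "Dom C i = Dom C f" "Cod C i = Dom C f'" "Dom C j = Cod C f" "Cod C j =
      Cod C f'"
    "f' \<cdot> i = j \<cdot> f" "u' \<cdot> i = u" "v' \<cdot> j = v"
  using assms by (simp_all add: fib_mor_def hom_iff)

definition unit_fib :: "'m \<Rightarrow> 'm \<Rightarrow> 'o \<Rightarrow> 'm fib" where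
  "unit_fib e0 e1 X = (Idn C X, e0 \<cdot> to_terminal C X, e1 \<cdot> to_terminal C X)"

text \<open>The structure on a composite is obtained from the classifying morphism \<open>(a, b, c)\<close> of the
  pair. The choice operator only picks out this morphism, which is unique.\<close>

definition comp_fib :: "'m \<Rightarrow> 'm \<Rightarrow> 'm fib \<Rightarrow> 'm fib \<Rightarrow> 'm fib" where
  "comp_fib m0 m1 = (\<lambda>(f, u, v) (g, u', v').
     case SOME (a, b, c). classifies P P f u v g u' v' a b c of (a, b, c) \<Rightarrow> (g \<cdot> f, m0 \<cdot> a, m1 \<cdot> c))"

text \<open>The pullback squares to \<open>p\<close> that are the possible units and multiplications.\<close>

definition unit_square :: "'m \<Rightarrow> 'm \<Rightarrow> bool" where
  "unit_square e0 e1 \<longleftrightarrow> is_pullback C p e1 e0 (Idn C T)"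

definition mult_square :: "'m \<Rightarrow> 'm \<Rightarrow> bool" where
  "mult_square m0 m1 \<longleftrightarrow> is_pullback C p m1 m0 (pmid PP)"

lemma unit_squareD:
  assumes "unit_square e0 e1"
  shows "e0 \<in> Arr C" "e1 \<in> Arr C" "Dom C e0 = T" "Dom C e1 = T" "Cod C e0 = Dom C p" "Cod C e1 = Cod C p"
    "p \<cdot> e0 = e1"
  using pullbackD[of p e1 e0 "Idn C T"] assms by (simp_all add: unit_square_def)

lemma fib_pair_of_fibs:
  assumes "fibration (f, u, v)" "fibration (g, u', v')" "Cod C f = Dom C g"
  shows "fib_pair P P f u v g u' v'"
  by (rule terminal_fib_pair) (use P_poly assms in \<open>simp_all add: fibration_def\<close>)

lemma comp_fib_classifies:
  assumes x: "fibration (f, u, v)" and y: "fibration (g, u', v')" and c: "Cod C f = Dom C g"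
    and cl: "classifies P P f u v g u' v' a b c"
  shows "comp_fib m0 m1 (f, u, v) (g, u', v') = (g \<cdot> f, m0 \<cdot> a, m1 \<cdot> c)"
proof -
  note fp = fib_pair_of_fibs[OF x y c]
  have "(SOME (a, b, c). classifies P P f u v g u' v' a b c) = (a, b, c)"
  proof (rule some_equality)
    fix w assume "case w of (a, b, c) \<Rightarrow> classifies P P f u v g u' v' a b c"
    then obtain a' b' c' where w: "w = (a', b', c')" "classifies P P f u v g u' v' a' b' c'"
      by (cases w) simp
    show "w = (a, b, c)" using classifies_unique[OF P_poly P_poly fp w(2) cl] w(1) by simp
  qed (use cl in simp)
  then show ?thesis by (simp add: comp_fib_def)
qed

lemma fibs_classified:
  assumes "fibration (f, u, v)" "fibration (g, u', v')" "Cod C f = Dom C g"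
  obtains a b c where "classifies P P f u v g u' v' a b c"
  using classifies_universal[OF P_poly P_poly fib_pair_of_fibs[OF assms]] by blast

lemmas PP_arrows = poly_comp_arrows[OF P_poly P_poly]

lemma mult_squareD:
  assumes "mult_square m0 m1"
  shows "m0 \<in> Arr C" "m1 \<in> Arr C" "Dom C m0 = Dom C (HF P P)" "Dom C m1 = Dom C (GC P P)"
    "Cod C m0 = Dom C p" "Cod C m1 = Cod C p"
  using assms pullbackD[of p m1 m0 "pmid PP"] PP_arrows by (simp_all add: mult_square_def poly_comp_def)

lemma comp_fib_fibration:
  assumes m: "mult_square m0 m1" and x: "fibration x" and y: "fibration y" and c: "Cod C (fst x) =
      Dom C (fst y)"
  shows "fibration (comp_fib m0 m1 x y)" "fst (comp_fib m0 m1 x y) = fst y \<cdot> fst x"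
proof -
  obtain f u v where x': "x = (f, u, v)" by (metis prod.collapse)
  obtain g u' v' where y': "y = (g, u', v')" by (metis prod.collapse)
  have xy: "fibration (f, u, v)" "fibration (g, u', v')" "Cod C f =
      Dom C g" using x y c by (simp_all add: x' y')
  obtain a b c where cl: "classifies P P f u v g u' v' a b c" by (rule fibs_classified[OF xy])
  note e = comp_fib_classifies[OF xy cl]
  have "is_pullback C p (m1 \<cdot> c) (m0 \<cdot> a) (g \<cdot> f)"
    by (rule pullback_paste[OF m[unfolded mult_square_def] classifies_fibration[OF P_poly P_poly
        fib_pair_of_fibs[OF xy] cl]])
  then show "fibration (comp_fib m0 m1 x y)" "fst (comp_fib m0 m1 x y) = fst y \<cdot> fst x"
    unfolding x' y' e by (simp_all add: fibration_def)
qed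

lemma comp_fib_mor:
  assumes m: "mult_square m0 m1" and x: "fibration x" and y: "fibration y" and c: "Cod C (fst x) =
      Dom C (fst y)"
    and w: "fibration w" and z: "fibration z" and d: "Cod C (fst w) = Dom C (fst z)"
    and i: "fib_mor w i j x" and k: "fib_mor z j k y"
  shows "fib_mor (comp_fib m0 m1 w z) i k (comp_fib m0 m1 x y)"
proof -
  obtain f u v where x': "x = (f, u, v)" by (metis prod.collapse)
  obtain g u' v' where y': "y = (g, u', v')" by (metis prod.collapse)
  obtain f2 u2 v2 where w': "w = (f2, u2, v2)" by (metis prod.collapse)
  obtain g2 u2' v2' where z': "z = (g2, u2', v2')" by (metis prod.collapse)
  have xy: "fibration (f, u, v)" "fibration (g, u', v')" "Cod C f =
      Dom C g" using x y c by (simp_all add: x' y')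
  have wz: "fibration (f2, u2, v2)" "fibration (g2, u2', v2')" "Cod C f2 =
      Dom C g2" using w z d by (simp_all add: w' z')
  obtain a b c where cl: "classifies P P f u v g u' v' a b c" by (rule fibs_classified[OF xy])
  note I = fib_morD[OF i[unfolded x' w']] and K = fib_morD[OF k[unfolded y' z']]
  note F = fibrationD(2-)[OF xy(1)] fibrationD(2-)[OF xy(2)] fibrationD(2-)[OF wz(1)] fibrationD(2-)[OF wz(2)]
  have "classifies P P f2 (u \<cdot> i) (v \<cdot> j) g2 (u' \<cdot> j) (v' \<cdot> k) (a \<cdot> i) (b \<cdot> j) (c \<cdot> k)"
    by (rule classifies_precomp[OF P_poly P_poly cl]) (use I K F wz(3) xy(3) in simp_all)
  then have cl2: "classifies P P f2 u2 v2 g2 u2' v2' (a \<cdot> i) (b \<cdot> j) (c \<cdot> k)" using I K by simp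
  note e = comp_fib_classifies[OF xy cl] comp_fib_classifies[OF wz cl2]
  note M = classifiesD[OF cl] and M2 = classifiesD[OF cl2]
  show ?thesis unfolding x' y' w' z' e
    by (rule fib_morI) (use I K F wz(3) xy(3) M M2 mult_squareD[OF m] in
      \<open>simp_all add: comp_extend[OF I(7)] comp_extend[OF K(7)]\<close>)
qed

lemma unit_fib_fibration:
  assumes e: "unit_square e0 e1" and X: "X \<in> Obj C"
  shows "fibration (unit_fib e0 e1 X)" "fst (unit_fib e0 e1 X) = Idn C X"
proof -
  have "is_pullback C (Idn C T) (to_terminal C X) (to_terminal C X) (Idn C X)"
    using pullback_sym[OF pullback_idn[of "to_terminal C X"]] X by simp
  from pullback_paste[OF e[unfolded unit_square_def] this]
  show "fibration (unit_fib e0 e1 X)" "fst (unit_fib e0 e1 X) = Idn C X"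
    by (simp_all add: fibration_def unit_fib_def)
qed

lemma unit_fib_mor:
  assumes e: "unit_square e0 e1" and i: "i \<in> Arr C"
  shows "fib_mor (unit_fib e0 e1 (Dom C i)) i i (unit_fib e0 e1 (Cod C i))"
proof -
  have "to_terminal C (Cod C i) \<cdot> i = to_terminal C (Dom C i)"
    by (rule terminal_unique) (use i in simp_all)
  then show ?thesis unfolding unit_fib_def
    by (intro fib_morI) (use i unit_squareD[OF e] in simp_all)
qed

text \<open>The common form of both kinds of data. The laws speak about objects only: the corresponding
  laws for squares follow, since a morphism of fibrations is determined by its two vertical arrows
  and its source and target.\<close>

definition fib_algebra :: "'m \<Rightarrow> 'm \<Rightarrow> 'm \<Rightarrow> 'm \<Rightarrow> bool" where
  "fib_algebra e0 e1 m0 m1 \<longleftrightarrow> unit_square e0 e1 \<and> mult_square m0 m1 \<and>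
     (\<forall>x. fibration x \<longrightarrow> comp_fib m0 m1 x (unit_fib e0 e1 (Cod C (fst x))) = x) \<and>
     (\<forall>x. fibration x \<longrightarrow> comp_fib m0 m1 (unit_fib e0 e1 (Dom C (fst x))) x = x) \<and>
     (\<forall>x y z. fibration x \<and> fibration y \<and> fibration z \<and> Cod C (fst x) = Dom C (fst y) \<and>
        Cod C (fst y) = Dom C (fst z) \<longrightarrow>
        comp_fib m0 m1 (comp_fib m0 m1 x y) z = comp_fib m0 m1 x (comp_fib m0 m1 y z))"

end

section \<open>Monad laws as laws at the universal fibrations\<close>

context exponentiable_arrow begin

lemma fibration_universal:
  assumes q: "q \<in> polynomials C T T"
  shows "fibration (HF q P, HA q P, FC q P)"
    and "fibration (FG P q, FA P q, GC P q)"
  using poly_comp_pullbacks(4)[OF P_poly q] poly_comp_pullbacks(3)[OF q P_poly] by (simp_all add: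
      fibration_def)

text \<open>Associativity in general is equivalent to associativity at the universal triple
  \<open>(x0, y0, z0)\<close>. There the structure obtained by composing the last two arrows first is the left
  side of the associativity equation of a monad, and the one obtained by composing the first two
  arrows first is the right side. Any other triple maps to the universal one: classify its last two
  arrows, and then the first arrow together with their composite.\<close>

lemma assoc_universal:
  assumes m: "mult_square m0 m1"
  shows "(\<forall>x y z. fibration x \<and> fibration y \<and> fibration z \<and> Cod C (fst x) = Dom C (fst y) \<and>
        Cod C (fst y) = Dom C (fst z) \<longrightarrow>
        comp_fib m0 m1 (comp_fib m0 m1 x y) z = comp_fib m0 m1 x (comp_fib m0 m1 y z)) \<longleftrightarrow>
    (\<exists>h t. label (poly_hcomp C (PP, (m0, m1), P) (P, (Idn C (Dom C p), Idn C (Cod C p)), P)) = (h, t) \<and>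
     (\<exists>h2 t2. label (poly_hcomp C (P, (Idn C (Dom C p), Idn C (Cod C p)), P) (PP, (m0, m1), P)) = (h2, t2) \<and>
      (\<exists>h3 t3. label (poly_assoc C P P P) = (h3, t3) \<and>
       m0 \<cdot> h = m0 \<cdot> h2 \<cdot> h3 \<and> m1 \<cdot> t = m1 \<cdot> t2 \<cdot> t3)))" (is "?all \<longleftrightarrow> ?one")
proof -
  have mp: "is_pullback C p m1 m0 (pmid PP)" using m by (simp add: mult_square_def)
  note M = mult_squareD[OF m]
  have ip: "is_pullback C (pmid P) (Idn C (Cod C p)) (Idn C (Dom C p)) (pmid P)"
    using pullback_idn[of p] by simp
  have ir: "pright P \<cdot> Idn C (Cod C p) = pright P" "pleft P \<cdot> Idn C (Dom C p) = pleft P" by simp_all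
  note PPd = polynomialsD[OF PP_poly]
  note mpd = pullbackD[OF mp]
  have mr: "pright P \<cdot> m1 = pright PP" "pleft P \<cdot> m0 = pleft PP"
    using mpd PPd by (auto intro!: terminal_unique)
  note A = PP_arrows and A1 = poly_comp_arrows[OF P_poly PP_poly] and A2 = poly_comp_arrows[OF PP_poly P_poly]
  obtain h1 s1 t1 where H1: "poly_hcomp C (PP, (m0, m1), P) (P, (Idn C (Dom C p), Idn C (Cod C p)), P)
      = (poly_comp C PP P, (h1, t1), PP)"
    "classifies P P (HF PP P) (Idn C (Dom C p) \<cdot> HA PP P) (Idn C (Cod C p) \<cdot> FC PP P)
       (FG PP P) (m0 \<cdot> FA PP P) (m1 \<cdot> GC PP P) h1 s1 t1"
    using poly_hcomp_classifies[OF P_poly PP_poly P_poly P_poly ip ir(1), of m1 m0] mp mr by auto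
  obtain h2 s2 t2 where H2: "poly_hcomp C (P, (Idn C (Dom C p), Idn C (Cod C p)), P) (PP, (m0, m1), P)
      = (poly_comp C P PP, (h2, t2), PP)"
    "classifies P P (HF P PP) (m0 \<cdot> HA P PP) (m1 \<cdot> FC P PP)
       (FG P PP) (Idn C (Dom C p) \<cdot> FA P PP) (Idn C (Cod C p) \<cdot> GC P PP) h2 s2 t2"
    using poly_hcomp_classifies[OF PP_poly P_poly P_poly P_poly _ _ ip ir(2), of m1 m0] mp mr by auto
  obtain n l k g s t h3 s3 t3 where tm: "middle_factorisation P P P n l k"
    and H3: "poly_assoc C P P P = (poly_comp C PP P, (h3, t3), poly_comp C P PP)"
     "classifies P P (HF PP P) (HA PP P) (FC PP P)
       n (HA P P \<cdot> FA PP P) (FC P P \<cdot> k) g s t"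
     "classifies P PP (n \<cdot> HF PP P) g t
       l (FA P P \<cdot> k) (GC P P \<cdot> GC PP P) h3 s3 t3"
    using poly_assoc_classifies[OF P_poly P_poly P_poly] by blast
  note N = middle_factorisationD[OF P_poly P_poly P_poly tm]
  \<comment> \<open>The universal composable triple.\<close>
  define x0 where "x0 = (HF PP P, HA PP P, FC PP P)"
  define y0 where "y0 = (n, HA P P \<cdot> FA PP P, FC P P \<cdot> k)"
  define z0 where "z0 = (l, FA P P \<cdot> k, GC P P \<cdot> GC PP P)"
  have F0: "fibration x0" "fibration y0" "fibration z0"
    using fibration_universal(1)[OF PP_poly] N(12,13) by (simp_all add: fibration_def x0_def y0_def z0_def)
  have C0: "Cod C (fst x0) = Dom C (fst y0)" "Cod C (fst y0) = Dom C (fst z0)"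
    using N A1 by (simp_all add: x0_def y0_def z0_def)
  have mid: "pmid PP = FG P P \<cdot> HF P P" by (simp add: poly_comp_def)
  have D: "Cod C (GC PP P) = Dom C (GC P P)" "Cod C (FA PP P) = Dom C (HF P P)"
    using A A1 by (simp_all add: mid)
  \<comment> \<open>The composite of \<open>n\<close> and \<open>l\<close> is the arrow \<open>F \<rightarrow> G\<close> of \<open>(p \<circ> p) \<circ> p\<close>, and its structure arrows
      \<open>FA\<close> and \<open>GC\<close> over \<open>p \<circ> p\<close> classify the pair.\<close>
  have yz: "comp_fib m0 m1 y0 z0 = (FG PP P, m0 \<cdot> FA PP P, m1 \<cdot> GC PP P)"
  proof -
    have "classifies P P n (HA P P \<cdot> FA PP P) (FC P P \<cdot> k) l (FA P P \<cdot> k)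
       (GC P P \<cdot> GC PP P) (FA PP P) k (GC PP P)"
      by (rule classifiesI) (use N A A1 D in simp_all)
    from comp_fib_classifies[OF F0(2,3)[unfolded y0_def z0_def] C0(2)[unfolded y0_def z0_def fst_conv] this]
    show ?thesis using N by (simp add: y0_def z0_def)
  qed
  \<comment> \<open>Therefore the whiskering of \<open>H1\<close> classifies \<open>x0\<close> followed by this composite.\<close>
  have xyz: "comp_fib m0 m1 x0 (comp_fib m0 m1 y0 z0) = (FG PP P \<cdot> HF PP P, m0 \<cdot> h1, m1 \<cdot> t1)"
  proof -
    have "fibration (comp_fib m0 m1 y0 z0)" by (rule comp_fib_fibration[OF m F0(2,3) C0(2)])
    then have f: "fibration (FG PP P, m0 \<cdot> FA PP P, m1 \<cdot> GC PP P)" by (simp add: yz)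
    have "classifies P P (HF PP P) (HA PP P) (FC PP P)
       (FG PP P) (m0 \<cdot> FA PP P) (m1 \<cdot> GC PP P) h1 s1 t1"
      using H1(2) A1 by simp
    from comp_fib_classifies[OF F0(1)[unfolded x0_def] f _ this] show ?thesis using A1 by (simp add: yz
        x0_def)
  qed
  have xy: "comp_fib m0 m1 x0 y0 = (n \<cdot> HF PP P, m0 \<cdot> g, m1 \<cdot> t)"
    using comp_fib_classifies[OF F0(1,2)[unfolded x0_def y0_def] C0(1)[unfolded x0_def y0_def fst_conv] H3(2)]
    by (simp add: x0_def y0_def)
  \<comment> \<open>The whiskering of \<open>H2\<close>, precomposed with the second half of the associator, classifies the
      composite of \<open>x0\<close> and \<open>y0\<close> followed by \<open>z0\<close>.\<close>
  have xy_z: "comp_fib m0 m1 (comp_fib m0 m1 x0 y0) z0 = (FG PP P \<cdot> HF PP P, m0 \<cdot> h2 \<cdot> h3, m1 \<cdot> t2 \<cdot> t3)"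
  proof -
    have "fibration (comp_fib m0 m1 x0 y0)" by (rule comp_fib_fibration[OF m F0(1,2) C0(1)])
    then have f: "fibration (n \<cdot> HF PP P, m0 \<cdot> g, m1 \<cdot> t)" by (simp add: xy)
    note S = classifiesD[OF H3(3)] and S2 = classifiesD[OF H2(2)]
    have D2: "Dom C m0 = Dom C (HF P P)" "Cod C (HA P PP) = Dom C (HF P P)"
      "Cod C (FC P PP) = Dom C (GC P P)"
      using M A A2 by (simp_all add: mid)
    have "classifies P P (n \<cdot> HF PP P) ((m0 \<cdot> HA P PP) \<cdot> h3) ((m1 \<cdot> FC P PP) \<cdot> s3)
       l ((Idn C (Dom C p) \<cdot> FA P PP) \<cdot> s3) ((Idn C (Cod C p) \<cdot> GC P PP) \<cdot> t3) (h2 \<cdot> h3) (s2 \<cdot> s3) (t2 \<cdot> t3)"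
      by (rule classifies_precomp[OF P_poly P_poly H2(2)]) (use S N A1 A2 in simp_all)
    moreover have "(m0 \<cdot> HA P PP) \<cdot> h3 = m0 \<cdot> g" "(m1 \<cdot> FC P PP) \<cdot> s3 = m1 \<cdot> t"
      "(Idn C (Dom C p) \<cdot> FA P PP) \<cdot> s3 = FA P P \<cdot> k"
      "(Idn C (Cod C p) \<cdot> GC P PP) \<cdot> t3 = GC P P \<cdot> GC PP P"
      using S A2 M D2 by simp_all
    ultimately have "classifies P P (n \<cdot> HF PP P) (m0 \<cdot> g) (m1 \<cdot> t)
       l (FA P P \<cdot> k) (GC P P \<cdot> GC PP P) (h2 \<cdot> h3) (s2 \<cdot> s3) (t2 \<cdot> t3)" by simp
    from comp_fib_classifies[OF f F0(3)[unfolded z0_def] _ this] show ?thesis using A1 N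
      by (simp add: xy z0_def comp_extend1[OF N(9)])
  qed
  have one: "?one \<longleftrightarrow> comp_fib m0 m1 (comp_fib m0 m1 x0 y0) z0 = comp_fib m0 m1 x0 (comp_fib m0 m1 y0 z0)"
    unfolding H1(1) H2(1) H3(1) xyz xy_z by auto
  show ?thesis
  proof
    assume ?all
    then show ?one unfolding one using F0 C0 by blast
  next
    assume ?one
    then have eq: "comp_fib m0 m1 (comp_fib m0 m1 x0 y0) z0 = comp_fib m0 m1 x0 (comp_fib m0 m1 y0 z0)"
      unfolding one .
    show ?all
    proof (intro allI impI)
      fix x y z assume a: "fibration x \<and> fibration y \<and> fibration z \<and> Cod C (fst x) = Dom C (fst y) \<and>
        Cod C (fst y) = Dom C (fst z)"
      obtain f1 u1 v1 where x: "x = (f1, u1, v1)" by (metis prod.collapse)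
      obtain f2 u2 v2 where y: "y = (f2, u2, v2)" by (metis prod.collapse)
      obtain f3 u3 v3 where z: "z = (f3, u3, v3)" by (metis prod.collapse)
      have F: "fibration (f1, u1, v1)" "fibration (f2, u2, v2)" "fibration (f3, u3, v3)"
        "Cod C f1 = Dom C f2" "Cod C f2 = Dom C f3" using a by (simp_all add: x y z)
      note FF = fibrationD(2-)[OF F(1)] fibrationD(2-)[OF F(2)] fibrationD(2-)[OF F(3)]
      obtain a b c where c1: "classifies P P f2 u2 v2 f3 u3 v3 a b c" by (rule fibs_classified[OF F(2,3,5)])
      note S = classifiesD[OF c1]
      have "is_pullback C (pmid PP) c a (f3 \<cdot> f2)"
        by (rule classifies_fibration[OF P_poly P_poly fib_pair_of_fibs[OF F(2,3,5)] c1])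
      then have fp: "fib_pair PP P f1 u1 v1 (f3 \<cdot> f2) a c"
        by (intro terminal_fib_pair[OF P_poly PP_poly]) (use F FF in \<open>simp_all add: fibration_def\<close>)
      obtain a' b' c' where c2: "classifies PP P f1 u1 v1 (f3 \<cdot> f2) a c a' b' c'"
        using classifies_universal[OF P_poly PP_poly fp] by blast
      note S' = classifiesD[OF c2]
      have "GC PP P \<cdot> (c' \<cdot> f3) = FG P P \<cdot> b"
        using S S' F FF A1 by (simp add: comp_extend1[OF S'(15)])
      \<comment> \<open>The morphism of triples lacks only its component at the object between the second and the
          third arrow.\<close>
      then obtain m where mm: "m \<in> Arr C" "Dom C m = Dom C (c' \<cdot> f3)" "Cod C m = Dom C l" "l \<cdot> m =
          c' \<cdot> f3" "k \<cdot> m = b"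
        by (rule_tac pullback_lift[OF tm[unfolded middle_factorisation_def, THEN conjunct1], of "c' \<cdot> f3" b])
          (use S S' F FF A1 A in simp_all)
      have nb: "n \<cdot> b' = m \<cdot> f2"
        by (rule pullback_eq[OF tm[unfolded middle_factorisation_def, THEN conjunct1]])
          (use S S' F FF A1 A mm N D in \<open>simp_all add: comp_extend1[OF N(9)] comp_extend1[OF N(10)]
              comp_extend[OF mm(4)]
             comp_extend1[OF mm(5)]\<close>)
      have mx: "fib_mor x a' b' x0"
        unfolding x x0_def by (rule fib_morI) (use S' F FF A1 in simp_all)
      have my: "fib_mor y b' m y0"
        unfolding y y0_def
      proof (rule fib_morI)
        show "(HA P P \<cdot> FA PP P) \<cdot> b' = u2" using S(10) S'(2,7,13) A(8,21) A1(7,19) D(2) by simp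
        show "(FC P P \<cdot> k) \<cdot> m = v2" using S(12) mm(1,3,5) A(6,17) N(3,5,6,8) by simp
      qed (use S' F FF N(1-8) mm(1-3) nb in simp_all)
      have mz: "fib_mor z m c' z0"
        unfolding z z0_def
      proof (rule fib_morI)
        show "(FA P P \<cdot> k) \<cdot> m = u3" using S(13) mm(1,3,5) A(7,19) N(3,5,6,8) by simp
        show "(GC P P \<cdot> GC PP P) \<cdot> c' = v3" using S(15) S'(3,9,15) A(5) A1(5) D(1) by simp
      qed (use S' F FF N(1-8) mm in simp_all)
      note cm = comp_fib_mor[OF m] and cf = comp_fib_fibration[OF m]
      have C1: "Cod C (fst x) = Dom C (fst y)" "Cod C (fst y) = Dom C (fst z)" "fibration x"
          "fibration y" "fibration z" using a by auto
      have arrs: "fst x \<in> Arr C" "fst y \<in> Arr C" "fst z \<in> Arr C" using FF by (simp_all add: x y z)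
      have arrs0: "fst x0 \<in> Arr C" "fst y0 \<in> Arr C"
          "fst z0 \<in> Arr C" using A1 N by (simp_all add: x0_def y0_def z0_def)
      have 1: "fib_mor (comp_fib m0 m1 (comp_fib m0 m1 x y) z) a' c' (comp_fib m0 m1 (comp_fib m0 m1 x0
          y0) z0)"
        by (rule cm[OF cf(1) _ _ cf(1) _ _ cm]) (use F0 C0 C1 mx my mz arrs arrs0 in \<open>simp_all add: cf\<close>)
      have 2: "fib_mor (comp_fib m0 m1 x (comp_fib m0 m1 y z)) a' c' (comp_fib m0 m1 x0 (comp_fib m0 m1
          y0 z0))"
        by (rule cm[OF _ cf(1) _ _ cf(1) _ _ cm]) (use F0 C0 C1 mx my mz arrs arrs0 in \<open>simp_all add: cf\<close>)
      have 3: "fst (comp_fib m0 m1 (comp_fib m0 m1 x y) z) = fst (comp_fib m0 m1 x (comp_fib m0 m1 y z))"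
        using C1 arrs by (simp add: cf)
      show "comp_fib m0 m1 (comp_fib m0 m1 x y) z = comp_fib m0 m1 x (comp_fib m0 m1 y z)"
        by (rule fib_mor_unique[OF 1[unfolded eq] 2 3])
    qed
  qed
qed

end

context exponentiable_arrow begin

abbreviation "J \<equiv> poly_id C T"

lemma J_simps [simp]: "pleft J = Idn C T" "pmid J = Idn C T" "pright J = Idn C T"
  by (simp_all add: poly_id_def)

lemma J_poly:
  assumes "unit_square e0 e1"
  shows "J \<in> polynomials C T T"
  using exponentiable_pullback[OF exponentiable_p assms[unfolded unit_square_def]]
  by (simp add: polynomials_def hom_iff)

lemma pullback_iso:
  assumes "f \<in> Arr C" "w \<in> Arr C" "w' \<in> Arr C" "Cod C w = Cod C f" "Dom C w' = Cod C f" "Cod C w' = Dom C w"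
    and ww: "w \<cdot> w' = Idn C (Cod C f)" "w' \<cdot> w = Idn C (Dom C w)"
  shows "is_pullback C f w (Idn C (Dom C f)) (w' \<cdot> f)"
proof (rule pullbackI)
  show "f \<cdot> Idn C (Dom C f) = w \<cdot> w' \<cdot> f" using assms by (simp add: comp_extend1[OF ww(1)])
  fix x y assume a: "x \<in> Arr C" "y \<in> Arr C" "Cod C x = Dom C f" "Cod C y = Dom C w" "f \<cdot> x = w \<cdot> y"
  have "(w' \<cdot> f) \<cdot> x = y" using a assms by (simp add: comp_extend1[OF ww(2)])
  then show "\<exists>r. r \<in> Arr C \<and> Dom C r = Dom C x \<and> Cod C r = Dom C (Idn C (Dom C f)) \<and>
      Idn C (Dom C f) \<cdot> r = x \<and> (w' \<cdot> f) \<cdot> r = y"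
    using a assms by (intro exI[of _ x]) simp
qed (use assms in simp_all)

text \<open>In \<open>1 \<circ> p\<close> the arrow \<open>F \<rightarrow> G\<close> is a pullback of an identity and so invertible. Up to this
  isomorphism the universal pair of \<open>1 \<circ> p\<close> is a fibration followed by an identity, and every
  fibration followed by an identity is classified by it.\<close>

lemma unit_law_right:
  assumes e: "unit_square e0 e1" and m: "mult_square m0 m1"
  shows "(\<forall>x. fibration x \<longrightarrow> comp_fib m0 m1 x (unit_fib e0 e1 (Cod C (fst x))) = x) \<longleftrightarrow>
    (\<exists>h t. label (poly_hcomp C (J, (e0, e1), P) (P, (Idn C (Dom C p), Idn C (Cod C p)), P)) = (h, t) \<and>
      label (poly_lunit C P) = (m0 \<cdot> h, m1 \<cdot> t))" (is "?all \<longleftrightarrow> ?one")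
proof -
  note J = J_poly[OF e] and E = unit_squareD[OF e] and M = mult_squareD[OF m]
  have ip: "is_pullback C (pmid P) (Idn C (Cod C p)) (Idn C (Dom C p)) (pmid P)"
    using pullback_idn[of p] by simp
  have ir: "pright P \<cdot> Idn C (Cod C p) = pright P" by simp
  have ep: "is_pullback C (pmid P) e1 e0 (pmid J)" using e by (simp add: unit_square_def)
  have el: "pleft P \<cdot> e0 = pleft J" by (rule terminal_unique) (use E in simp_all)
  note A = poly_comp_arrows[OF P_poly J] and pbs = poly_comp_pullbacks[OF P_poly J]
  have J1: "Dom C (pmid J) = T" "Cod C (pmid J) = T" by simp_all
  obtain h s t where H: "poly_hcomp C (J, (e0, e1), P) (P, (Idn C (Dom C p), Idn C (Cod C p)), P)
      = (poly_comp C J P, (h, t), PP)"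
    "classifies P P (HF J P) (Idn C (Dom C p) \<cdot> HA J P) (Idn C (Cod C p) \<cdot> FC J P)
       (FG J P) (e0 \<cdot> FA J P) (e1 \<cdot> GC J P) h s t"
    using poly_hcomp_classifies[OF P_poly J P_poly P_poly ip ir ep el] by blast
  have H2: "classifies P P (HF J P) (HA J P) (FC J P)
       (FG J P) (e0 \<cdot> FA J P) (e1 \<cdot> GC J P) h s t"
    using H(2) A(6,8,18,22) by simp
  define x0 where "x0 = (HF J P, HA J P, FC J P)"
  define y0 where "y0 = (FG J P, e0 \<cdot> FA J P, e1 \<cdot> GC J P)"
  have x0: "fibration x0" unfolding x0_def by (rule fibration_universal(1)[OF J])
  have y0: "fibration y0" unfolding y0_def fibration_def
    using pullback_paste[OF ep pbs(3)] by simp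
  have c0: "Cod C (fst x0) = Dom C (fst y0)" using A by (simp add: x0_def y0_def)
  have xy: "comp_fib m0 m1 x0 y0 = (FG J P \<cdot> HF J P, m0 \<cdot> h, m1 \<cdot> t)"
    using comp_fib_classifies[OF x0[unfolded x0_def] y0[unfolded y0_def] c0[unfolded x0_def y0_def
        fst_conv] H2]
    by (simp add: x0_def y0_def)
  define w where "w = induced C (FA J P) (FG J P) (GC J P) (Idn C (Dom C (GC J P)))"
  have w: "w \<in> Arr C" "Dom C w = Dom C (GC J P)" "Cod C w = Dom C (FG J P)"
    "FA J P \<cdot> w = GC J P" "FG J P \<cdot> w = Idn C (Dom C (GC J P))"
    using induced_props[OF pbs(3), of "GC J P" "Idn C (Dom C (GC J P))"] A
    by (simp_all add: w_def)
  have GF: "FA J P = GC J P \<cdot> FG J P"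
    using A(7,20,27) by simp
  \<comment> \<open>Thus \<open>w\<close> is the inverse of \<open>F \<rightarrow> G\<close>.\<close>
  have wF: "w \<cdot> FG J P = Idn C (Dom C (FG J P))"
    by (rule pullback_eq[OF pbs(3)])
      (use A(4,5,7,15,16,19,20) w GF[symmetric] in
          \<open>simp_all add: comp_extend1[OF w(4)] comp_extend1[OF w(5)]\<close>)
  have lun: "label (poly_lunit C P) = (HA J P, FC J P \<cdot> w)"
    by (simp add: poly_lunit_def Let_def w_def)
  have one: "?one \<longleftrightarrow> comp_fib m0 m1 x0 y0 = (FG J P \<cdot> HF J P, HA J P, FC J P \<cdot> w)"
    unfolding lun H(1) xy by auto
  show ?thesis
  proof
    assume all: ?all
    \<comment> \<open>The fibration \<open>x0\<close> transported along the isomorphism \<open>F \<rightarrow> G\<close>; in \<open>1 \<circ> p\<close> it is followed by an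
        identity.\<close>
    define x1 where "x1 = (FG J P \<cdot> HF J P, HA J P, FC J P \<cdot> w)"
    have "is_pullback C (HF J P) w (Idn C (Dom C (HF J P))) (FG J P \<cdot> HF J P)"
      by (rule pullback_iso) (use A(4,9,15,23) w wF in simp_all)
    from pullback_paste[OF pbs(4) this]
    have x1: "fibration x1" using A(8,21) by (simp add: x1_def fibration_def)
    let ?u = "unit_fib e0 e1 (Dom C (GC J P))"
    have u: "fibration ?u" "fst ?u = Idn C (Dom C (GC J P))"
      using unit_fib_fibration[OF e, of "Dom C (GC J P)"] A(5) by simp_all
    have x01: "fib_mor x0 (Idn C (Dom C (HF J P))) (FG J P) x1"
      unfolding x0_def x1_def by (rule fib_morI) (use A(4,6,8,9,15,17,21,23) w wF in simp_all)
    have y01: "fib_mor y0 (FG J P) (Idn C (Dom C (GC J P))) ?u"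
      unfolding y0_def unit_fib_def
    proof (rule fib_morI)
      have "to_terminal C (Dom C (GC J P)) \<cdot> FG J P = FA J P"
        by (rule terminal_unique) (use A(4,5,7,15,19,20) in simp_all)
      then show "(e0 \<cdot> to_terminal C (Dom C (GC J P))) \<cdot> FG J P = e0 \<cdot> FA J P"
        using A(4,5,15) E by simp
      have "to_terminal C (Dom C (GC J P)) = GC J P"
        by (rule terminal_unique) (use A(5,16) in simp_all)
      then show "(e1 \<cdot> to_terminal C (Dom C (GC J P))) \<cdot> Idn C (Dom C (GC J P)) = e1 \<cdot> GC J P"
        using A(5,16) E by simp
    qed (use A(4,5,15) in simp_all)
    have "fib_mor (comp_fib m0 m1 x0 y0) (Idn C (Dom C (HF J P))) (Idn C (Dom C (GC J P))) (comp_fib m0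
        m1 x1 ?u)"
      by (rule comp_fib_mor[OF m x1 u(1) _ x0 y0 c0 x01 y01]) (use u(2) A(4,5,9,15,23) in \<open>simp add: x1_def\<close>)
    moreover have "comp_fib m0 m1 x1 ?u = x1"
      using all[THEN spec, THEN mp, OF x1] A(4,5,9,15,23) by (simp add: x1_def)
    ultimately have "fib_mor (comp_fib m0 m1 x0 y0) (Idn C (Dom C (HF J P))) (Idn C (Dom C (GC J P)))
        x1" by simp
    moreover have "fib_mor x1 (Idn C (Dom C (HF J P))) (Idn C (Dom C (GC J P))) x1"
      unfolding x1_def by (rule fib_morI) (use A w in simp_all)
    ultimately have "comp_fib m0 m1 x0 y0 = x1"
      by (rule fib_mor_unique) (simp add: xy x1_def)
    then show ?one unfolding one x1_def .
  next
    assume ?one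
    then have eq: "comp_fib m0 m1 x0 y0 = (FG J P \<cdot> HF J P, HA J P, FC J P \<cdot> w)"
      unfolding one .
    show ?all
    proof (intro allI impI)
      fix x assume "fibration x"
      obtain f u v where x: "x = (f, u, v)" by (metis prod.collapse)
      have fx: "fibration (f, u, v)" using \<open>fibration x\<close> x by simp
      note F = fibrationD[OF fx]
      let ?Y = "Cod C f" let ?t = "to_terminal C ?Y"
      have Y: "?Y \<in> Obj C" using F by simp
      have "is_pullback C (pmid J) ?t ?t (Idn C ?Y)"
        using pullback_sym[OF pullback_idn[of ?t]] Y by simp
      then have fp: "fib_pair J P f u v (Idn C ?Y) ?t ?t"
        by (intro terminal_fib_pair[OF P_poly J]) (use F in simp_all)
      obtain a b c where cl: "classifies J P f u v (Idn C ?Y) ?t ?t a b c"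
        using classifies_universal[OF P_poly J fp] by blast
      note S = classifiesD[OF cl]
      let ?u = "unit_fib e0 e1 ?Y"
      have uf: "fibration ?u" "fst ?u = Idn C ?Y" using unit_fib_fibration[OF e Y] by simp_all
      have xm: "fib_mor x a b x0" unfolding x x0_def by (rule fib_morI) (use S F A(9,23) in simp_all)
      have ym: "fib_mor ?u b c y0" unfolding unit_fib_def y0_def
        by (rule fib_morI) (use S F E Y A(4,5,7,15,16,19,20) in simp_all)
      have mor: "fib_mor (comp_fib m0 m1 x ?u) a c (FG J P \<cdot> HF J P, HA J P, FC J P \<cdot> w)"
        unfolding eq[symmetric]
        by (rule comp_fib_mor[OF m x0 y0 c0 _ uf(1) _ xm ym]) (use fx F uf x in simp_all)
      have c: "c = FG J P \<cdot> b" using S Y by simp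
      have "fib_mor x a c (FG J P \<cdot> HF J P, HA J P, FC J P \<cdot> w)"
        unfolding x
      proof (rule fib_morI)
        have "w \<cdot> c = b" unfolding c using comp_extend1[OF wF, of b] S A(4,15) w by simp
        then show "(FC J P \<cdot> w) \<cdot> c = v" using S A(6,17) w by simp
        show "(FG J P \<cdot> HF J P) \<cdot> a = c \<cdot> f"
          using S F A(4,9,15,23) Y by (simp add: comp_extend[OF S(14)])
      qed (use S F A(4,9,15,23) Y in simp_all)
      then show "comp_fib m0 m1 x (unit_fib e0 e1 (Cod C (fst x))) = x"
        using fib_mor_unique[OF mor, of x] comp_fib_fibration(2)[OF m, of x ?u] fx F uf x by simp
    qed
  qed
qed

text \<open>In \<open>p \<circ> 1\<close> it is \<open>H \<rightarrow> F\<close> that is a pullback of an identity. It is also a morphism of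
  fibrations to the unit fibration on \<open>F\<close>, along which the law at \<open>F \<rightarrow> G\<close> is transported.\<close>

lemma unit_law_left:
  assumes e: "unit_square e0 e1" and m: "mult_square m0 m1"
  shows "(\<forall>x. fibration x \<longrightarrow> comp_fib m0 m1 (unit_fib e0 e1 (Dom C (fst x))) x = x) \<longleftrightarrow>
    (\<exists>h t. label (poly_hcomp C (P, (Idn C (Dom C p), Idn C (Cod C p)), P) (J, (e0, e1), P)) = (h, t) \<and>
      label (poly_runit C P) = (m0 \<cdot> h, m1 \<cdot> t))" (is "?all \<longleftrightarrow> ?one")
proof -
  note J = J_poly[OF e] and E = unit_squareD[OF e] and M = mult_squareD[OF m]
  have ip: "is_pullback C (pmid P) (Idn C (Cod C p)) (Idn C (Dom C p)) (pmid P)"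
    using pullback_idn[of p] by simp
  have ir: "pleft P \<cdot> Idn C (Dom C p) = pleft P" by simp
  have ep: "is_pullback C (pmid P) e1 e0 (pmid J)" using e by (simp add: unit_square_def)
  have el: "pright P \<cdot> e1 = pright J" by (rule terminal_unique) (use E in simp_all)
  note A = poly_comp_arrows[OF J P_poly] and pbs = poly_comp_pullbacks[OF J P_poly]
  obtain h s t where H: "poly_hcomp C (P, (Idn C (Dom C p), Idn C (Cod C p)), P) (J, (e0, e1), P)
      = (poly_comp C P J, (h, t), PP)"
    "classifies P P (HF P J) (e0 \<cdot> HA P J) (e1 \<cdot> FC P J)
       (FG P J) (Idn C (Dom C p) \<cdot> FA P J) (Idn C (Cod C p) \<cdot> GC P J) h s t"
    using poly_hcomp_classifies[OF J P_poly P_poly P_poly ep el ip ir] by blast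
  have H2: "classifies P P (HF P J) (e0 \<cdot> HA P J) (e1 \<cdot> FC P J)
       (FG P J) (FA P J) (GC P J) h s t"
    using H(2) A(5,7,16,20) by simp
  define x0 where "x0 = (HF P J, e0 \<cdot> HA P J, e1 \<cdot> FC P J)"
  define y0 where "y0 = (FG P J, FA P J, GC P J)"
  have y0: "fibration y0" unfolding y0_def by (rule fibration_universal(2)[OF J])
  have x0: "fibration x0" unfolding x0_def fibration_def
    using pullback_paste[OF ep pbs(4)] by simp
  have c0: "Cod C (fst x0) = Dom C (fst y0)" using A by (simp add: x0_def y0_def)
  have xy: "comp_fib m0 m1 x0 y0 = (FG P J \<cdot> HF P J, m0 \<cdot> h, m1 \<cdot> t)"
    using comp_fib_classifies[OF x0[unfolded x0_def] y0[unfolded y0_def] c0[unfolded x0_def y0_def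
        fst_conv] H2]
    by (simp add: x0_def y0_def)
  have run: "label (poly_runit C P) = (FA P J \<cdot> HF P J, GC P J)"
    by (simp add: poly_runit_def Let_def)
  have one: "?one \<longleftrightarrow> comp_fib m0 m1 x0 y0 = (FG P J \<cdot> HF P J, FA P J \<cdot> HF P J, GC P J)"
    unfolding run H(1) xy by auto
  show ?thesis
  proof
    assume all: ?all
    let ?X = "Dom C (FG P J)" let ?G = "Dom C (GC P J)"
    let ?u = "unit_fib e0 e1 ?X"
    have u: "fibration ?u" "fst ?u = Idn C ?X"
      using unit_fib_fibration[OF e, of ?X] A(4) by simp_all
    have x01: "fib_mor x0 (HF P J) (Idn C ?X) ?u"
      unfolding x0_def unit_fib_def
    proof (rule fib_morI)
      have "to_terminal C ?X \<cdot> HF P J = HA P J"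
        by (rule terminal_unique) (use A(4,8,9,21,22,23) in simp_all)
      then show "(e0 \<cdot> to_terminal C ?X) \<cdot> HF P J = e0 \<cdot> HA P J" using A(4,9,23) E by simp
      have "to_terminal C ?X = FC P J"
        by (rule terminal_unique) (use A(4,6,17,18) in simp_all)
      then show "(e1 \<cdot> to_terminal C ?X) \<cdot> Idn C ?X = e1 \<cdot> FC P J" using A(4,6,17,18) E by simp
    qed (use A(4,9,23) in simp_all)
    have y01: "fib_mor y0 (Idn C ?X) (Idn C ?G) y0"
      unfolding y0_def by (rule fib_morI) (use A(4,5,7,15,19) in simp_all)
    have "comp_fib m0 m1 ?u y0 = y0" using all[THEN spec, THEN mp, OF y0] by (simp add: y0_def)
    moreover have "fib_mor (comp_fib m0 m1 x0 y0) (HF P J) (Idn C ?G) (comp_fib m0 m1 ?u y0)"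
      by (rule comp_fib_mor[OF m u(1) y0 _ x0 y0 c0 x01 y01]) (use u(2) A(4) in \<open>simp add: y0_def\<close>)
    ultimately have "fib_mor (comp_fib m0 m1 x0 y0) (HF P J) (Idn C ?G) y0" by simp
    moreover have "fib_mor (FG P J \<cdot> HF P J, FA P J \<cdot> HF P J, GC P J) (HF P J) (Idn C ?G) y0"
      unfolding y0_def by (rule fib_morI) (use A in simp_all)
    ultimately have "comp_fib m0 m1 x0 y0 = (FG P J \<cdot> HF P J, FA P J \<cdot> HF P J, GC P J)"
      by (rule fib_mor_unique) (simp add: xy)
    then show ?one unfolding one .
  next
    assume ?one
    then have eq: "comp_fib m0 m1 x0 y0 = (FG P J \<cdot> HF P J, FA P J \<cdot> HF P J, GC P J)"
      unfolding one .
    show ?all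
    proof (intro allI impI)
      fix x assume "fibration x"
      obtain f u v where x: "x = (f, u, v)" by (metis prod.collapse)
      have fx: "fibration (f, u, v)" using \<open>fibration x\<close> x by simp
      note F = fibrationD[OF fx]
      let ?X = "Dom C f" let ?t = "to_terminal C ?X"
      have X: "?X \<in> Obj C" using F by simp
      have "is_pullback C (pmid J) ?t ?t (Idn C ?X)"
        using pullback_sym[OF pullback_idn[of ?t]] X by simp
      then have fp: "fib_pair P J (Idn C ?X) ?t ?t f u v"
        by (intro terminal_fib_pair[OF J P_poly]) (use F in simp_all)
      obtain a b c where cl: "classifies P J (Idn C ?X) ?t ?t f u v a b c"
        using classifies_universal[OF J P_poly fp] by blast
      note S = classifiesD[OF cl]
      let ?u = "unit_fib e0 e1 ?X"
      have uf: "fibration ?u" "fst ?u = Idn C ?X" using unit_fib_fibration[OF e X] by simp_all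
      have xm: "fib_mor ?u a b x0" unfolding unit_fib_def x0_def
        by (rule fib_morI) (use S F E X A(6,8,9,17,18,21,22,23) in simp_all)
      have ym: "fib_mor x b c y0" unfolding x y0_def by (rule fib_morI) (use S F A(4,15) in simp_all)
      have mor: "fib_mor (comp_fib m0 m1 ?u x) a c (FG P J \<cdot> HF P J, FA P J \<cdot> HF P J, GC P J)"
        unfolding eq[symmetric]
        by (rule comp_fib_mor[OF m x0 y0 c0 uf(1) _ _ xm ym]) (use fx F uf x in simp_all)
      have ba: "HF P J \<cdot> a = b" using S X by simp
      have "fib_mor x a c (FG P J \<cdot> HF P J, FA P J \<cdot> HF P J, GC P J)"
        unfolding x
        by (rule fib_morI) (use S F A(4,5,7,9,15,19,23) X ba in simp_all)
      then show "comp_fib m0 m1 (unit_fib e0 e1 (Dom C (fst x))) x = x"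
        using fib_mor_unique[OF mor, of x] comp_fib_fibration(2)[OF m, of ?u x] fx F uf x by simp
    qed
  qed
qed

text \<open>The sources and targets of all cells in the monad equations are fixed, so the equations
  concern the underlying pairs of arrows only.\<close>

lemma monad_iff:
  "is_monad (Poly C) T P \<eta> \<mu> \<longleftrightarrow>
    (\<exists>e0 e1 m0 m1. \<eta> = (J, (e0, e1), P) \<and> \<mu> = (PP, (m0, m1), P) \<and> fib_algebra e0 e1 m0 m1)"
proof -
  let ?i = "(P, (Idn C (Dom C p), Idn C (Cod C p)), P)"
  have eta: "\<eta> \<in> hom (poly_hom C T T) J P \<longleftrightarrow> (\<exists>e0 e1. \<eta> = (J, (e0, e1), P) \<and> unit_square e0 e1)" (is "?l \<longleftrightarrow> ?r")
  proof
    assume ?l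
    then have "source \<eta> = J" "target \<eta> = P" "is_pullback C p (snd (label \<eta>)) (fst (label \<eta>)) (Idn C T)"
      by (simp_all add: poly_hom_def split_beta)
    then show ?r unfolding unit_square_def by (metis prod.collapse)
  next
    assume ?r
    then obtain e0 e1 where e: "\<eta> = (J, (e0, e1), P)" "unit_square e0 e1" by blast
    note E = unit_squareD[OF e(2)]
    have "to_terminal C (Dom C p) \<cdot> e0 = Idn C T" "to_terminal C (Cod C p) \<cdot> e1 = Idn C T"
      by (rule terminal_unique; use E in simp)+
    then show ?l using e J_poly[OF e(2)] P_poly E by (simp add: poly_hom_def hom_iff unit_square_def)
  qed
  have mu: "\<mu> \<in> hom (poly_hom C T T) PP P \<longleftrightarrow> (\<exists>m0 m1. \<mu> = (PP, (m0, m1), P) \<and> mult_square m0 m1)" (is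
      "?l \<longleftrightarrow> ?r")
  proof
    assume ?l
    then have "source \<mu> = PP" "target \<mu> = P" "is_pullback C p (snd (label \<mu>)) (fst (label \<mu>)) (pmid PP)"
      by (simp_all add: poly_hom_def split_beta)
    then show ?r unfolding mult_square_def by (metis prod.collapse)
  next
    assume ?r
    then obtain m0 m1 where e: "\<mu> = (PP, (m0, m1), P)" "mult_square m0 m1" by blast
    note E = pullbackD[OF e(2)[unfolded mult_square_def]]
    note PD = polynomialsD[OF PP_poly]
    have "to_terminal C (Dom C p) \<cdot> m0 = pleft PP" "to_terminal C (Cod C p) \<cdot> m1 = pright PP"
      by (rule terminal_unique; use E PD in simp)+
    then show ?l using e PP_poly P_poly E PD by (simp add: poly_hom_def hom_iff mult_square_def)
  qed
  have eq: "\<mu> \<cdot>\<^bsub>poly_hom C T T\<^esub> poly_hcomp C \<mu> ?i =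
      \<mu> \<cdot>\<^bsub>poly_hom C T T\<^esub> poly_hcomp C ?i \<mu> \<cdot>\<^bsub>poly_hom C T T\<^esub> poly_assoc C P P P \<and>
      \<mu> \<cdot>\<^bsub>poly_hom C T T\<^esub> poly_hcomp C \<eta> ?i = poly_lunit C P \<and>
      \<mu> \<cdot>\<^bsub>poly_hom C T T\<^esub> poly_hcomp C ?i \<eta> = poly_runit C P \<longleftrightarrow> fib_algebra e0 e1 m0 m1"
    if em: "\<eta> = (J, (e0, e1), P)" "\<mu> = (PP, (m0, m1), P)" "unit_square e0 e1"
        "mult_square m0 m1" for e0 e1 m0 m1
  proof -
    have src: "source (poly_hcomp C (q, b, q') (r, a, r')) = poly_comp C q r" for q b q' r a r'
      by (simp add: poly_hcomp_def Let_def split_beta)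
    have s2: "source (poly_assoc C P P P) = poly_comp C PP P" "source (poly_lunit C P) = poly_comp C J P"
      "target (poly_lunit C P) = P" "source (poly_runit C P) = poly_comp C P J" "target (poly_runit C P) = P"
      by (simp_all add: poly_assoc_def poly_lunit_def poly_runit_def Let_def split_beta)
    show ?thesis
      unfolding fib_algebra_def assoc_universal[OF em(4)] unit_law_left[OF em(3,4)] unit_law_right[OF em(3,4)]
      by (auto simp: em poly_hom_def src s2 prod_eq_iff pair_comp_def split_beta)
  qed
  have "is_monad (Poly C) T P \<eta> \<mu> \<longleftrightarrow> \<eta> \<in> hom (poly_hom C T T) J P \<and> \<mu> \<in> hom (poly_hom C T T) PP P \<and>
    \<mu> \<cdot>\<^bsub>poly_hom C T T\<^esub> poly_hcomp C \<mu> ?i =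
        \<mu> \<cdot>\<^bsub>poly_hom C T T\<^esub> poly_hcomp C ?i \<mu> \<cdot>\<^bsub>poly_hom C T T\<^esub> poly_assoc C P P P \<and>
      \<mu> \<cdot>\<^bsub>poly_hom C T T\<^esub> poly_hcomp C \<eta> ?i = poly_lunit C P \<and>
      \<mu> \<cdot>\<^bsub>poly_hom C T T\<^esub> poly_hcomp C ?i \<eta> = poly_runit C P"
    using P_poly by (auto simp: is_monad_def Poly_def Let_def poly_hom_def)
  then show ?thesis unfolding eta mu using eq unfolding fib_algebra_def by blast
qed

end

section \<open>The double category of squares\<close>

lemma functorI:
  assumes "FObj F \<in> extensional (Obj C)" "FArr F \<in> extensional (Arr C)"
    and "\<And>x. x \<in> Obj C \<Longrightarrow> FObj F x \<in> Obj D"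
    and "\<And>f. f \<in> Arr C \<Longrightarrow> FArr F f \<in> Arr D \<and> Dom D (FArr F f) = FObj F (Dom C f) \<and> Cod D (FArr F f) =
        FObj F (Cod C f)"
    and "\<And>x. x \<in> Obj C \<Longrightarrow> FArr F (Idn C x) = Idn D (FObj F x)"
    and "\<And>f g. f \<in> Arr C \<Longrightarrow> g \<in> Arr C \<Longrightarrow> Cod C f = Dom C g \<Longrightarrow>
        FArr F (g \<cdot>\<^bsub>C\<^esub> f) = FArr F g \<cdot>\<^bsub>D\<^esub> FArr F f"
  shows "is_functor C D F"
  using assms unfolding is_functor_def by (auto simp: PiE_def)

lemma composable_pairs_mem:
  "(x, y) \<in> Obj (composable_pairs \<G>) \<longleftrightarrow>
     x \<in> Obj (Gr1 \<G>) \<and> y \<in> Obj (Gr1 \<G>) \<and> FObj (Tgt \<G>) x = FObj (Src \<G>) y"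
  "(\<alpha>, \<beta>) \<in> Arr (composable_pairs \<G>) \<longleftrightarrow>
     \<alpha> \<in> Arr (Gr1 \<G>) \<and> \<beta> \<in> Arr (Gr1 \<G>) \<and> FArr (Tgt \<G>) \<alpha> = FArr (Src \<G>) \<beta>"
  by (simp_all add: composable_pairs_def)

lemma composable_pairs_simps [simp]:
  "Dom (composable_pairs \<G>) (\<alpha>, \<beta>) = (Dom (Gr1 \<G>) \<alpha>, Dom (Gr1 \<G>) \<beta>)"
  "Cod (composable_pairs \<G>) (\<alpha>, \<beta>) = (Cod (Gr1 \<G>) \<alpha>, Cod (Gr1 \<G>) \<beta>)"
  "Idn (composable_pairs \<G>) (x, y) = (Idn (Gr1 \<G>) x, Idn (Gr1 \<G>) y)"
  "Comp (composable_pairs \<G>) (\<alpha>', \<beta>') (\<alpha>, \<beta>) = (Comp (Gr1 \<G>) \<alpha>' \<alpha>, Comp (Gr1 \<G>) \<beta>' \<beta>)"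
  by (simp_all add: composable_pairs_def pair_comp_def)

context categ begin

text \<open>The relation between the sides of a commutative square, in the form in which the arrows of
  both \<open>arrow_category C\<close> and the category of fibrations use it.\<close>

definition square :: "'m \<Rightarrow> 'm \<Rightarrow> 'm \<Rightarrow> 'm \<Rightarrow> bool" where
  "square f h k g \<longleftrightarrow> h \<in> hom C (Dom C f) (Dom C g) \<and> k \<in> hom C (Cod C f) (Cod C g) \<and> g \<cdot> h = k \<cdot> f"

lemma squareD:
  "square f h k g \<Longrightarrow> h \<in> Arr C" "square f h k g \<Longrightarrow> k \<in> Arr C" "square f h k g \<Longrightarrow> Dom C h = Dom C f"
  "square f h k g \<Longrightarrow> Cod C h = Dom C g" "square f h k g \<Longrightarrow> Dom C k = Cod C f"
  "square f h k g \<Longrightarrow> Cod C k = Cod C g" "square f h k g \<Longrightarrow> g \<cdot> h = k \<cdot> f"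
  by (simp_all add: square_def hom_iff)

lemma square_id: "f \<in> Arr C \<Longrightarrow> Dom C f = x \<Longrightarrow> Cod C f = y \<Longrightarrow> square f (Idn C x) (Idn C y) f"
  by (auto simp: square_def hom_iff)

lemma square_unit: "k \<in> Arr C \<Longrightarrow> square (Idn C (Dom C k)) k k (Idn C (Cod C k))"
  by (simp add: square_def hom_iff)

lemma square_comp:
  assumes "f \<in> Arr C" "g \<in> Arr C" "l \<in> Arr C" and a: "square f h k g" and b: "square g h' k' l"
  shows "square f (h' \<cdot> h) (k' \<cdot> k) l"
  using assms(1-3) squareD[OF a] squareD[OF b]
  by (simp add: square_def hom_iff comp_extend[OF squareD(7)[OF b]])

lemma square_comp':
  assumes "source \<alpha> \<in> Arr C" "target \<alpha> \<in> Arr C" "target \<beta> \<in> Arr C" "target \<alpha> = source \<beta>"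
    and "square (source \<alpha>) (fst (label \<alpha>)) (snd (label \<alpha>)) (target \<alpha>)"
    and "square (source \<beta>) (fst (label \<beta>)) (snd (label \<beta>)) (target \<beta>)"
  shows "square (source \<alpha>) (fst (label \<beta>) \<cdot> fst (label \<alpha>)) (snd (label \<beta>) \<cdot> snd (label \<alpha>)) (target \<beta>)"
  using assms square_comp by simp

lemma square_paste:
  assumes "f \<in> Arr C" "g \<in> Arr C" "f' \<in> Arr C" "g' \<in> Arr C" "Cod C f = Dom C f'" "Cod C g = Dom C g'"
    and a: "square f h k g" and b: "square f' k l g'"
  shows "square (f' \<cdot> f) h l (g' \<cdot> g)"
  using assms(1-6) squareD[OF a] squareD[OF b]
  by (simp add: square_def hom_iff comp_extend[OF squareD(7)[OF b]])

lemma arrow_category_simps [simp]: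
  "Obj (arrow_category C) = Arr C"
  "\<alpha> \<in> Arr (arrow_category C) \<longleftrightarrow> source \<alpha> \<in> Arr C \<and> target \<alpha> \<in> Arr C \<and>
     square (source \<alpha>) (fst (label \<alpha>)) (snd (label \<alpha>)) (target \<alpha>)"
  "Dom (arrow_category C) \<alpha> = source \<alpha>" "Cod (arrow_category C) \<alpha> = target \<alpha>"
  "Idn (arrow_category C) f = (f, (Idn C (Dom C f), Idn C (Cod C f)), f)"
  "Comp (arrow_category C) \<beta> \<alpha> = (source \<alpha>, (fst (label \<beta>) \<cdot> fst (label \<alpha>),
      snd (label \<beta>) \<cdot> snd (label \<alpha>)), target \<beta>)"
  by (simp_all add: arrow_category_def split_beta square_def pair_comp_def)

lemma arrow_category_category: "is_category (arrow_category C)"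
proof -
  have *: "arrow_category C = category_of (Arr C) (\<lambda>f h g. square f (fst h) (snd h) g)
     (\<lambda>f. (Idn C (Dom C f), Idn C (Cod C f))) (\<lambda>g f. (fst g \<cdot> fst f, snd g \<cdot> snd f))"
    by (simp add: arrow_category_def square_def case_prod_unfold pair_comp_def)
  show ?thesis unfolding *
    by (rule category_ofI) (simp_all add: square_id square_comp prod_eq_iff squareD)
qed

lemma squares_graph_simps [simp]:
  "Gr0 (squares_graph C) = C" "Gr1 (squares_graph C) = arrow_category C"
  "f \<in> Arr C \<Longrightarrow> FObj (Src (squares_graph C)) f = Dom C f"
  "f \<in> Arr C \<Longrightarrow> FObj (Tgt (squares_graph C)) f = Cod C f"
  "\<alpha> \<in> Arr (arrow_category C) \<Longrightarrow> FArr (Src (squares_graph C)) \<alpha> = fst (label \<alpha>)"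
  "\<alpha> \<in> Arr (arrow_category C) \<Longrightarrow> FArr (Tgt (squares_graph C)) \<alpha> = snd (label \<alpha>)"
  by (simp_all add: squares_graph_def)

lemma squares_pairs [simp]:
  "(f, g) \<in> Obj (composable_pairs (squares_graph C)) \<longleftrightarrow> f \<in> Arr C \<and> g \<in> Arr C \<and> Cod C f = Dom C g"
  "(\<alpha>, \<beta>) \<in> Arr (composable_pairs (squares_graph C)) \<longleftrightarrow>
     \<alpha> \<in> Arr (arrow_category C) \<and> \<beta> \<in> Arr (arrow_category C) \<and> snd (label \<alpha>) = fst (label \<beta>)"
  unfolding composable_pairs_mem by (auto simp del: arrow_category_simps(2))

lemma squares_graph_graph: "is_cat_graph (squares_graph C)"
  unfolding is_cat_graph_def
proof (intro conjI)
  show "is_functor (Gr1 (squares_graph C)) (Gr0 (squares_graph C)) (Src (squares_graph C))"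
    by (rule functorI) (simp_all add: square_id square_comp', auto simp: squares_graph_def dest: squareD)
  show "is_functor (Gr1 (squares_graph C)) (Gr0 (squares_graph C)) (Tgt (squares_graph C))"
    by (rule functorI) (simp_all add: square_id square_comp', auto simp: squares_graph_def dest: squareD)
qed (simp_all add: cat arrow_category_category)

lemma squares_unit_simps [simp]:
  "X \<in> Obj C \<Longrightarrow> FObj (squares_unit C) X = Idn C X"
  "k \<in> Arr C \<Longrightarrow> FArr (squares_unit C) k = (Idn C (Dom C k), (k, k), Idn C (Cod C k))"
  by (simp_all add: squares_unit_def)

lemma squares_comp_simps [simp]:
  "f \<in> Arr C \<Longrightarrow> g \<in> Arr C \<Longrightarrow> Cod C f = Dom C g \<Longrightarrow> FObj (squares_comp C) (f, g) = g \<cdot> f"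
  "\<alpha> \<in> Arr (arrow_category C) \<Longrightarrow> \<beta> \<in> Arr (arrow_category C) \<Longrightarrow> snd (label \<alpha>) = fst (label \<beta>) \<Longrightarrow>
    FArr (squares_comp C) (\<alpha>, \<beta>) =
      (source \<beta> \<cdot> source \<alpha>, (fst (label \<alpha>), snd (label \<beta>)), target \<beta> \<cdot> target \<alpha>)"
  by (simp_all add: squares_comp_def del: arrow_category_simps(2))

lemma square_meet:
  assumes "square f h k g" "square f' h' k' g'" "k = h'"
  shows "Cod C f = Dom C f'" "Cod C g = Dom C g'"
  using squareD[OF assms(1)] squareD[OF assms(2)] assms(3) by simp_all

lemma squares_double_category: "is_double_category (squares_graph C) (squares_unit C) (squares_comp C)"
  unfolding is_double_category_def
proof (intro conjI ballI)
  show "is_cat_graph (squares_graph C)" by (rule squares_graph_graph)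
  show "is_functor (Gr0 (squares_graph C)) (Gr1 (squares_graph C)) (squares_unit C)"
    by (rule functorI) (simp_all add: square_unit, simp_all add: squares_unit_def)
  show "is_functor (composable_pairs (squares_graph C)) (Gr1 (squares_graph C)) (squares_comp C)"
  proof (rule functorI)
    show "FObj (squares_comp C) \<in> extensional (Obj (composable_pairs (squares_graph C)))"
      "FArr (squares_comp C) \<in> extensional (Arr (composable_pairs (squares_graph C)))"
      by (simp_all add: squares_comp_def)
  next
    fix x assume "x \<in> Obj (composable_pairs (squares_graph C))"
    then show "FObj (squares_comp C) x \<in> Obj (Gr1 (squares_graph C))" by (cases x) simp
  next
    fix \<alpha> assume al: "\<alpha> \<in> Arr (composable_pairs (squares_graph C))"
    show "FArr (squares_comp C) \<alpha> \<in> Arr (Gr1 (squares_graph C)) \<and>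
         Dom (Gr1 (squares_graph C)) (FArr (squares_comp C) \<alpha>) =
         FObj (squares_comp C) (Dom (composable_pairs (squares_graph C)) \<alpha>) \<and>
         Cod (Gr1 (squares_graph C)) (FArr (squares_comp C) \<alpha>) =
         FObj (squares_comp C) (Cod (composable_pairs (squares_graph C)) \<alpha>)"
    proof -
      obtain \<beta> \<gamma> where Pair: "\<alpha> = (\<beta>, \<gamma>)" by (rule prod.exhaust)
      have m: "square (source \<beta>) (fst (label \<beta>)) (snd (label \<beta>)) (target \<beta>)"
         "square (source \<gamma>) (fst (label \<gamma>)) (snd (label \<gamma>)) (target \<gamma>)" "snd (label \<beta>) = fst (label \<gamma>)"
         "source \<beta> \<in> Arr C" "source \<gamma> \<in> Arr C" "target \<beta> \<in> Arr C" "target \<gamma> \<in> Arr C"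
        using al unfolding Pair squares_pairs arrow_category_simps by blast+
      note e = square_meet[OF m(1-3)]
      show ?thesis using m e square_paste[OF m(4,6,5,7) e m(1)] by (simp add: Pair)
    qed
  next
    fix x assume "x \<in> Obj (composable_pairs (squares_graph C))"
    then show "FArr (squares_comp C) (Idn (composable_pairs (squares_graph C)) x) =
         Idn (Gr1 (squares_graph C)) (FObj (squares_comp C) x)"
      by (cases x) (simp add: square_id)
  next
    fix \<alpha> \<beta> assume a: "\<alpha> \<in> Arr (composable_pairs (squares_graph C))"
      "\<beta> \<in> Arr (composable_pairs (squares_graph C))"
      "Cod (composable_pairs (squares_graph C)) \<alpha> = Dom (composable_pairs (squares_graph C)) \<beta>"
    show "FArr (squares_comp C) (\<beta> \<cdot>\<^bsub>composable_pairs (squares_graph C)\<^esub> \<alpha>) =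
         FArr (squares_comp C) \<beta> \<cdot>\<^bsub>Gr1 (squares_graph C)\<^esub> FArr (squares_comp C) \<alpha>"
    proof -
      obtain \<alpha>1 \<alpha>2 \<beta>1 \<beta>2 where Pair: "\<alpha> = (\<alpha>1, \<alpha>2)" "\<beta> = (\<beta>1, \<beta>2)" by (metis prod.exhaust)
      have m: "\<alpha>1 \<in> Arr (arrow_category C)" "\<alpha>2 \<in> Arr (arrow_category C)" "\<beta>1 \<in> Arr (arrow_category C)"
        "\<beta>2 \<in> Arr (arrow_category C)" "snd (label \<alpha>1) = fst (label \<alpha>2)" "snd (label \<beta>1) = fst (label \<beta>2)"
        "target \<alpha>1 = source \<beta>1" "target \<alpha>2 = source \<beta>2"
        using a unfolding Pair by (simp_all del: arrow_category_simps(2))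
      interpret A: categ "arrow_category C" by standard (rule arrow_category_category)
      have "\<beta>1 \<cdot>\<^bsub>arrow_category C\<^esub> \<alpha>1 \<in> Arr (arrow_category C)"
          "\<beta>2 \<cdot>\<^bsub>arrow_category C\<^esub> \<alpha>2 \<in> Arr (arrow_category C)"
        by (rule A.comp_simps(1); use m in \<open>simp del: arrow_category_simps(2)\<close>)+
      then show ?thesis using m unfolding Pair by (simp del: arrow_category_simps(2))
    qed
  qed
next
  fix a assume "a \<in> Obj (Gr0 (squares_graph C))"
  then show "FObj (Src (squares_graph C)) (FObj (squares_unit C) a) = a"
    "FObj (Tgt (squares_graph C)) (FObj (squares_unit C) a) = a" by simp_all
next
  fix k assume "k \<in> Arr (Gr0 (squares_graph C))"
  then show "FArr (Src (squares_graph C)) (FArr (squares_unit C) k) = k"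
      "FArr (Tgt (squares_graph C)) (FArr (squares_unit C) k) = k"
    by (simp_all add: square_unit)
next
  fix x assume "x \<in> Obj (composable_pairs (squares_graph C))"
  then show "case x of (x, y) \<Rightarrow> FObj (Src (squares_graph C)) (FObj (squares_comp C) (x, y)) =
      FObj (Src (squares_graph C)) x \<and>
              FObj (Tgt (squares_graph C)) (FObj (squares_comp C) (x, y)) = FObj (Tgt (squares_graph C)) y"
    by (cases x) simp
next
  fix \<alpha> assume al: "\<alpha> \<in> Arr (composable_pairs (squares_graph C))"
  show "case \<alpha> of (\<alpha>, \<beta>) \<Rightarrow> FArr (Src (squares_graph C)) (FArr (squares_comp C) (\<alpha>, \<beta>)) =
      FArr (Src (squares_graph C)) \<alpha> \<and>
              FArr (Tgt (squares_graph C)) (FArr (squares_comp C) (\<alpha>, \<beta>)) = FArr (Tgt (squares_graph C)) \<beta>"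
  proof -
    obtain \<beta> \<gamma> where Pair: "\<alpha> = (\<beta>, \<gamma>)" by (rule prod.exhaust)
    have m: "square (source \<beta>) (fst (label \<beta>)) (snd (label \<beta>)) (target \<beta>)"
       "square (source \<gamma>) (fst (label \<gamma>)) (snd (label \<gamma>)) (target \<gamma>)" "snd (label \<beta>) = fst (label \<gamma>)"
       "source \<beta> \<in> Arr C" "source \<gamma> \<in> Arr C" "target \<beta> \<in> Arr C" "target \<gamma> \<in> Arr C"
      using al unfolding Pair squares_pairs arrow_category_simps by blast+
    note e = square_meet[OF m(1-3)]
    show ?thesis using m e square_paste[OF m(4,6,5,7) e m(1)] by (simp add: Pair)
  qed
next
  fix x assume "x \<in> Obj (Gr1 (squares_graph C))"
  then show "FObj (squares_comp C) (FObj (squares_unit C) (FObj (Src (squares_graph C)) x), x) = x"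
    "FObj (squares_comp C) (x, FObj (squares_unit C) (FObj (Tgt (squares_graph C)) x)) = x" by simp_all
next
  fix \<alpha> assume a: "\<alpha> \<in> Arr (Gr1 (squares_graph C))"
  then have m: "square (source \<alpha>) (fst (label \<alpha>)) (snd (label \<alpha>)) (target \<alpha>)" "source \<alpha> \<in> Arr C"
      "target \<alpha> \<in> Arr C"
    by simp_all
  note D = squareD[OF m(1)]
  have "square (Idn C (Dom C (source \<alpha>))) (fst (label \<alpha>)) (fst (label \<alpha>)) (Idn C (Dom C (target \<alpha>)))"
    using square_unit[OF D(1)] D by simp
  then show "FArr (squares_comp C) (FArr (squares_unit C) (FArr (Src (squares_graph C)) \<alpha>), \<alpha>) = \<alpha>"
    using a m D by (simp add: prod_eq_iff)
  have "square (Idn C (Cod C (source \<alpha>))) (snd (label \<alpha>)) (snd (label \<alpha>)) (Idn C (Cod C (target \<alpha>)))"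
    using square_unit[OF D(2)] D by simp
  then show "FArr (squares_comp C) (\<alpha>, FArr (squares_unit C) (FArr (Tgt (squares_graph C)) \<alpha>)) = \<alpha>"
    using a m D by (simp add: prod_eq_iff)
next
  show "\<forall>x y z. (x, y) \<in> Obj (composable_pairs (squares_graph C)) \<and> (y,
      z) \<in> Obj (composable_pairs (squares_graph C)) \<longrightarrow>
       FObj (squares_comp C) (FObj (squares_comp C) (x, y), z) = FObj (squares_comp C) (x,
           FObj (squares_comp C) (y, z))"
    by simp
  show "\<forall>\<alpha> \<beta> \<gamma>. (\<alpha>, \<beta>) \<in> Arr (composable_pairs (squares_graph C)) \<and> (\<beta>,
      \<gamma>) \<in> Arr (composable_pairs (squares_graph C)) \<longrightarrow>
       FArr (squares_comp C) (FArr (squares_comp C) (\<alpha>, \<beta>), \<gamma>) = FArr (squares_comp C) (\<alpha>,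
           FArr (squares_comp C) (\<beta>, \<gamma>))"
  proof (intro allI impI)
    fix \<alpha> \<beta> \<gamma> assume a: "(\<alpha>, \<beta>) \<in> Arr (composable_pairs (squares_graph C)) \<and> (\<beta>,
        \<gamma>) \<in> Arr (composable_pairs (squares_graph C))"
    have m: "square (source \<alpha>) (fst (label \<alpha>)) (snd (label \<alpha>)) (target \<alpha>)"
       "square (source \<beta>) (fst (label \<beta>)) (snd (label \<beta>)) (target \<beta>)"
       "square (source \<gamma>) (fst (label \<gamma>)) (snd (label \<gamma>)) (target \<gamma>)" "snd (label \<alpha>) = fst (label \<beta>)"
           "snd (label \<beta>) = fst (label \<gamma>)"
       "source \<alpha> \<in> Arr C" "target \<alpha> \<in> Arr C"  "source \<beta> \<in> Arr C" "target \<beta> \<in> Arr C" "source \<gamma> \<in> Arr C"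
           "target \<gamma> \<in> Arr C"
      using a unfolding squares_pairs arrow_category_simps by blast+
    note e = square_meet[OF m(1,2,4)] square_meet[OF m(2,3,5)]
    have "square (source \<beta> \<cdot> source \<alpha>) (fst (label \<alpha>)) (snd (label \<beta>)) (target \<beta> \<cdot> target \<alpha>)"
      by (rule square_paste[where k = "snd (label \<alpha>)"]) (use m e in simp_all)
    moreover have "square (source \<gamma> \<cdot> source \<beta>) (fst (label \<beta>)) (snd (label \<gamma>)) (target \<gamma> \<cdot> target \<beta>)"
      by (rule square_paste[where k = "snd (label \<beta>)"]) (use m e in simp_all)
    ultimately show "FArr (squares_comp C) (FArr (squares_comp C) (\<alpha>, \<beta>), \<gamma>) = FArr (squares_comp C) (\<alpha>,
        FArr (squares_comp C) (\<beta>, \<gamma>))"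
      using m e by simp
  qed
qed

end

section \<open>Double category structures on fibrations\<close>

lemma functor_eqI:
  assumes F: "is_functor C D F" and G: "is_functor C D G"
    and "\<And>x. x \<in> Obj C \<Longrightarrow> FObj F x = FObj G x" "\<And>f. f \<in> Arr C \<Longrightarrow> FArr F f = FArr G f"
  shows "F = G"
proof (rule funct.equality)
  show "FObj F = FObj G"
    by (rule PiE_ext[where k = "Obj C" and s = "\<lambda>_. Obj D"]) (use F G assms(3) in \<open>auto simp: is_functor_def\<close>)
  show "FArr F = FArr G"
    by (rule PiE_ext[where k = "Arr C" and s = "\<lambda>_. Arr D"]) (use F G assms(4) in \<open>auto simp: is_functor_def\<close>)
qed simp

lemma functor_arrowD:
  assumes "is_functor C D F" "f \<in> Arr C"
  shows "FArr F f \<in> Arr D" "Dom D (FArr F f) = FObj F (Dom C f)" "Cod D (FArr F f) = FObj F (Cod C f)"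
  using assms by (auto simp: is_functor_def)

context exponentiable_arrow begin

abbreviation "Fib \<equiv> fibration_category C p"
abbreviation "FibGraph \<equiv> fibration_graph C p"
abbreviation "FibPairs \<equiv> composable_pairs FibGraph"

lemma fibration_arr: "fibration x \<Longrightarrow> fst x \<in> Arr C"
  by (auto simp: fibration_def split_beta dest: pullbackD)

lemma fib_mor_square: "fib_mor x i j y \<Longrightarrow> square (fst x) i j (fst y)"
  by (simp add: fib_mor_def square_def split_beta)

lemma fib_mor_iff:
  "fib_mor x i j y \<longleftrightarrow> square (fst x) i j (fst y) \<and> fst (snd y) \<cdot> i = fst (snd x) \<and> snd (snd y) \<cdot> j =
      snd (snd x)"
  by (auto simp: fib_mor_def square_def split_beta)

lemma fib_mor_id: "fibration x \<Longrightarrow> fib_mor x (Idn C (Dom C (fst x))) (Idn C (Cod C (fst x))) x"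
  using fibrationD[of "fst x" "fst (snd x)" "snd (snd x)"] by (simp add: fib_mor_iff square_id)

lemma fib_mor_comp:
  assumes x: "fibration x" and y: "fibration y" and z: "fibration z"
    and a: "fib_mor x i j y" and b: "fib_mor y k l z"
  shows "fib_mor x (k \<cdot> i) (l \<cdot> j) z"
proof -
  have e: "fst (snd z) \<cdot> k = fst (snd y)" "snd (snd z) \<cdot> l = snd (snd y)"
     "fst (snd y) \<cdot> i = fst (snd x)" "snd (snd y) \<cdot> j = snd (snd x)" using a b by (simp_all add: fib_mor_iff)
  note s = fib_mor_square[OF a] fib_mor_square[OF b]
  note X = fibrationD[of "fst x" "fst (snd x)" "snd (snd x)"] fibrationD[of "fst y" "fst (snd y)"
      "snd (snd y)"]
    fibrationD[of "fst z" "fst (snd z)" "snd (snd z)"]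
  note S = squareD[OF s(1)] squareD[OF s(2)]
  have "square (fst x) (k \<cdot> i) (l \<cdot> j) (fst z)"
    by (rule square_comp[OF _ _ _ s]) (use fibration_arr x y z in simp_all)
  then show ?thesis using X x y z S e(3,4)
    by (simp add: fib_mor_iff comp_extend1[OF e(1)] comp_extend1[OF e(2)])
qed

lemma Fib_simps [simp]:
  "x \<in> Obj Fib \<longleftrightarrow> fibration x"
  "Dom Fib \<alpha> = source \<alpha>" "Cod Fib \<alpha> = target \<alpha>"
  "Idn Fib x = (x, (Idn C (Dom C (fst x)), Idn C (Cod C (fst x))), x)"
  "Comp Fib \<beta> \<alpha> = (source \<alpha>, (fst (label \<beta>) \<cdot> fst (label \<alpha>), snd (label \<beta>) \<cdot> snd (label \<alpha>)), target \<beta>)"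
  by (simp_all add: fibration_category_def fibration_def split_beta pair_comp_def)

lemma Fib_arr:
  "\<alpha> \<in> Arr Fib \<longleftrightarrow> fibration (source \<alpha>) \<and> fibration (target \<alpha>) \<and>
     fib_mor (source \<alpha>) (fst (label \<alpha>)) (snd (label \<alpha>)) (target \<alpha>)"
  by (simp add: fibration_category_def split_beta fib_mor_def fibration_def)

lemma Fib_arrD:
  assumes "\<alpha> \<in> Arr Fib"
  shows "fibration (source \<alpha>)" "fibration (target \<alpha>)"
     "fib_mor (source \<alpha>) (fst (label \<alpha>)) (snd (label \<alpha>)) (target \<alpha>)"
     "fst (label \<alpha>) \<in> Arr C" "snd (label \<alpha>) \<in> Arr C" "Dom C (fst (label \<alpha>)) = Dom C (fst (source \<alpha>))"
     "Cod C (fst (label \<alpha>)) = Dom C (fst (target \<alpha>))" "Dom C (snd (label \<alpha>)) = Cod C (fst (source \<alpha>))"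
     "Cod C (snd (label \<alpha>)) = Cod C (fst (target \<alpha>))"
     "fst (source \<alpha>) \<in> Arr C" "fst (target \<alpha>) \<in> Arr C"
proof -
  show 1: "fibration (source \<alpha>)" "fibration (target \<alpha>)"
     "fib_mor (source \<alpha>) (fst (label \<alpha>)) (snd (label \<alpha>)) (target \<alpha>)" using assms by (simp_all add: Fib_arr)
  from squareD[OF fib_mor_square[OF 1(3)]]
  show  "fst (label \<alpha>) \<in> Arr C" "snd (label \<alpha>) \<in> Arr C" "Dom C (fst (label \<alpha>)) = Dom C (fst (source \<alpha>))"
     "Cod C (fst (label \<alpha>)) = Dom C (fst (target \<alpha>))" "Dom C (snd (label \<alpha>)) = Cod C (fst (source \<alpha>))"
     "Cod C (snd (label \<alpha>)) = Cod C (fst (target \<alpha>))" by simp_all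
  show "fst (source \<alpha>) \<in> Arr C" "fst (target \<alpha>) \<in> Arr C" using 1 fibration_arr by simp_all
qed

lemma Fib_category: "is_category Fib"
proof -
  have *: "Fib = category_of (Collect fibration) (\<lambda>x h y. fib_mor x (fst h) (snd h) y)
     (\<lambda>x. (Idn C (Dom C (fst x)), Idn C (Cod C (fst x)))) (\<lambda>g f. (fst g \<cdot> fst f, snd g \<cdot> snd f))"
    by (simp add: fibration_category_def fib_mor_def fibration_def case_prod_unfold pair_comp_def)
  have a: "f \<in> Arr C" "g \<in> Arr C" "Dom C f = Dom C (fst x)" "Cod C f = Dom C (fst y)" "Dom C g =
      Cod C (fst x)" "Cod C g = Cod C (fst y)"
    if "fib_mor x f g y" for x f g y using squareD[OF fib_mor_square[OF that]] by simp_all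
  show ?thesis unfolding *
    by (rule category_ofI) (simp_all add: fib_mor_id prod_eq_iff a, blast intro: fib_mor_comp)
qed

lemma FibGraph_simps [simp]:
  "Gr0 FibGraph = C" "Gr1 FibGraph = Fib"
  "fibration x \<Longrightarrow> FObj (Src FibGraph) x = Dom C (fst x)" "fibration x \<Longrightarrow> FObj (Tgt FibGraph) x = Cod C (fst x)"
  "\<alpha> \<in> Arr Fib \<Longrightarrow> FArr (Src FibGraph) \<alpha> = fst (label \<alpha>)" "\<alpha> \<in> Arr Fib \<Longrightarrow> FArr (Tgt FibGraph) \<alpha> = snd (label \<alpha>)"
  by (simp_all add: fibration_graph_def)

lemma FibPairs_mem [simp]:
  "(x, y) \<in> Obj FibPairs \<longleftrightarrow> fibration x \<and> fibration y \<and> Cod C (fst x) = Dom C (fst y)"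
  "(\<alpha>, \<beta>) \<in> Arr FibPairs \<longleftrightarrow> \<alpha> \<in> Arr Fib \<and> \<beta> \<in> Arr Fib \<and> snd (label \<alpha>) = fst (label \<beta>)"
  unfolding composable_pairs_mem by auto

lemma FibPairs_arr_meet:
  assumes "\<alpha> \<in> Arr Fib" "\<beta> \<in> Arr Fib" "snd (label \<alpha>) = fst (label \<beta>)"
  shows "Cod C (fst (source \<alpha>)) = Dom C (fst (source \<beta>))" "Cod C (fst (target \<alpha>)) = Dom C (fst (target \<beta>))"
  using Fib_arrD[OF assms(1)] Fib_arrD[OF assms(2)] assms(3) by simp_all

lemma Fib_idn_arr [simp]:
  "fibration x \<Longrightarrow> Dom C (fst x) = X \<Longrightarrow> Cod C (fst x) = Y \<Longrightarrow> (x, (Idn C X, Idn C Y), x) \<in> Arr Fib"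
  using fib_mor_id[of x] by (auto simp: Fib_arr)

lemma Fib_comp_arr [simp]:
  assumes "\<alpha> \<in> Arr Fib" "\<beta> \<in> Arr Fib" "target \<alpha> = source \<beta>"
  shows "(source \<alpha>, (fst (label \<beta>) \<cdot> fst (label \<alpha>), snd (label \<beta>) \<cdot> snd (label \<alpha>)), target \<beta>) \<in> Arr Fib"
  using assms fib_mor_comp[of "source \<alpha>" "target \<alpha>" "target \<beta>"] by (simp add: Fib_arr)

lemma FibGraph_graph: "is_cat_graph FibGraph"
  unfolding is_cat_graph_def
proof (intro conjI)
  show "is_functor (Gr1 FibGraph) (Gr0 FibGraph) (Src FibGraph)"
    by (rule functorI) (simp_all add: Fib_arrD fibration_arr, simp_all add: fibration_graph_def)
  show "is_functor (Gr1 FibGraph) (Gr0 FibGraph) (Tgt FibGraph)"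
    by (rule functorI) (simp_all add: Fib_arrD fibration_arr, simp_all add: fibration_graph_def)
qed (simp_all add: cat Fib_category)

definition unit_functor :: "'m \<Rightarrow> 'm \<Rightarrow> ('o, 'm, 'm fib, 'm fib_arrow) funct" where
  "unit_functor e0 e1 =
     \<lparr>FObj = \<lambda>X\<in>Obj C. unit_fib e0 e1 X,
      FArr = \<lambda>k\<in>Arr C. (unit_fib e0 e1 (Dom C k), (k, k), unit_fib e0 e1 (Cod C k))\<rparr>"

definition comp_functor :: "'m \<Rightarrow> 'm \<Rightarrow>
  ('m fib \<times> 'm fib, 'm fib_arrow \<times> 'm fib_arrow, 'm fib, 'm fib_arrow) funct" where
  "comp_functor m0 m1 =
     \<lparr>FObj = \<lambda>(x, y)\<in>Obj FibPairs. comp_fib m0 m1 x y,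
      FArr = \<lambda>(\<alpha>, \<beta>)\<in>Arr FibPairs. (comp_fib m0 m1 (source \<alpha>) (source \<beta>),
        (fst (label \<alpha>), snd (label \<beta>)), comp_fib m0 m1 (target \<alpha>) (target \<beta>))\<rparr>"

lemma unit_functor_simps [simp]:
  "X \<in> Obj C \<Longrightarrow> FObj (unit_functor e0 e1) X = unit_fib e0 e1 X"
  "k \<in> Arr C \<Longrightarrow> FArr (unit_functor e0 e1) k = (unit_fib e0 e1 (Dom C k), (k, k), unit_fib e0 e1 (Cod C k))"
  by (simp_all add: unit_functor_def)

lemma comp_functor_simps [simp]:
  "fibration x \<Longrightarrow> fibration y \<Longrightarrow> Cod C (fst x) = Dom C (fst y) \<Longrightarrow>
    FObj (comp_functor m0 m1) (x, y) = comp_fib m0 m1 x y"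
  "\<alpha> \<in> Arr Fib \<Longrightarrow> \<beta> \<in> Arr Fib \<Longrightarrow> snd (label \<alpha>) = fst (label \<beta>) \<Longrightarrow>
    FArr (comp_functor m0 m1) (\<alpha>, \<beta>) = (comp_fib m0 m1 (source \<alpha>) (source \<beta>),
        (fst (label \<alpha>), snd (label \<beta>)), comp_fib m0 m1 (target \<alpha>) (target \<beta>))"
  by (simp_all add: comp_functor_def)

lemma unit_arr:
  assumes "unit_square e0 e1" "k \<in> Arr C"
  shows "(unit_fib e0 e1 (Dom C k), (k, k), unit_fib e0 e1 (Cod C k)) \<in> Arr Fib"
  using assms by (simp add: Fib_arr unit_fib_fibration unit_fib_mor)

lemma comp_arr:
  assumes "mult_square m0 m1" "\<alpha> \<in> Arr Fib" "\<beta> \<in> Arr Fib" "snd (label \<alpha>) = fst (label \<beta>)"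
  shows "(comp_fib m0 m1 (source \<alpha>) (source \<beta>), (fst (label \<alpha>), snd (label \<beta>)),
     comp_fib m0 m1 (target \<alpha>) (target \<beta>)) \<in> Arr Fib"
proof -
  note A = Fib_arrD[OF assms(2)] and B = Fib_arrD[OF assms(3)] and e = FibPairs_arr_meet[OF assms(2-4)]
  have "fib_mor (comp_fib m0 m1 (source \<alpha>) (source \<beta>)) (fst (label \<alpha>)) (snd (label \<beta>)) (comp_fib m0 m1
      (target \<alpha>) (target \<beta>))"
    by (rule comp_fib_mor[OF assms(1) A(2) B(2) e(2) A(1) B(1) e(1) A(3) B(3)[folded assms(4)]])
  then show ?thesis using comp_fib_fibration(1)[OF assms(1)] A B e by (simp add: Fib_arr)
qed

lemma unit_functor_functor: "unit_square e0 e1 \<Longrightarrow> is_functor C Fib (unit_functor e0 e1)"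
  by (rule functorI) (simp_all add: unit_arr unit_fib_fibration, simp_all add: unit_functor_def)

lemma comp_functor_functor:
  assumes m: "mult_square m0 m1"
  shows "is_functor FibPairs Fib (comp_functor m0 m1)"
proof (rule functorI)
  show "FObj (comp_functor m0 m1) \<in> extensional (Obj FibPairs)"
      "FArr (comp_functor m0 m1) \<in> extensional (Arr FibPairs)"
    by (simp_all add: comp_functor_def)
next
  fix x assume x: "x \<in> Obj FibPairs"
  obtain y z where yz: "x = (y, z)" by (rule prod.exhaust)
  show "FObj (comp_functor m0 m1) x \<in> Obj Fib" using x comp_fib_fibration(1)[OF m] unfolding yz by auto
  show "FArr (comp_functor m0 m1) (Idn FibPairs x) = Idn Fib (FObj (comp_functor m0 m1) x)"
    using x comp_fib_fibration(2)[OF m, of y z] fibration_arr[of y] fibration_arr[of z] unfolding yz by auto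
next
  fix \<alpha> assume a: "\<alpha> \<in> Arr FibPairs"
  obtain \<beta> \<gamma> where bc: "\<alpha> = (\<beta>, \<gamma>)" by (rule prod.exhaust)
  have m': "\<beta> \<in> Arr Fib" "\<gamma> \<in> Arr Fib" "snd (label \<beta>) = fst (label \<gamma>)" using a unfolding bc by simp_all
  show "FArr (comp_functor m0 m1) \<alpha> \<in> Arr Fib \<and>
     Dom Fib (FArr (comp_functor m0 m1) \<alpha>) = FObj (comp_functor m0 m1) (Dom FibPairs \<alpha>) \<and>
     Cod Fib (FArr (comp_functor m0 m1) \<alpha>) = FObj (comp_functor m0 m1) (Cod FibPairs \<alpha>)"
    using m' comp_arr[OF m m'] FibPairs_arr_meet[OF m'] Fib_arrD[OF m'(1)] Fib_arrD[OF m'(2)] unfolding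
        bc by simp
next
  fix \<alpha> \<beta> assume a: "\<alpha> \<in> Arr FibPairs" "\<beta> \<in> Arr FibPairs" "Cod FibPairs \<alpha> = Dom FibPairs \<beta>"
  obtain \<alpha>1 \<alpha>2 where Pa: "\<alpha> = (\<alpha>1, \<alpha>2)" by (rule prod.exhaust)
  obtain \<beta>1 \<beta>2 where Pb: "\<beta> = (\<beta>1, \<beta>2)" by (rule prod.exhaust)
  have m': "\<alpha>1 \<in> Arr Fib" "\<alpha>2 \<in> Arr Fib" "snd (label \<alpha>1) = fst (label \<alpha>2)"
      "\<beta>1 \<in> Arr Fib" "\<beta>2 \<in> Arr Fib" "snd (label \<beta>1) = fst (label \<beta>2)"
      "target \<alpha>1 = source \<beta>1" "target \<alpha>2 = source \<beta>2"
    using a unfolding Pa Pb by simp_all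
  have c: "(source \<alpha>1, (fst (label \<beta>1) \<cdot> fst (label \<alpha>1), snd (label \<beta>1) \<cdot> snd (label \<alpha>1)),
      target \<beta>1) \<in> Arr Fib"
     "(source \<alpha>2, (fst (label \<beta>2) \<cdot> fst (label \<alpha>2), snd (label \<beta>2) \<cdot> snd (label \<alpha>2)), target \<beta>2) \<in> Arr Fib"
    by (rule Fib_comp_arr; use m' in simp)+
  show "FArr (comp_functor m0 m1) (\<beta> \<cdot>\<^bsub>FibPairs\<^esub> \<alpha>) =
      FArr (comp_functor m0 m1) \<beta> \<cdot>\<^bsub>Fib\<^esub> FArr (comp_functor m0 m1) \<alpha>"
    using m' unfolding Pa Pb by (simp add: c[unfolded m'(3,6)] c)
qed

text \<open>The laws of \<open>fib_algebra\<close> give the axioms on objects. On arrows, both sides of each axiom have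
  the same pair of vertical arrows, and their sources and targets agree by the axioms on objects.\<close>

lemma fib_algebra_double_category:
  assumes alg: "fib_algebra e0 e1 m0 m1"
  shows "is_double_category FibGraph (unit_functor e0 e1) (comp_functor m0 m1)"
proof -
  have e: "unit_square e0 e1" and m: "mult_square m0 m1"
    and ur: "\<And>x. fibration x \<Longrightarrow> comp_fib m0 m1 x (unit_fib e0 e1 (Cod C (fst x))) = x"
    and ul: "\<And>x. fibration x \<Longrightarrow> comp_fib m0 m1 (unit_fib e0 e1 (Dom C (fst x))) x = x"
    and as: "\<And>x y z. fibration x \<Longrightarrow> fibration y \<Longrightarrow> fibration z \<Longrightarrow> Cod C (fst x) = Dom C (fst y) \<Longrightarrow>
        Cod C (fst y) = Dom C (fst z) \<Longrightarrow>
        comp_fib m0 m1 (comp_fib m0 m1 x y) z = comp_fib m0 m1 x (comp_fib m0 m1 y z)"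
    using alg unfolding fib_algebra_def by blast+
  note uf = unit_fib_fibration[OF e] and ua = unit_arr[OF e] and cf = comp_fib_fibration[OF m] and ca =
      comp_arr[OF m]
  show ?thesis
    unfolding is_double_category_def
  proof (intro conjI ballI allI impI)
    show "is_cat_graph FibGraph" by (rule FibGraph_graph)
    show "is_functor (Gr0 FibGraph) (Gr1 FibGraph) (unit_functor e0 e1)" using unit_functor_functor[OF
        e] by simp
    show "is_functor FibPairs (Gr1 FibGraph) (comp_functor m0 m1)" using comp_functor_functor[OF m] by simp
  next
    fix a assume "a \<in> Obj (Gr0 FibGraph)"
    then show "FObj (Src FibGraph) (FObj (unit_functor e0 e1) a) = a"
        "FObj (Tgt FibGraph) (FObj (unit_functor e0 e1) a) = a"
      by (simp_all add: uf)
  next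
    fix k assume "k \<in> Arr (Gr0 FibGraph)"
    then show "FArr (Src FibGraph) (FArr (unit_functor e0 e1) k) = k"
        "FArr (Tgt FibGraph) (FArr (unit_functor e0 e1) k) = k"
      by (simp_all add: ua)
  next
    fix x assume x: "x \<in> Obj FibPairs"
    obtain y z where yz: "x = (y, z)" by (rule prod.exhaust)
    have xx: "fibration y" "fibration z" "Cod C (fst y) = Dom C (fst z)" using x unfolding yz by simp_all
    show "case x of (x, y) \<Rightarrow> FObj (Src FibGraph) (FObj (comp_functor m0 m1) (x, y)) = FObj (Src FibGraph) x \<and>
       FObj (Tgt FibGraph) (FObj (comp_functor m0 m1) (x, y)) = FObj (Tgt FibGraph) y"
      unfolding yz using xx cf[OF xx] fibration_arr by simp
  next
    fix \<alpha> assume a: "\<alpha> \<in> Arr FibPairs"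
    obtain \<beta> \<gamma> where bc: "\<alpha> = (\<beta>, \<gamma>)" by (rule prod.exhaust)
    have m': "\<beta> \<in> Arr Fib" "\<gamma> \<in> Arr Fib" "snd (label \<beta>) = fst (label \<gamma>)" using a unfolding bc by simp_all
    show "case \<alpha> of (\<alpha>, \<beta>) \<Rightarrow> FArr (Src FibGraph) (FArr (comp_functor m0 m1) (\<alpha>, \<beta>)) = FArr (Src FibGraph) \<alpha> \<and>
       FArr (Tgt FibGraph) (FArr (comp_functor m0 m1) (\<alpha>, \<beta>)) = FArr (Tgt FibGraph) \<beta>"
      unfolding bc using m' ca[OF m'] by simp
  next
    fix x assume "x \<in> Obj (Gr1 FibGraph)"
    then have x: "fibration x" by simp
    note xa = fibration_arr[OF x]
    show "FObj (comp_functor m0 m1) (FObj (unit_functor e0 e1) (FObj (Src FibGraph) x), x) = x"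
      "FObj (comp_functor m0 m1) (x, FObj (unit_functor e0 e1) (FObj (Tgt FibGraph) x)) = x"
      using x xa by (simp_all add: uf ul ur)
  next
    fix \<alpha> assume "\<alpha> \<in> Arr (Gr1 FibGraph)"
    then have a: "\<alpha> \<in> Arr Fib" by simp
    note A = Fib_arrD[OF a]
    show "FArr (comp_functor m0 m1) (FArr (unit_functor e0 e1) (FArr (Src FibGraph) \<alpha>), \<alpha>) = \<alpha>"
      using a A ua[OF A(4)] by (simp add: ul prod_eq_iff)
    show "FArr (comp_functor m0 m1) (\<alpha>, FArr (unit_functor e0 e1) (FArr (Tgt FibGraph) \<alpha>)) = \<alpha>"
      using a A ua[OF A(5)] by (simp add: ur prod_eq_iff)
  next
    fix x y z assume "(x, y) \<in> Obj FibPairs \<and> (y, z) \<in> Obj FibPairs"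
    then have a: "fibration x" "fibration y" "fibration z" "Cod C (fst x) = Dom C (fst y)"
        "Cod C (fst y) = Dom C (fst z)"
      by simp_all
    show "FObj (comp_functor m0 m1) (FObj (comp_functor m0 m1) (x, y), z) =
       FObj (comp_functor m0 m1) (x, FObj (comp_functor m0 m1) (y, z))"
      using a cf[OF a(1,2,4)] cf[OF a(2,3,5)] as[OF a] a(1-3)[THEN fibration_arr] by simp
  next
    fix \<alpha> \<beta> \<gamma> assume "(\<alpha>, \<beta>) \<in> Arr FibPairs \<and> (\<beta>, \<gamma>) \<in> Arr FibPairs"
    then have a: "\<alpha> \<in> Arr Fib" "\<beta> \<in> Arr Fib" "\<gamma> \<in> Arr Fib" "snd (label \<alpha>) = fst (label \<beta>)"
        "snd (label \<beta>) = fst (label \<gamma>)"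
      by auto
    note A = Fib_arrD[OF a(1)] and B = Fib_arrD[OF a(2)] and D = Fib_arrD[OF a(3)]
      and e1 = FibPairs_arr_meet[OF a(1,2,4)] and e2 = FibPairs_arr_meet[OF a(2,3,5)]
    show "FArr (comp_functor m0 m1) (FArr (comp_functor m0 m1) (\<alpha>, \<beta>), \<gamma>) =
       FArr (comp_functor m0 m1) (\<alpha>, FArr (comp_functor m0 m1) (\<beta>, \<gamma>))"
      using a ca[OF a(1,2,4)] ca[OF a(2,3,5)] as[OF A(1) B(1) D(1) e1(1) e2(1)] as[OF A(2) B(2) D(2)
          e1(2) e2(2)]
      by simp
  qed
qed

end

context exponentiable_arrow begin

lemma forget_simps [simp]:
  "fibration x \<Longrightarrow> FObj (forget_fibrations C p) x = fst x"
  "\<alpha> \<in> Arr Fib \<Longrightarrow> FArr (forget_fibrations C p) \<alpha> = (fst (source \<alpha>), label \<alpha>, fst (target \<alpha>))"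
  by (simp_all add: forget_fibrations_def)

lemma identity_functor_simps [simp]:
  "x \<in> Obj C \<Longrightarrow> FObj (identity_functor C) x = x" "f \<in> Arr C \<Longrightarrow> FArr (identity_functor C) f = f"
  by (simp_all add: identity_functor_def)

lemma forget_arr: "\<alpha> \<in> Arr Fib \<Longrightarrow> (fst (source \<alpha>), label \<alpha>, fst (target \<alpha>)) \<in> Arr (arrow_category C)"
  using Fib_arrD[of \<alpha>] fib_mor_square by simp

lemma forget_graph_morphism:
  "is_graph_morphism FibGraph (squares_graph C) (identity_functor C) (forget_fibrations C p)"
  unfolding is_graph_morphism_def
proof (intro conjI ballI)
  show "is_functor (Gr0 FibGraph) (Gr0 (squares_graph C)) (identity_functor C)"
    by (rule functorI) (simp_all, simp_all add: identity_functor_def)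
  show "is_functor (Gr1 FibGraph) (Gr1 (squares_graph C)) (forget_fibrations C p)"
  proof (rule functorI)
    fix \<alpha> assume "\<alpha> \<in> Arr (Gr1 FibGraph)"
    then have a: "\<alpha> \<in> Arr Fib" by simp
    show "FArr (forget_fibrations C p) \<alpha> \<in> Arr (Gr1 (squares_graph C)) \<and>
         Dom (Gr1 (squares_graph C)) (FArr (forget_fibrations C p) \<alpha>) =
             FObj (forget_fibrations C p) (Dom (Gr1 FibGraph) \<alpha>) \<and>
         Cod (Gr1 (squares_graph C)) (FArr (forget_fibrations C p) \<alpha>) =
             FObj (forget_fibrations C p) (Cod (Gr1 FibGraph) \<alpha>)"
      using a forget_arr[OF a] Fib_arrD[OF a] by (simp del: arrow_category_simps(2))
  qed (simp_all add: fibration_arr, simp_all add: forget_fibrations_def)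
next
  fix x assume "x \<in> Obj (Gr1 FibGraph)"
  then have "fibration x" by simp
  then show "FObj (Src (squares_graph C)) (FObj (forget_fibrations C p) x) =
      FObj (identity_functor C) (FObj (Src FibGraph) x)"
    "FObj (Tgt (squares_graph C)) (FObj (forget_fibrations C p) x) =
        FObj (identity_functor C) (FObj (Tgt FibGraph) x)"
    using fibration_arr[of x] by simp_all
next
  fix \<alpha> assume "\<alpha> \<in> Arr (Gr1 FibGraph)"
  then have a: "\<alpha> \<in> Arr Fib" by simp
  show "FArr (Src (squares_graph C)) (FArr (forget_fibrations C p) \<alpha>) =
      FArr (identity_functor C) (FArr (Src FibGraph) \<alpha>)"
    "FArr (Tgt (squares_graph C)) (FArr (forget_fibrations C p) \<alpha>) =
        FArr (identity_functor C) (FArr (Tgt FibGraph) \<alpha>)"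
    using a forget_arr[OF a] Fib_arrD(4,5)[OF a] by (simp_all del: arrow_category_simps(2))
qed

lemma fib_algebra_structure:
  assumes alg: "fib_algebra e0 e1 m0 m1"
  shows "(unit_functor e0 e1, comp_functor m0 m1) \<in> double_category_structures C p"
proof -
  have e: "unit_square e0 e1" and m: "mult_square m0 m1" using alg by (simp_all add: fib_algebra_def)
  note D = fib_algebra_double_category[OF alg]
  have "is_double_functor FibGraph (unit_functor e0 e1) (comp_functor m0 m1)
     (squares_graph C) (squares_unit C) (squares_comp C) (identity_functor C) (forget_fibrations C p)"
    unfolding is_double_functor_def
  proof (intro conjI ballI D squares_double_category forget_graph_morphism)
    fix a assume "a \<in> Obj (Gr0 FibGraph)"
    then show "FObj (forget_fibrations C p) (FObj (unit_functor e0 e1) a) =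
        FObj (squares_unit C) (FObj (identity_functor C) a)"
      by (simp add: unit_fib_fibration[OF e])
  next
    fix k assume "k \<in> Arr (Gr0 FibGraph)"
    then show "FArr (forget_fibrations C p) (FArr (unit_functor e0 e1) k) =
        FArr (squares_unit C) (FArr (identity_functor C) k)"
      by (simp add: unit_fib_fibration[OF e] unit_arr[OF e])
  next
    fix x assume x: "x \<in> Obj FibPairs"
    obtain y z where yz: "x = (y, z)" by (rule prod.exhaust)
    have xx: "fibration y" "fibration z" "Cod C (fst y) = Dom C (fst z)" using x unfolding yz by simp_all
    show "case x of (x, y) \<Rightarrow> FObj (forget_fibrations C p) (FObj (comp_functor m0 m1) (x, y)) =
        FObj (squares_comp C) (FObj (forget_fibrations C p) x, FObj (forget_fibrations C p) y)"
      unfolding yz using xx comp_fib_fibration[OF m xx] fibration_arr by simp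
  next
    fix \<alpha> assume a: "\<alpha> \<in> Arr FibPairs"
    obtain \<beta> \<gamma> where bc: "\<alpha> = (\<beta>, \<gamma>)" by (rule prod.exhaust)
    have m': "\<beta> \<in> Arr Fib" "\<gamma> \<in> Arr Fib" "snd (label \<beta>) = fst (label \<gamma>)" using a unfolding bc by simp_all
    note B = Fib_arrD[OF m'(1)] and G = Fib_arrD[OF m'(2)]
    show "case \<alpha> of (\<alpha>, \<beta>) \<Rightarrow> FArr (forget_fibrations C p) (FArr (comp_functor m0 m1) (\<alpha>, \<beta>)) =
        FArr (squares_comp C) (FArr (forget_fibrations C p) \<alpha>, FArr (forget_fibrations C p) \<beta>)"
      unfolding bc using m' comp_arr[OF m m'] forget_arr[OF m'(1)] forget_arr[OF m'(2)]
        comp_fib_fibration(2)[OF m B(1) G(1) FibPairs_arr_meet(1)[OF m']] comp_fib_fibration(2)[OF m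
            B(2) G(2) FibPairs_arr_meet(2)[OF m']]
      by (simp del: arrow_category_simps(2))
  qed
  then show ?thesis using D by (simp add: double_category_structures_def)
qed

abbreviation "x\<^sub>0 \<equiv> (HF P P, HA P P, FC P P)"
abbreviation "y\<^sub>0 \<equiv> (FG P P, FA P P, GC P P)"

lemma universal_fibs: "fibration x\<^sub>0" "fibration y\<^sub>0" "Cod C (HF P P) = Dom C (FG P P)"
  using fibration_universal[OF P_poly] PP_arrows by simp_all

text \<open>The universal pair is classified by identities, so a multiplication is recovered as the
  structure on the composite of the universal pair.\<close>

lemma comp_fib_universal:
  assumes "mult_square m0 m1"
  shows "comp_fib m0 m1 x\<^sub>0 y\<^sub>0 = (FG P P \<cdot> HF P P, m0, m1)"
proof -
  note M = mult_squareD[OF assms]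
  have "classifies P P (HF P P) (HA P P) (FC P P) (FG P P) (FA P P) (GC P P)
     (Idn C (Dom C (HF P P))) (Idn C (Dom C (FG P P))) (Idn C (Dom C (GC P P)))"
    by (rule classifiesI) (use PP_arrows in simp_all)
  from comp_fib_classifies[OF universal_fibs this, of m0 m1] M show ?thesis by simp
qed

lemma to_terminal_terminal [simp]: "to_terminal C T = Idn C T"
  by (rule terminal_unique) simp_all

text \<open>Since the forgetful morphism is a double functor, the underlying arrows and squares of units
  and composites are known; only the fibration structures are free. Evaluate them at \<open>1\<close> and at the
  universal pair. The functor \<open>I\<close> applied to the arrow \<open>X \<rightarrow> 1\<close>, and the functor \<open>M\<close> applied to the
  classifying morphism of a pair, are morphisms of fibrations that determine all other values.\<close>

lemma structure_fib_algebra: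
  assumes "(I, M) \<in> double_category_structures C p"
  shows "\<exists>e0 e1 m0 m1. fib_algebra e0 e1 m0 m1 \<and> I = unit_functor e0 e1 \<and> M = comp_functor m0 m1"
proof -
  let ?U = "forget_fibrations C p"
  have D: "is_double_category FibGraph I M" and U:
      "is_double_functor FibGraph I M (squares_graph C) (squares_unit C) (squares_comp C)
      (identity_functor C) ?U"
    using assms by (simp_all add: double_category_structures_def)
  have I: "is_functor C Fib I" and M: "is_functor FibPairs Fib M" using D by (simp_all add:
      is_double_category_def)
  have IO: "fibration (FObj I X)" "fst (FObj I X) = Idn C X" if X: "X \<in> Obj C" for X
  proof -
    show f: "fibration (FObj I X)" using functorD(1)[OF I X] by simp
    have "FObj ?U (FObj I X) = FObj (squares_unit C) (FObj (identity_functor C) X)"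
      using U X by (simp add: is_double_functor_def)
    then show "fst (FObj I X) = Idn C X" using f X by simp
  qed
  have IA: "FArr I k \<in> Arr Fib" "FArr I k = (FObj I (Dom C k), (k, k), FObj I (Cod C k))" if k:
      "k \<in> Arr C" for k
  proof -
    note A = functor_arrowD[OF I k]
    show "FArr I k \<in> Arr Fib" by (fact A)
    have "FArr ?U (FArr I k) = FArr (squares_unit C) (FArr (identity_functor C) k)"
      using U k by (simp add: is_double_functor_def)
    then have "label (FArr I k) = (k, k)" using A(1) k by simp
    then show "FArr I k = (FObj I (Dom C k), (k, k), FObj I (Cod C k))" using A by (simp add: prod_eq_iff)
  qed
  have MO: "fibration (FObj M (x, y))" "fst (FObj M (x, y)) = fst y \<cdot> fst x"
    if xy: "fibration x" "fibration y" "Cod C (fst x) = Dom C (fst y)" for x y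
  proof -
    have o: "(x, y) \<in> Obj FibPairs" using xy by simp
    show f: "fibration (FObj M (x, y))" using functorD(1)[OF M o] by simp
    have "FObj ?U (FObj M (x, y)) = FObj (squares_comp C) (FObj ?U x, FObj ?U y)"
      using U o unfolding is_double_functor_def by blast
    then show "fst (FObj M (x, y)) = fst y \<cdot> fst x" using f xy fibration_arr by simp
  qed
  have MA: "FArr M (\<alpha>, \<beta>) \<in> Arr Fib"
    "FArr M (\<alpha>, \<beta>) = (FObj M (source \<alpha>, source \<beta>), (fst (label \<alpha>), snd (label \<beta>)), FObj M (target \<alpha>,
        target \<beta>))"
    if a: "\<alpha> \<in> Arr Fib" "\<beta> \<in> Arr Fib" "snd (label \<alpha>) = fst (label \<beta>)" for \<alpha> \<beta>
  proof -
    have o: "(\<alpha>, \<beta>) \<in> Arr FibPairs" using a by simp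
    note A = functor_arrowD[OF M o]
    show "FArr M (\<alpha>, \<beta>) \<in> Arr Fib" by (fact A)
    have "FArr ?U (FArr M (\<alpha>, \<beta>)) = FArr (squares_comp C) (FArr ?U \<alpha>, FArr ?U \<beta>)"
      using U o unfolding is_double_functor_def by blast
    then have "label (FArr M (\<alpha>, \<beta>)) = (fst (label \<alpha>), snd (label \<beta>))"
      using A(1) a forget_arr[OF a(1)] forget_arr[OF a(2)] by (simp del: arrow_category_simps(2))
    then show "FArr M (\<alpha>, \<beta>) = (FObj M (source \<alpha>, source \<beta>), (fst (label \<alpha>), snd (label \<beta>)),
        FObj M (target \<alpha>, target \<beta>))"
      using A by (simp add: prod_eq_iff)
  qed
  define e0 where "e0 = fst (snd (FObj I T))"
  define e1 where "e1 = snd (snd (FObj I T))"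
  define m0 where "m0 = fst (snd (FObj M (x\<^sub>0, y\<^sub>0)))"
  define m1 where "m1 = snd (snd (FObj M (x\<^sub>0, y\<^sub>0)))"
  have IT: "FObj I T = (Idn C T, e0, e1)" using IO(2)[of T] by (simp add: e0_def e1_def prod_eq_iff)
  then have e: "unit_square e0 e1" using IO(1)[of T] by (simp add: unit_square_def fibration_def)
  have uc: "Cod C (fst x\<^sub>0) = Dom C (fst y\<^sub>0)" using universal_fibs(3) by simp
  have MT: "FObj M (x\<^sub>0, y\<^sub>0) = (FG P P \<cdot> HF P P, m0, m1)"
    using MO(2)[OF universal_fibs(1,2) uc] by (simp add: m0_def m1_def prod_eq_iff)
  then have m: "mult_square m0 m1"
    using MO(1)[OF universal_fibs(1,2) uc] by (simp add: mult_square_def fibration_def poly_comp_def)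
  have IX: "FObj I X = unit_fib e0 e1 X" if X: "X \<in> Obj C" for X
  proof -
    have t: "to_terminal C X \<in> Arr C" using X by simp
    have "fib_mor (FObj I X) (to_terminal C X) (to_terminal C X) (Idn C T, e0, e1)"
      using Fib_arrD(3)[OF IA(1)[OF t]] IA(2)[OF t] X IT by simp
    then show ?thesis using IO(2)[OF X] by (simp add: fib_mor_iff unit_fib_def prod_eq_iff)
  qed
  have MX: "FObj M (x, y) = comp_fib m0 m1 x y"
    if xy: "fibration x" "fibration y" "Cod C (fst x) = Dom C (fst y)" for x y
  proof -
    obtain f u v where x: "x = (f, u, v)" by (metis prod.collapse)
    obtain g u' v' where y: "y = (g, u', v')" by (metis prod.collapse)
    have F: "fibration (f, u, v)" "fibration (g, u', v')" "Cod C f = Dom C g" using xy by (simp_all add: x y)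
    obtain a b c where cl: "classifies P P f u v g u' v' a b c" by (rule fibs_classified[OF F])
    note S = classifiesD[OF cl]
    have al: "(x, (a, b), x\<^sub>0) \<in> Arr Fib"
      using xy universal_fibs fibrationD[OF F(1)] F(3) S PP_arrows unfolding x
      by (simp add: Fib_arr fib_morI)
    have be: "(y, (b, c), y\<^sub>0) \<in> Arr Fib"
      using xy universal_fibs fibrationD[OF F(2)] F(3) S PP_arrows unfolding y
      by (simp add: Fib_arr fib_morI)
    have "fib_mor (FObj M (x, y)) a c (FG P P \<cdot> HF P P, m0, m1)"
      using Fib_arrD(3)[OF MA(1)[OF al be]] MA(2)[OF al be] MT by simp
    then have "FObj M (x, y) = (g \<cdot> f, m0 \<cdot> a, m1 \<cdot> c)"
      using MO(2)[OF xy] by (simp add: fib_mor_iff prod_eq_iff x y)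
    then show ?thesis using comp_fib_classifies[OF F cl] by (simp add: x y)
  qed
  have IU: "I = unit_functor e0 e1"
    by (rule functor_eqI[OF I unit_functor_functor[OF e]]) (simp_all add: IX IA(2))
  have MU: "M = comp_functor m0 m1"
  proof (rule functor_eqI[OF M comp_functor_functor[OF m]])
    fix x assume x: "x \<in> Obj FibPairs"
    obtain y z where yz: "x = (y, z)" by (rule prod.exhaust)
    show "FObj M x = FObj (comp_functor m0 m1) x" using x unfolding yz by (simp add: MX)
  next
    fix \<alpha> assume a: "\<alpha> \<in> Arr FibPairs"
    obtain \<beta> \<gamma> where bc: "\<alpha> = (\<beta>, \<gamma>)" by (rule prod.exhaust)
    have m': "\<beta> \<in> Arr Fib" "\<gamma> \<in> Arr Fib" "snd (label \<beta>) = fst (label \<gamma>)" using a unfolding bc by simp_all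
    show "FArr M \<alpha> = FArr (comp_functor m0 m1) \<alpha>"
      unfolding bc using m' FibPairs_arr_meet[OF m'] Fib_arrD[OF m'(1)] Fib_arrD[OF m'(2)] by (simp add:
          MA(2) MX)
  qed
  have "fib_algebra e0 e1 m0 m1"
    unfolding fib_algebra_def
  proof (intro conjI allI impI e m)
    fix x assume x: "fibration x"
    note xa = fibration_arr[OF x]
    have "FObj M (x, FObj I (FObj (Tgt FibGraph) x)) = x \<and> FObj M (FObj I (FObj (Src FibGraph) x), x) = x"
      using D x unfolding is_double_category_def by simp
    then show "comp_fib m0 m1 x (unit_fib e0 e1 (Cod C (fst x))) = x"
      "comp_fib m0 m1 (unit_fib e0 e1 (Dom C (fst x))) x = x"
      using x xa by (simp_all add: IX MX unit_fib_fibration[OF e])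
  next
    fix x y z assume "fibration x \<and> fibration y \<and> fibration z \<and> Cod C (fst x) = Dom C (fst y) \<and>
       Cod C (fst y) = Dom C (fst z)"
    then have a: "fibration x" "fibration y" "fibration z" "Cod C (fst x) = Dom C (fst y)"
        "Cod C (fst y) = Dom C (fst z)"
      by auto
    then have "(x, y) \<in> Obj FibPairs" "(y, z) \<in> Obj FibPairs" by simp_all
    then have "FObj M (FObj M (x, y), z) = FObj M (x, FObj M (y, z))"
      using D unfolding is_double_category_def by blast
    then show "comp_fib m0 m1 (comp_fib m0 m1 x y) z = comp_fib m0 m1 x (comp_fib m0 m1 y z)"
      using a comp_fib_fibration[OF m a(1,2,4)] comp_fib_fibration[OF m a(2,3,5)] a(1-3)[THEN fibration_arr]
      by (simp add: MX)
  qed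
  then show ?thesis using IU MU by blast
qed

definition structure_of_monad ::
  "'m poly_cell \<times> 'm poly_cell \<Rightarrow> ('o, 'm, 'm fib, 'm fib_arrow) funct \<times>
    ('m fib \<times> 'm fib, 'm fib_arrow \<times> 'm fib_arrow, 'm fib, 'm fib_arrow) funct" where
  "structure_of_monad = (\<lambda>(\<eta>, \<mu>).
     (unit_functor (fst (label \<eta>)) (snd (label \<eta>)), comp_functor (fst (label \<mu>)) (snd (label \<mu>))))"

lemma unit_functor_inj:
  assumes "unit_square e0 e1" "unit_square e0' e1'" "unit_functor e0 e1 = unit_functor e0' e1'"
  shows "e0 = e0' \<and> e1 = e1'"
proof -
  have "unit_fib e0 e1 T = unit_fib e0' e1' T"
    using assms(3) by (metis unit_functor_simps(1) terminal_obj)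
  then show ?thesis using unit_squareD[OF assms(1)] unit_squareD[OF assms(2)] by (simp add: unit_fib_def)
qed

lemma comp_functor_inj:
  assumes "mult_square m0 m1" "mult_square m0' m1'" "comp_functor m0 m1 = comp_functor m0' m1'"
  shows "m0 = m0' \<and> m1 = m1'"
proof -
  have uc: "Cod C (fst x\<^sub>0) = Dom C (fst y\<^sub>0)" using universal_fibs(3) by simp
  have "comp_fib m0 m1 x\<^sub>0 y\<^sub>0 = comp_fib m0' m1' x\<^sub>0 y\<^sub>0"
    using assms(3) comp_functor_simps(1)[OF universal_fibs(1,2) uc] by metis
  then show ?thesis using comp_fib_universal[OF assms(1)] comp_fib_universal[OF assms(2)] by simp
qed

lemma structure_of_monad_bij:
  "bij_betw structure_of_monad (monad_structures C p) (double_category_structures C p)"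
proof (rule bij_betw_imageI)
  show "inj_on structure_of_monad (monad_structures C p)"
  proof (rule inj_onI)
    fix X Y assume X: "X \<in> monad_structures C p" and Y: "Y \<in> monad_structures C p"
      and eq: "structure_of_monad X = structure_of_monad Y"
    obtain e0 e1 m0 m1 where x: "X = ((J, (e0, e1), P), (PP, (m0, m1), P))" and 1: "fib_algebra e0 e1 m0 m1"
      using X by (cases X) (auto simp: monad_structures_def monad_iff)
    obtain e0' e1' m0' m1' where y: "Y = ((J, (e0', e1'), P), (PP, (m0', m1'), P))" and 2:
        "fib_algebra e0' e1' m0' m1'"
      using Y by (cases Y) (auto simp: monad_structures_def monad_iff)
    have "unit_functor e0 e1 = unit_functor e0' e1'" "comp_functor m0 m1 = comp_functor m0' m1'"
      using eq by (simp_all add: x y structure_of_monad_def)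
    then show "X = Y" using unit_functor_inj comp_functor_inj 1 2 unfolding x y fib_algebra_def by blast
  qed
  show "structure_of_monad ` monad_structures C p = double_category_structures C p"
  proof (intro set_eqI iffI)
    fix Z assume "Z \<in> structure_of_monad ` monad_structures C p"
    then obtain \<eta> \<mu> where Z: "Z = structure_of_monad (\<eta>, \<mu>)" and m: "is_monad (Poly C) T P \<eta> \<mu>"
      by (auto simp: monad_structures_def)
    obtain e0 e1 m0 m1 where x: "\<eta> = (J, (e0, e1), P)" "\<mu> = (PP, (m0, m1), P)" and 1:
        "fib_algebra e0 e1 m0 m1"
      using m unfolding monad_iff by blast
    show "Z \<in> double_category_structures C p"
      using fib_algebra_structure[OF 1] by (simp add: Z x structure_of_monad_def)
  next
    fix Z assume Z: "Z \<in> double_category_structures C p"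
    obtain I M where IM: "Z = (I, M)" by (rule prod.exhaust)
    obtain e0 e1 m0 m1 where a: "fib_algebra e0 e1 m0 m1" "I = unit_functor e0 e1" "M = comp_functor m0 m1"
      using structure_fib_algebra[OF Z[unfolded IM]] by blast
    have "((J, (e0, e1), P), (PP, (m0, m1), P)) \<in> monad_structures C p"
      using a(1) by (auto simp: monad_structures_def monad_iff)
    moreover have "structure_of_monad ((J, (e0, e1), P), (PP, (m0, m1), P)) = Z"
      by (simp add: structure_of_monad_def IM a)
    ultimately show "Z \<in> structure_of_monad ` monad_structures C p" by (metis image_eqI)
  qed
qed

end

theorem theorem5p3p3:
  fixes C :: "('o, 'm) category" and p :: 'm
  assumes "is_category C"
    and "has_finite_limits C"
    and "exponentiable C p"
  shows "\<exists>\<Phi>. bij_betw \<Phi> (monad_structures C p) (double_category_structures C p)"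
proof -
  interpret exponentiable_arrow C p
    using assms by unfold_locales
  show ?thesis using structure_of_monad_bij by blast
qed

end
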